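(* Let $r\in\{1,\dots,10\}$ and let $G=(V,E)$ be a finite graph. For each $r$, let $a_r$ and $c_r$ be the numbers listed below (given to six decimal places): \[ \begin{array}{ccc} r & a_r & c_r\\ 1 & 1.782213 & 3.264251\\ 2 & 1.404909 & 2.621596\\ 3 & 1.280812 & 2.412700\\ 4 & 1.216786 & 2.309224\\ 5 & 1.177179 & 2.247399\\ 6 & 1.150060 & 2.206258\\ 7 & 1.130249 & 2.176891\\ 8 & 1.115110 & 2.154868\\ 9 & 1.103150 & 2.137736\\ 10 & 1.093456 & 2.124024 \end{array} \] If $G$ has chromatic number $2$ (bipartite), then $K(r,G)\le \alpha_r$ for some real number $\alpha_r$ whose decimal expansion begins with the digits of $a_r$ (i.e. $a_r\le \alpha_r< a_r+10^{-6}$). If $G$ has chromatic number $3$ (tripartite), then $K(r,G)\le \gamma_r$ for some real number $\gamma_r$ with $c_r\le\gamma_r<c_r+10^{-6}$.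
   Context: For a finite graph $G=(V,E)$, a symmetric matrix $A\colon V\times V\to\mathbb{R}$ and a positive integer $r$, define \[\mathrm{SDP}_r(G,A)=\max\Big\{\sum_{\{u,v\}\in E}A(u,v)\,f(u)\cdot f(v)\;:\; f\colon V\to S^{r-1}\Big\},\] where $S^{r-1}=\{x\in\mathbb{R}^r: x\cdot x=1\}$; $\mathrm{SDP}_\infty(G,A)$ is defined in the same way with $f$ taking values in the unit sphere of the Hilbert space $\ell^2$ (equivalently, $\mathrm{SDP}_\infty(G,A)=\mathrm{SDP}_{|V|}(G,A)$). The rank-$r$ Grothendieck constant $K(r,G)$ is the smallest constant such that $\mathrm{SDP}_\infty(G,A)\le K(r,G)\,\mathrm{SDP}_r(G,A)$ for all symmetric $A\colon V\times V\to\mathbb{R}$. *)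

theory Defs
  imports Complex_Main
begin

definition simple_graph :: "'v set \<Rightarrow> 'v set set \<Rightarrow> bool" where
  "simple_graph V E \<longleftrightarrow> finite V \<and>
     (\<forall>e\<in>E. \<exists>u v. e = {u, v} \<and> u \<noteq> v \<and> u \<in> V \<and> v \<in> V)"

definition proper_colouring :: "'v set \<Rightarrow> 'v set set \<Rightarrow> nat \<Rightarrow> ('v \<Rightarrow> nat) \<Rightarrow> bool" where
  "proper_colouring V E k c \<longleftrightarrow>
     (\<forall>v\<in>V. c v < k) \<and> (\<forall>u\<in>V. \<forall>v\<in>V. {u, v} \<in> E \<longrightarrow> c u \<noteq> c v)"

definition chromatic_number :: "'v set \<Rightarrow> 'v set set \<Rightarrow> nat" where
  "chromatic_number V E = (LEAST k. \<exists>c. proper_colouring V E k c)"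

text \<open>Vectors of \<open>\<real>^r\<close> are represented by their first r coordinates of a
  function \<open>nat \<Rightarrow> real\<close>.\<close>
definition inner_r :: "nat \<Rightarrow> (nat \<Rightarrow> real) \<Rightarrow> (nat \<Rightarrow> real) \<Rightarrow> real" where
  "inner_r r x y = (\<Sum>i<r. x i * y i)"

definition sphere_map :: "nat \<Rightarrow> 'v set \<Rightarrow> ('v \<Rightarrow> nat \<Rightarrow> real) \<Rightarrow> bool" where
  "sphere_map r V f \<longleftrightarrow> (\<forall>v\<in>V. inner_r r (f v) (f v) = 1)"

text \<open>Objective: sum over undirected edges \<open>{u,v}\<close> of \<open>A u v f(u)\<cdot>f(v)\<close>,
  written as half of the sum over ordered pairs (A symmetric).\<close>
definition sdp_obj :: "nat \<Rightarrow> 'v set \<Rightarrow> 'v set set \<Rightarrow> ('v \<Rightarrow> 'v \<Rightarrow> real) \<Rightarrow> ('v \<Rightarrow> nat \<Rightarrow> real) \<Rightarrow> real" where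
  "sdp_obj r V E A f =
     (1/2) * (\<Sum>(u, v) \<in> {(u, v). u \<in> V \<and> v \<in> V \<and> {u, v} \<in> E}. A u v * inner_r r (f u) (f v))"

definition SDP :: "nat \<Rightarrow> 'v set \<Rightarrow> 'v set set \<Rightarrow> ('v \<Rightarrow> 'v \<Rightarrow> real) \<Rightarrow> real" where
  "SDP r V E A = Sup {sdp_obj r V E A f | f. sphere_map r V f}"

definition SDP_inf :: "'v set \<Rightarrow> 'v set set \<Rightarrow> ('v \<Rightarrow> 'v \<Rightarrow> real) \<Rightarrow> real" where
  "SDP_inf V E A = SDP (card V) V E A"

definition symmetric_on :: "'v set \<Rightarrow> ('v \<Rightarrow> 'v \<Rightarrow> real) \<Rightarrow> bool" where
  "symmetric_on V A \<longleftrightarrow> (\<forall>u\<in>V. \<forall>v\<in>V. A u v = A v u)"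

definition groth_K :: "nat \<Rightarrow> 'v set \<Rightarrow> 'v set set \<Rightarrow> real" where
  "groth_K r V E = Inf {K. \<forall>A. symmetric_on V A \<longrightarrow> SDP_inf V E A \<le> K * SDP r V E A}"

definition a_tab :: "real list" where
  "a_tab = [1.782213, 1.404909, 1.280812, 1.216786, 1.177179,
            1.150060, 1.130249, 1.115110, 1.103150, 1.093456]"

definition c_tab :: "real list" where
  "c_tab = [3.264251, 2.621596, 2.412700, 2.309224, 2.247399,
            2.206258, 2.176891, 2.154868, 2.137736, 2.124024]"

end

theory Submission
  imports Defs "HOL-Probability.Probability" "HOL-Computational_Algebra.Formal_Power_Series"
begin

text \<open>
  Let \<open>E\<^sub>r(\<rho>)\<close> be the expected inner product of \<open>Z x / \<bar>Z x\<bar>\<close> and \<open>Z y / \<bar>Z y\<bar>\<close>, where \<open>Z\<close> is an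
  \<open>r \<times> n\<close> Gaussian matrix and \<open>x, y\<close> are unit vectors with inner product \<open>\<rho>\<close>. Rounding the
  Gram vectors of a kernel \<open>H\<close> with unit diagonal by \<open>Z\<close> shows that \<open>E\<^sub>r(H)\<close> is feasible for \<open>SDP\<^sub>r\<close>
  up to averaging. Krivine's trick is to choose \<open>H\<close> such that \<open>E\<^sub>r(H) = \<beta> G\<close> on the edges for a given
  Gram matrix \<open>G\<close>; since only the edges matter, a power series in \<open>G\<close> costs the sum of the absolute
  values of its coefficients when the graph is bipartite.

  It suffices to solve \<open>E\<^sub>r(H) = \<beta> G\<close> up to an error of small cost, because the error term is bounded
  by a multiple of \<open>SDP\<^sub>\<infinity>\<close>. Writing \<open>H = 2 Q / (1 + Q\<^sup>2)\<close> gives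
  \<open>E\<^sub>r(H) = 2 e\<^sub>r \<Sum>k. \<psi>\<^sub>k Q ^ (2 k + 1)\<close> with rational \<open>\<psi>\<^sub>k\<close>, \<open>\<bar>\<psi>\<^sub>k\<bar> \<le> 1\<close>, and this series converges
  geometrically also where the power series of \<open>E\<^sub>r\<close> itself converges too slowly. For bipartite graphs \<open>Q\<close> is an
  explicit polynomial in \<open>G\<close>, checked by exact integer arithmetic. For tripartite graphs, where a negative
  coefficient costs a factor 2, the choice \<open>Q = 3/8 G\<close> is already good enough.
\<close>

section \<open>Positive semidefinite kernels\<close>

text \<open>The obstacle: a sharp bipartite constant forces \<open>H\<close> to use its whole
  budget, cost 1, and the power series of the rounding kernel has radius of convergence 1 with
  branch points at 1 and -1. At cost 1 its tail decays only polynomially. The substitution means Q =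
  tan (arcsin H / 2), and in the certificates the cost of Q stays at or below 0.67, so at most 24
  terms are kept. The model case is r = 1, where the rounding kernel is (2 / pi) arcsin: there Q =
  tan (a G) and H = sin (2 a G) with sinh (2 a) = 1, which is Krivine's solution, and the first
  certificate is a rounded form of it. For larger r the inverse is only computed numerically. Since
  every deviation from an exact solution is paid for in proportion to its cost, a truncated and
  rounded inverse is good enough, and the sign pattern of the infinite inverse series never enters.
  All costs are subadditive and submultiplicative, so the estimates read like norm estimates in a
  Banach algebra of kernels in which only the pairs of differently coloured vertices are
  visible.\<close>

definition psd_on :: "'v set \<Rightarrow> ('v \<Rightarrow> 'v \<Rightarrow> real) \<Rightarrow> bool" where
  "psd_on V H \<longleftrightarrow> (\<forall>u\<in>V. \<forall>v\<in>V. H u v = H v u) \<and>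
     (\<forall>x. 0 \<le> (\<Sum>u\<in>V. \<Sum>v\<in>V. x u * x v * H u v))"

lemma psd_onI:
  assumes "\<And>u v. u \<in> V \<Longrightarrow> v \<in> V \<Longrightarrow> H u v = H v u"
    and "\<And>x. 0 \<le> (\<Sum>u\<in>V. \<Sum>v\<in>V. x u * x v * H u v)"
  shows "psd_on V H"
  using assms by (auto simp: psd_on_def)

lemma psd_on_sym: "psd_on V H \<Longrightarrow> u \<in> V \<Longrightarrow> v \<in> V \<Longrightarrow> H u v = H v u"
  by (auto simp: psd_on_def)

lemma psd_on_nonneg: "psd_on V H \<Longrightarrow> 0 \<le> (\<Sum>u\<in>V. \<Sum>v\<in>V. x u * x v * H u v)"
  by (auto simp: psd_on_def)

lemma psd_on_cong:
  assumes "\<And>u v. u \<in> V \<Longrightarrow> v \<in> V \<Longrightarrow> H u v = H' u v"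
  shows "psd_on V H \<longleftrightarrow> psd_on V H'"
proof -
  have "(\<Sum>u\<in>V. \<Sum>v\<in>V. x u * x v * H u v) = (\<Sum>u\<in>V. \<Sum>v\<in>V. x u * x v * H' u v)" for x
    using assms by (intro sum.cong) auto
  then show ?thesis
    using assms by (simp add: psd_on_def)
qed

lemma inner_r_abs_le: "2 * \<bar>inner_r n x y\<bar> \<le> inner_r n x x + inner_r n y y"
proof -
  have "2 * \<bar>inner_r n x y\<bar> \<le> 2 * (\<Sum>i<n. \<bar>x i * y i\<bar>)"
    by (simp add: inner_r_def)
  also have "\<dots> \<le> (\<Sum>i<n. x i * x i + y i * y i)"
    unfolding sum_distrib_left
  proof (rule sum_mono)
    fix i
    have "0 \<le> (\<bar>x i\<bar> - \<bar>y i\<bar>)\<^sup>2" by simp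
    then show "2 * \<bar>x i * y i\<bar> \<le> x i * x i + y i * y i"
      by (simp add: power2_eq_square abs_mult algebra_simps)
  qed
  finally show ?thesis
    by (simp add: inner_r_def sum.distrib)
qed

lemma psd_on_gram: "psd_on V (\<lambda>u v. inner_r n (f u) (f v))"
proof (rule psd_onI)
  fix x :: "'a \<Rightarrow> real"
  have "(\<Sum>u\<in>V. \<Sum>v\<in>V. x u * x v * inner_r n (f u) (f v))
      = (\<Sum>u\<in>V. \<Sum>v\<in>V. \<Sum>i<n. (x u * f u i) * (x v * f v i))"
    by (simp add: inner_r_def sum_distrib_left algebra_simps)
  also have "\<dots> = (\<Sum>u\<in>V. \<Sum>i<n. \<Sum>v\<in>V. (x u * f u i) * (x v * f v i))"
    by (intro sum.cong refl sum.swap)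
  also have "\<dots> = (\<Sum>i<n. \<Sum>u\<in>V. \<Sum>v\<in>V. (x u * f u i) * (x v * f v i))"
    by (rule sum.swap)
  also have "\<dots> = (\<Sum>i<n. (\<Sum>u\<in>V. x u * f u i)\<^sup>2)"
    by (simp add: power2_eq_square sum_product)
  finally show "0 \<le> (\<Sum>u\<in>V. \<Sum>v\<in>V. x u * x v * inner_r n (f u) (f v))"
    by (simp add: sum_nonneg)
qed (simp add: inner_r_def mult.commute)

lemma psd_on_add: "psd_on V H \<Longrightarrow> psd_on V K \<Longrightarrow> psd_on V (\<lambda>u v. H u v + K u v)"
  by (simp add: psd_on_def distrib_left sum.distrib)

lemma psd_on_scale:
  assumes "0 \<le> c" "psd_on V H" shows "psd_on V (\<lambda>u v. c * H u v)"
proof (rule psd_onI)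
  fix x :: "'a \<Rightarrow> real"
  have "(\<Sum>u\<in>V. \<Sum>v\<in>V. x u * x v * (c * H u v)) = c * (\<Sum>u\<in>V. \<Sum>v\<in>V. x u * x v * H u v)"
    by (simp add: sum_distrib_left algebra_simps)
  then show "0 \<le> (\<Sum>u\<in>V. \<Sum>v\<in>V. x u * x v * (c * H u v))"
    using assms by (simp add: psd_on_nonneg)
qed (use assms in \<open>auto simp: psd_on_def\<close>)

lemma psd_on_one: "psd_on V (\<lambda>u v. 1)"
  using psd_on_gram[of V 1 "\<lambda>_ _. 1"] by (simp add: inner_r_def)

lemma psd_on_diagonal:
  assumes "finite V" "\<And>v. v \<in> V \<Longrightarrow> 0 \<le> d v"
  shows "psd_on V (\<lambda>u v. if u = v then d u else 0)"
proof (rule psd_onI)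
  fix x :: "'a \<Rightarrow> real"
  have "(\<Sum>u\<in>V. \<Sum>v\<in>V. x u * x v * (if u = v then d u else 0)) = (\<Sum>u\<in>V. x u * x u * d u)"
  proof (rule sum.cong[OF refl])
    fix u assume "u \<in> V"
    have "(\<Sum>v\<in>V. x u * x v * (if u = v then d u else 0)) = (\<Sum>v\<in>V. if u = v then x u * x v * d u else 0)"
      by (intro sum.cong) auto
    then show "(\<Sum>v\<in>V. x u * x v * (if u = v then d u else 0)) = x u * x u * d u"
      using assms \<open>u \<in> V\<close> by simp
  qed
  also have "\<dots> \<ge> 0"
    using assms by (intro sum_nonneg) simp
  finally show "0 \<le> (\<Sum>u\<in>V. \<Sum>v\<in>V. x u * x v * (if u = v then d u else 0))" .
qed auto

lemma quadratic_form_insert: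
  assumes "finite V" "w \<notin> V" and sym: "\<And>u. u \<in> V \<Longrightarrow> H u w = H w u"
  shows "(\<Sum>u\<in>insert w V. \<Sum>v\<in>insert w V. x u * x v * H u v) =
    (\<Sum>u\<in>V. \<Sum>v\<in>V. x u * x v * H u v) + 2 * x w * (\<Sum>u\<in>V. x u * H u w) + (x w)\<^sup>2 * (H w w :: real)"
proof -
  have "(\<Sum>u\<in>insert w V. \<Sum>v\<in>insert w V. x u * x v * H u v) =
      x w * x w * H w w + (\<Sum>v\<in>V. x w * x v * H w v)
      + (\<Sum>u\<in>V. x u * x w * H u w + (\<Sum>v\<in>V. x u * x v * H u v))"
    using assms by simp
  moreover have "(\<Sum>v\<in>V. x w * x v * H w v) = x w * (\<Sum>u\<in>V. x u * H u w)"
    unfolding sum_distrib_left using sym by (intro sum.cong) auto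
  moreover have "(\<Sum>u\<in>V. x u * x w * H u w) = x w * (\<Sum>u\<in>V. x u * H u w)"
    unfolding sum_distrib_left by (intro sum.cong) auto
  ultimately show ?thesis
    by (simp add: sum.distrib power2_eq_square algebra_simps)
qed

lemma psd_on_diag_nonneg:
  assumes "finite V" "psd_on V H" "w \<in> V" shows "0 \<le> H w w"
proof -
  have "(\<Sum>u\<in>V. \<Sum>v\<in>V. (if u = w then 1 else 0) * (if v = w then 1 else 0) * H u v)
      = (\<Sum>u\<in>V. \<Sum>v\<in>V. if u = w then (if v = w then H w w else 0) else 0)"
    by (intro sum.cong) auto
  also have "\<dots> = (\<Sum>u\<in>V. if u = w then H w w else 0)"
    using assms by (intro sum.cong) auto
  also have "\<dots> = H w w"
    using assms by simp
  finally show ?thesis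
    using psd_on_nonneg[OF assms(2), of "\<lambda>u. if u = w then 1 else 0"] by simp
qed

lemma psd_on_subset:
  assumes "psd_on V H" "finite V" "W \<subseteq> V" shows "psd_on W H"
proof (rule psd_onI)
  fix x :: "'a \<Rightarrow> real"
  define y where "y u = (if u \<in> W then x u else 0)" for u
  have "(\<Sum>u\<in>V. \<Sum>v\<in>V. y u * y v * H u v) = (\<Sum>u\<in>W. \<Sum>v\<in>V. y u * y v * H u v)"
    using assms by (intro sum.mono_neutral_right) (auto simp: y_def)
  also have "\<dots> = (\<Sum>u\<in>W. \<Sum>v\<in>W. y u * y v * H u v)"
    using assms by (intro sum.cong sum.mono_neutral_right) (auto simp: y_def)
  also have "\<dots> = (\<Sum>u\<in>W. \<Sum>v\<in>W. x u * x v * H u v)"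
    by (intro sum.cong) (auto simp: y_def)
  finally show "0 \<le> (\<Sum>u\<in>W. \<Sum>v\<in>W. x u * x v * H u v)"
    using psd_on_nonneg[OF assms(1), of y] by simp
qed (use assms in \<open>auto simp: psd_on_def subset_iff\<close>)

text \<open>The induction step is one step of the Cholesky decomposition: the Schur complement of
  \<^term>\<open>H w w\<close> is again positive semidefinite. When \<^term>\<open>H w w = 0\<close>, division by zero turns
  the formulas into the right ones, since then the whole row of \<^term>\<open>w\<close> vanishes.\<close>

theorem psd_on_gram_representation:
  assumes "finite V" "psd_on V H"
  shows "\<exists>f. \<forall>u\<in>V. \<forall>v\<in>V. H u v = inner_r (card V) (f u) (f v)"
  using assms
proof (induction V arbitrary: H rule: finite_induct)
  case empty
  show ?case by simp
next
  case (insert w V)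
  let ?h = "H w w" and ?n = "card V"
  have sym: "H u v = H v u" if "u \<in> insert w V" "v \<in> insert w V" for u v
    using psd_on_sym[OF insert.prems that] .
  have h0: "0 \<le> ?h"
    by (rule psd_on_diag_nonneg[OF _ insert.prems]) (use insert.hyps in simp_all)
  have row: "H u w = 0" if "u \<in> V" "?h = 0" for u
  proof (rule ccontr)
    assume ne: "H u w \<noteq> 0"
    have ps: "psd_on (insert w {u}) H"
      by (rule psd_on_subset[OF insert.prems]) (use insert.hyps that in auto)
    have "u \<noteq> w" using that insert.hyps by auto
    \<comment> \<open>With \<open>?h = 0\<close> the quadratic form is affine in the weight at
      \<open>w\<close>; this weight makes it negative as soon as \<open>H u w\<close> is
      nonzero.\<close>
    define x where "x v = (if v = w then - (H u u + 1) / H u w else 1)" for v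
    have "0 \<le> (\<Sum>a\<in>insert w {u}. \<Sum>b\<in>insert w {u}. x a * x b * H a b)"
      by (rule psd_on_nonneg[OF ps])
    also have "\<dots> = H u u + 2 * (- (H u u + 1) / H u w) * H u w"
    proof (subst quadratic_form_insert)
      show "H v w = H w v" if "v \<in> {u}" for v
        using that \<open>u \<in> V\<close> sym by blast
    qed (use \<open>u \<noteq> w\<close> \<open>?h = 0\<close> in \<open>simp_all add: x_def\<close>)
    also have "\<dots> = - H u u - 2"
      using ne by (simp add: field_simps)
    finally have "0 \<le> - H u u - 2" .
    moreover have "0 \<le> H u u"
        by (rule psd_on_diag_nonneg[OF _ insert.prems]) (use insert.hyps that in simp_all)
    ultimately show False
      by linarith
  qed
  define H' where "H' u v = H u v - H u w * H v w / ?h" for u v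
  have "psd_on V H'"
  proof (rule psd_onI)
    fix x :: "'a \<Rightarrow> real"
    define T where "T = (\<Sum>u\<in>V. x u * H u w)"
    \<comment> \<open>The weight at \<open>w\<close> that minimizes the form when the other weights
      are fixed; the minimum is the form of the Schur complement.\<close>
    define y where "y = x(w := - T / ?h)"
    have yx: "y u = x u" if "u \<in> V" for u
      using that insert.hyps by (auto simp: y_def)
    have "0 \<le> (\<Sum>u\<in>insert w V. \<Sum>v\<in>insert w V. y u * y v * H u v)"
      by (rule psd_on_nonneg[OF insert.prems])
    also have "\<dots> = (\<Sum>u\<in>V. \<Sum>v\<in>V. y u * y v * H u v) + 2 * y w * (\<Sum>u\<in>V. y u * H u w) + (y w)\<^sup>2 * ?h"
      using insert.hyps sym by (intro quadratic_form_insert) auto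
    also have "(\<Sum>u\<in>V. \<Sum>v\<in>V. y u * y v * H u v) = (\<Sum>u\<in>V. \<Sum>v\<in>V. x u * x v * H u v)"
      using yx by (intro sum.cong) auto
    also have "(\<Sum>u\<in>V. y u * H u w) = T"
      unfolding T_def using yx by (intro sum.cong) auto
    also have "(\<Sum>u\<in>V. \<Sum>v\<in>V. x u * x v * H u v) + 2 * y w * T + (y w)\<^sup>2 * ?h
        = (\<Sum>u\<in>V. \<Sum>v\<in>V. x u * x v * H u v) - T * T / ?h"
      by (cases "?h = 0") (simp_all add: y_def power2_eq_square)
    also have "T * T / ?h = (\<Sum>u\<in>V. \<Sum>v\<in>V. x u * x v * (H u w * H v w / ?h))"
      unfolding T_def sum_product sum_divide_distrib by (intro sum.cong) (auto simp: algebra_simps)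
    finally show "0 \<le> (\<Sum>u\<in>V. \<Sum>v\<in>V. x u * x v * H' u v)"
      by (simp add: H'_def right_diff_distrib sum_subtractf)
  qed (simp add: H'_def mult.commute sym)
  then obtain f where f: "\<And>u v. u \<in> V \<Longrightarrow> v \<in> V \<Longrightarrow> H' u v = inner_r ?n (f u) (f v)"
    using insert.IH by blast
  define g where "g u i = (if u = w then (if i = ?n then sqrt ?h else 0)
      else if i < ?n then f u i else H u w / sqrt ?h)" for u i
  have wV: "w \<notin> V" by fact
  have g_uv: "inner_r (Suc ?n) (g u) (g v) = H u v" if "u \<in> V" "v \<in> V" for u v
  proof -
    have "u \<noteq> w" "v \<noteq> w" using that wV by auto
    then have "inner_r (Suc ?n) (g u) (g v) = inner_r ?n (f u) (f v) + H u w * H v w / ?h"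
      using h0 by (simp add: inner_r_def g_def)
    then show ?thesis
      using f[OF that] by (simp add: H'_def)
  qed
  have g_uw: "inner_r (Suc ?n) (g u) (g w) = H u w" if "u \<in> V" for u
  proof -
    have "u \<noteq> w" using that wV by auto
    moreover have "H u w / sqrt ?h * sqrt ?h = H u w"
      using row[OF that] h0 by (cases "?h = 0") auto
    ultimately show ?thesis
      by (simp add: inner_r_def g_def)
  qed
  have g_wu: "inner_r (Suc ?n) (g w) (g u) = H w u" if "u \<in> V" for u
    using g_uw[OF that] sym[of u w] that by (simp add: inner_r_def mult.commute)
  have g_ww: "inner_r (Suc ?n) (g w) (g w) = H w w"
    using h0 by (simp add: inner_r_def g_def wV)
  show ?case
  proof (intro exI[of _ g] ballI)
    fix u v assume uv: "u \<in> insert w V" "v \<in> insert w V"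
    have "card (insert w V) = Suc ?n"
      using insert.hyps by simp
    moreover have "inner_r (Suc ?n) (g u) (g v) = H u v"
    proof (cases "u = w")
      case True
      then show ?thesis
        using uv(2) g_wu[of v] g_ww by (cases "v = w") simp_all
    next
      case False
      then show ?thesis
        using uv g_uw[of u] g_uv[of u v] by (cases "v = w") simp_all
    qed
    ultimately show "H u v = inner_r (card (insert w V)) (g u) (g v)"
      by (simp only:)
  qed
qed

text \<open>Schur product theorem: a Gram factorization of \<open>H\<close> splits the form of the
  product into a sum over coordinates of forms of \<open>K\<close>, with weights
  \<open>x u * f u i\<close>.\<close>

lemma psd_on_mult:
  assumes "finite V" "psd_on V H" "psd_on V K"
  shows "psd_on V (\<lambda>u v. H u v * K u v)"
proof -
  obtain f where f: "\<And>u v. u \<in> V \<Longrightarrow> v \<in> V \<Longrightarrow> H u v = inner_r (card V) (f u) (f v)"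
    using psd_on_gram_representation[OF assms(1,2)] by blast
  show ?thesis
  proof (rule psd_onI)
    fix x :: "'a \<Rightarrow> real"
    have "(\<Sum>u\<in>V. \<Sum>v\<in>V. x u * x v * (H u v * K u v))
        = (\<Sum>u\<in>V. \<Sum>v\<in>V. \<Sum>i<card V. (x u * f u i) * (x v * f v i) * K u v)"
      by (intro sum.cong refl)
        (simp add: f inner_r_def sum_distrib_left sum_distrib_right algebra_simps)
    also have "\<dots> = (\<Sum>u\<in>V. \<Sum>i<card V. \<Sum>v\<in>V. (x u * f u i) * (x v * f v i) * K u v)"
      by (intro sum.cong refl sum.swap)
    also have "\<dots> = (\<Sum>i<card V. \<Sum>u\<in>V. \<Sum>v\<in>V. (x u * f u i) * (x v * f v i) * K u v)"
      by (rule sum.swap)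
    also have "\<dots> \<ge> 0"
      by (intro sum_nonneg psd_on_nonneg[OF assms(3)])
    finally show "0 \<le> (\<Sum>u\<in>V. \<Sum>v\<in>V. x u * x v * (H u v * K u v))" .
  next
    fix u v assume "u \<in> V" "v \<in> V"
    then show "H u v * K u v = H v u * K v u"
      using psd_on_sym[OF assms(2), of u v] psd_on_sym[OF assms(3), of u v] by simp
  qed
qed

lemma psd_on_suminf:
  assumes "\<And>n. psd_on V (H n)"
    and s: "\<And>u v. u \<in> V \<Longrightarrow> v \<in> V \<Longrightarrow> summable (\<lambda>n. H n u v)"
  shows "psd_on V (\<lambda>u v. \<Sum>n. H n u v)"
proof (rule psd_onI)
  fix x :: "'a \<Rightarrow> real"
  have "(\<lambda>n. \<Sum>u\<in>V. \<Sum>v\<in>V. x u * x v * H n u v) sums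
      (\<Sum>u\<in>V. \<Sum>v\<in>V. x u * x v * (\<Sum>n. H n u v))"
    by (intro sums_sum sums_mult summable_sums s)
  from sums_le[OF _ sums_zero this]
  show "0 \<le> (\<Sum>u\<in>V. \<Sum>v\<in>V. x u * x v * (\<Sum>n. H n u v))"
    using psd_on_nonneg[OF assms(1)] by blast
next
  fix u v assume "u \<in> V" "v \<in> V"
  then show "(\<Sum>n. H n u v) = (\<Sum>n. H n v u)"
    by (intro arg_cong[where f = suminf] ext psd_on_sym[OF assms(1)])
qed

lemma psd_on_abs_le:
  assumes "finite V" "psd_on V H" "u \<in> V" "v \<in> V"
  shows "2 * \<bar>H u v\<bar> \<le> H u u + H v v"
proof -
  obtain f where f: "\<And>u v. u \<in> V \<Longrightarrow> v \<in> V \<Longrightarrow> H u v = inner_r (card V) (f u) (f v)"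
    using psd_on_gram_representation[OF assms(1,2)] by blast
  show ?thesis
    using inner_r_abs_le[of "card V" "f u" "f v"] f assms(3,4) by simp
qed

section \<open>Kernels dominated across colour classes\<close>

text \<open>The cost of a kernel on the differently coloured pairs: the smallest \<open>B\<close> such that it extends there to a
  positive semidefinite kernel with diagonal at most \<open>B\<close>.\<close>

definition dominated :: "'v set \<Rightarrow> ('v \<Rightarrow> nat) \<Rightarrow> ('v \<Rightarrow> 'v \<Rightarrow> real) \<Rightarrow> real \<Rightarrow> bool" where
  "dominated V c K B \<longleftrightarrow> (\<exists>P. psd_on V P \<and> (\<forall>v\<in>V. P v v \<le> B) \<and>
     (\<forall>u\<in>V. \<forall>v\<in>V. c u \<noteq> c v \<longrightarrow> K u v = P u v))"

lemma dominatedI: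
  assumes "psd_on V P" "\<And>v. v \<in> V \<Longrightarrow> P v v \<le> B"
    and "\<And>u v. u \<in> V \<Longrightarrow> v \<in> V \<Longrightarrow> c u \<noteq> c v \<Longrightarrow> K u v = P u v"
  shows "dominated V c K B"
  using assms by (auto simp: dominated_def)

lemma dominatedE:
  assumes "dominated V c K B"
  obtains P where "psd_on V P" "\<And>v. v \<in> V \<Longrightarrow> P v v \<le> B"
    and "\<And>u v. u \<in> V \<Longrightarrow> v \<in> V \<Longrightarrow> c u \<noteq> c v \<Longrightarrow> K u v = P u v"
  using assms by (auto simp: dominated_def)

lemma dominated_mono: "dominated V c K B \<Longrightarrow> B \<le> B' \<Longrightarrow> dominated V c K B'"
  unfolding dominated_def by (meson order_trans)

lemma dominated_cong:
  assumes "dominated V c K B"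
    and "\<And>u v. u \<in> V \<Longrightarrow> v \<in> V \<Longrightarrow> c u \<noteq> c v \<Longrightarrow> K u v = K' u v"
  shows "dominated V c K' B"
  using assms unfolding dominated_def by force

lemma dominated_add:
  assumes "dominated V c K B" "dominated V c K' B'"
  shows "dominated V c (\<lambda>u v. K u v + K' u v) (B + B')"
proof -
  obtain P where P: "psd_on V P" "\<And>v. v \<in> V \<Longrightarrow> P v v \<le> B"
    "\<And>u v. u \<in> V \<Longrightarrow> v \<in> V \<Longrightarrow> c u \<noteq> c v \<Longrightarrow> K u v = P u v"
    using dominatedE[OF assms(1)] by blast
  obtain P' where P': "psd_on V P'" "\<And>v. v \<in> V \<Longrightarrow> P' v v \<le> B'"
    "\<And>u v. u \<in> V \<Longrightarrow> v \<in> V \<Longrightarrow> c u \<noteq> c v \<Longrightarrow> K' u v = P' u v"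
    using dominatedE[OF assms(2)] by blast
  show ?thesis
    by (rule dominatedI[OF psd_on_add[OF P(1) P'(1)]])
      (simp_all add: P(2,3) P'(2,3) add_mono)
qed

lemma dominated_cmult:
  assumes "0 \<le> a" "dominated V c K B"
  shows "dominated V c (\<lambda>u v. a * K u v) (a * B)"
proof -
  obtain P where P: "psd_on V P" "\<And>v. v \<in> V \<Longrightarrow> P v v \<le> B"
    "\<And>u v. u \<in> V \<Longrightarrow> v \<in> V \<Longrightarrow> c u \<noteq> c v \<Longrightarrow> K u v = P u v"
    using dominatedE[OF assms(2)] by blast
  show ?thesis
    by (rule dominatedI[OF psd_on_scale[OF assms(1) P(1)]])
      (simp_all add: P(2,3) assms(1) mult_left_mono)
qed

text \<open>Costs are submultiplicative by the Schur product theorem, because the diagonal of a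
  product kernel is the product of the diagonals. This is what allows power series of kernels to be
  estimated term by term.\<close>

lemma dominated_mult:
  assumes "finite V" "dominated V c K B" "dominated V c K' B'"
  shows "dominated V c (\<lambda>u v. K u v * K' u v) (B * B')"
proof -
  obtain P where P: "psd_on V P" "\<And>v. v \<in> V \<Longrightarrow> P v v \<le> B"
    "\<And>u v. u \<in> V \<Longrightarrow> v \<in> V \<Longrightarrow> c u \<noteq> c v \<Longrightarrow> K u v = P u v"
    using dominatedE[OF assms(2)] by blast
  obtain P' where P': "psd_on V P'" "\<And>v. v \<in> V \<Longrightarrow> P' v v \<le> B'"
    "\<And>u v. u \<in> V \<Longrightarrow> v \<in> V \<Longrightarrow> c u \<noteq> c v \<Longrightarrow> K' u v = P' u v"
    using dominatedE[OF assms(3)] by blast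
  have nonneg: "0 \<le> P v v" "0 \<le> P' v v" if "v \<in> V" for v
    using psd_on_diag_nonneg[OF assms(1) P(1) that] psd_on_diag_nonneg[OF assms(1) P'(1) that]
    by auto
  show ?thesis
  proof (rule dominatedI[OF psd_on_mult[OF assms(1) P(1) P'(1)]])
    fix v assume "v \<in> V"
    then show "P v v * P' v v \<le> B * B'"
      using P(2)[of v] P'(2)[of v] nonneg[of v] by (intro mult_mono) auto
  qed (simp add: P(3) P'(3))
qed

lemma dominated_one: "dominated V c (\<lambda>u v. 1) 1"
  by (rule dominatedI[OF psd_on_one]) auto

lemma dominated_power:
  assumes "finite V" "dominated V c K B"
  shows "dominated V c (\<lambda>u v. K u v ^ n) (B ^ n)"
proof (induction n)
  case 0
  show ?case using dominated_one by simp
next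
  case (Suc n)
  from dominated_mult[OF assms Suc] show ?case by simp
qed

lemma dominated_abs_le:
  assumes "finite V" "dominated V c K B" "u \<in> V" "v \<in> V" "c u \<noteq> c v"
  shows "\<bar>K u v\<bar> \<le> B"
proof -
  obtain P where P: "psd_on V P" "\<And>v. v \<in> V \<Longrightarrow> P v v \<le> B"
    "\<And>u v. u \<in> V \<Longrightarrow> v \<in> V \<Longrightarrow> c u \<noteq> c v \<Longrightarrow> K u v = P u v"
    using dominatedE[OF assms(2)] by blast
  show ?thesis
    using psd_on_abs_le[OF assms(1) P(1) assms(3,4)] P(2)[OF assms(3)] P(2)[OF assms(4)]
      P(3)[OF assms(3-5)] by linarith
qed

lemma dominated_suminf:
  assumes "finite V" "\<And>n. dominated V c (K n) (B n)" "summable B"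
  shows "dominated V c (\<lambda>u v. \<Sum>n. K n u v) (\<Sum>n. B n)"
proof -
  have "\<exists>P. psd_on V P \<and> (\<forall>v\<in>V. P v v \<le> B n) \<and>
     (\<forall>u\<in>V. \<forall>v\<in>V. c u \<noteq> c v \<longrightarrow> K n u v = P u v)" for n
    using assms(2)[of n] by (simp add: dominated_def)
  then obtain P where P: "\<And>n. psd_on V (P n)" "\<And>n v. v \<in> V \<Longrightarrow> P n v v \<le> B n"
    "\<And>n u v. u \<in> V \<Longrightarrow> v \<in> V \<Longrightarrow> c u \<noteq> c v \<Longrightarrow> K n u v = P n u v"
    by metis
  \<comment> \<open>The bound covers pairs inside a colour class too, where \<open>P n\<close> is
    not tied to \<open>K n\<close>; hence the extensions can be summed on all of
    \<open>V\<close>.\<close>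
  have "\<bar>P n u v\<bar> \<le> B n" if "u \<in> V" "v \<in> V" for n u v
    using psd_on_abs_le[OF assms(1) P(1)[of n] that] P(2)[OF that(1), of n] P(2)[OF that(2), of n]
    by linarith
  then have s: "summable (\<lambda>n. P n u v)" if "u \<in> V" "v \<in> V" for u v
    using that by (intro summable_comparison_test'[OF assms(3), of 0]) simp
  show ?thesis
    by (rule dominatedI[OF psd_on_suminf[OF P(1) s]])
      (auto intro!: suminf_le suminf_cong s assms(3) P(2,3))
qed

text \<open>Changing a sign costs a factor \<^term>\<open>k\<close> for \<^term>\<open>Suc k\<close> colours: multiply by the Gram
  matrix of the vertices of a regular simplex, whose off-diagonal entries are \<^term>\<open>- 1 / k\<close>.\<close>

lemma dominated_uminus:
  assumes "finite V" "dominated V c K B" "0 < k" and col: "\<And>v. v \<in> V \<Longrightarrow> c v < Suc k"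
  shows "dominated V c (\<lambda>u v. - K u v) (real k * B)"
proof -
  define Z where "Z u v = (if c u = c v then 1 else - 1 / real k)" for u v
  \<comment> \<open>The simplex vertices are the standard basis vectors of dimension k + 1 minus
    their barycentre. These have squared length k / (k + 1), and \<open>q\<close> rescales them to
    unit vectors.\<close>
  define q where "q = sqrt ((real k + 1) / real k)"
  have qq: "q * q = (real k + 1) / real k"
    by (simp add: q_def)
  define f where "f u j = ((if c u = j then 1 else 0) - 1 / (real k + 1)) * q" for u j
  have "Z u v = inner_r (Suc k) (f u) (f v)" if "u \<in> V" "v \<in> V" for u v
  proof -
    let ?e = "\<lambda>u j. (if c u = j then 1 else 0) :: real" and ?a = "1 / (real k + 1)"
    have *: "(real k + 1) * (?a * ?a) = ?a"
      by simp
    have e2: "(\<Sum>j<Suc k. ?e u j * ?e v j) = (if c u = c v then 1 else 0)"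
    proof -
      have "(\<Sum>j<Suc k. ?e u j * ?e v j) = (\<Sum>j<Suc k. if c u = j then ?e v (c u) else 0)"
        by (intro sum.cong) auto
      then show ?thesis
        using col[OF that(1)] by (simp del: sum.lessThan_Suc)
    qed
    have e1: "(\<Sum>j<Suc k. ?e u j) = 1" "(\<Sum>j<Suc k. ?e v j) = 1"
      using col[OF that(1)] col[OF that(2)] by (simp_all del: sum.lessThan_Suc)
    have "inner_r (Suc k) (f u) (f v)
        = (\<Sum>j<Suc k. (?e u j * ?e v j - ?a * ?e u j - ?a * ?e v j + ?a * ?a) * (q * q))"
      unfolding inner_r_def f_def
      by (intro sum.cong refl) (simp only: algebra_simps)
    also have "\<dots> = ((\<Sum>j<Suc k. ?e u j * ?e v j) - ?a * (\<Sum>j<Suc k. ?e u j)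
        - ?a * (\<Sum>j<Suc k. ?e v j) + (real k + 1) * (?a * ?a)) * (q * q)"
      by (simp only: sum_distrib_right[symmetric] sum_distrib_left[symmetric] sum.distrib
          sum_subtractf sum_constant card_lessThan of_nat_Suc add.commute mult.assoc)
    also have "\<dots> = ((if c u = c v then 1 else 0) - ?a) * ((real k + 1) / real k)"
      unfolding e1 e2 * qq by simp
    also have "\<dots> = Z u v"
    proof (cases "c u = c v")
      case True
      have "1 - ?a = real k / (real k + 1)"
        by (simp add: field_simps)
      then show ?thesis
        using True assms(3) by (simp add: Z_def)
    next
      case False
      have "real k + 1 \<noteq> 0" by linarith
      then show ?thesis
        using False by (simp add: Z_def)
    qed
    finally show ?thesis ..
  qed
  then have Z: "psd_on V Z"
    by (intro iffD2[OF psd_on_cong psd_on_gram[of V "Suc k" f]])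
  obtain P where P: "psd_on V P" "\<And>v. v \<in> V \<Longrightarrow> P v v \<le> B"
    "\<And>u v. u \<in> V \<Longrightarrow> v \<in> V \<Longrightarrow> c u \<noteq> c v \<Longrightarrow> K u v = P u v"
    using dominatedE[OF assms(2)] by blast
  show ?thesis
  proof (rule dominatedI[OF psd_on_scale[OF _ psd_on_mult[OF assms(1) P(1) Z], of "real k"]])
    fix v assume "v \<in> V"
    then show "real k * (P v v * Z v v) \<le> real k * B"
      using P(2)[of v] by (simp add: Z_def mult_left_mono)
  next
    fix u v assume "u \<in> V" "v \<in> V" "c u \<noteq> c v"
    then show "- K u v = real k * (P u v * Z u v)"
      using P(3)[of u v] assms(3) by (simp add: Z_def)
  qed simp
qed

section \<open>Edge sums, SDP values and the Grothendieck constant\<close>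

text \<open>The objective as a linear functional of an arbitrary kernel, so that it can also be
  evaluated on error terms, which are not Gram kernels of sphere maps.\<close>

definition edge_form :: "'v set \<Rightarrow> 'v set set \<Rightarrow> ('v \<Rightarrow> 'v \<Rightarrow> real) \<Rightarrow> ('v \<Rightarrow> 'v \<Rightarrow> real) \<Rightarrow> real" where
  "edge_form V E A K = (1/2) * (\<Sum>(u, v) \<in> {(u, v). u \<in> V \<and> v \<in> V \<and> {u, v} \<in> E}. A u v * K u v)"

lemma sdp_obj_eq_edge_form: "sdp_obj r V E A f = edge_form V E A (\<lambda>u v. inner_r r (f u) (f v))"
  by (simp add: sdp_obj_def edge_form_def)

lemma edge_form_cong:
  assumes "\<And>u v. u \<in> V \<Longrightarrow> v \<in> V \<Longrightarrow> {u, v} \<in> E \<Longrightarrow> K u v = K' u v"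
  shows "edge_form V E A K = edge_form V E A K'"
proof -
  have "(\<Sum>(u, v) \<in> {(u, v). u \<in> V \<and> v \<in> V \<and> {u, v} \<in> E}. A u v * K u v) =
      (\<Sum>(u, v) \<in> {(u, v). u \<in> V \<and> v \<in> V \<and> {u, v} \<in> E}. A u v * K' u v)"
    using assms by (intro sum.cong) auto
  then show ?thesis
    by (simp add: edge_form_def)
qed

lemma edge_form_add:
  "edge_form V E A (\<lambda>u v. K u v + K' u v) = edge_form V E A K + edge_form V E A K'"
  by (simp add: edge_form_def distrib_left sum.distrib split_def)

lemma edge_form_cmult: "edge_form V E A (\<lambda>u v. a * K u v) = a * edge_form V E A K"
  by (simp add: edge_form_def sum_distrib_left split_def algebra_simps)

lemma sdp_obj_le_SDP:
  assumes "sphere_map r V f"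
  shows "sdp_obj r V E A f \<le> SDP r V E A"
  unfolding SDP_def
proof (rule cSup_upper)
  let ?S = "{(u, v). u \<in> V \<and> v \<in> V \<and> {u, v} \<in> E}"
  have "sdp_obj r V E A g \<le> (1/2) * (\<Sum>(u, v)\<in>?S. \<bar>A u v\<bar>)" if g: "sphere_map r V g" for g
    unfolding sdp_obj_def
  proof (intro mult_left_mono sum_mono)
    fix p assume "p \<in> ?S"
    then obtain u v where p: "p = (u, v)" "u \<in> V" "v \<in> V" by auto
    have "\<bar>inner_r r (g u) (g v)\<bar> \<le> 1"
      using inner_r_abs_le[of r "g u" "g v"] g p by (simp add: sphere_map_def)
    then have "\<bar>A u v * inner_r r (g u) (g v)\<bar> \<le> \<bar>A u v\<bar> * 1"
      unfolding abs_mult by (intro mult_left_mono) auto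
    then show "(case p of (u, v) \<Rightarrow> A u v * inner_r r (g u) (g v)) \<le> (case p of (u, v) \<Rightarrow> \<bar>A u v\<bar>)"
      by (simp add: p)
  qed simp
  then show "bdd_above {sdp_obj r V E A f |f. sphere_map r V f}"
    by (intro bdd_aboveI[of _ "(1/2) * (\<Sum>(u, v)\<in>?S. \<bar>A u v\<bar>)"]) auto
qed (use assms in blast)

lemma exists_sphere_map:
  assumes "0 < r" shows "\<exists>f. sphere_map r V f"
proof (intro exI)
  show "sphere_map r V (\<lambda>v i. if i = 0 then 1 else 0)"
    using assms by (auto simp: sphere_map_def inner_r_def if_distrib cong: if_cong)
qed

text \<open>Edges never see the diagonal, so the diagonal of the extension can be raised to exactly
  \<open>B\<close>; dividing by \<open>B\<close> then leaves a Gram matrix of unit vectors. This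
  rescaling fails for \<open>B = 0\<close>, where \<open>K\<close> vanishes on all edges
  anyway.\<close>

lemma edge_form_dominated_le:
  assumes fin: "finite V" and dom: "dominated V c K B" and "0 \<le> B"
    and col: "\<And>u v. u \<in> V \<Longrightarrow> v \<in> V \<Longrightarrow> {u, v} \<in> E \<Longrightarrow> c u \<noteq> c v"
  shows "edge_form V E A K \<le> B * SDP_inf V E A"
proof (cases "B = 0")
  case True
  have "edge_form V E A K = edge_form V E A (\<lambda>u v. 0 * K u v)"
    using dominated_abs_le[OF fin dom] col by (intro edge_form_cong) (force simp: True)
  then show ?thesis
    unfolding edge_form_cmult by (simp add: True)
next
  case False
  with assms have B: "0 < B" by simp
  obtain P where P: "psd_on V P" "\<And>v. v \<in> V \<Longrightarrow> P v v \<le> B"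
    "\<And>u v. u \<in> V \<Longrightarrow> v \<in> V \<Longrightarrow> c u \<noteq> c v \<Longrightarrow> K u v = P u v"
    using dominatedE[OF dom] by blast
  define Q where "Q u v = (1 / B) * (P u v + (if u = v then B - P u u else 0))" for u v
  have "psd_on V Q"
    unfolding Q_def using B P(2)
    by (intro psd_on_scale psd_on_add P(1) psd_on_diagonal fin) auto
  then obtain f where f: "\<And>u v. u \<in> V \<Longrightarrow> v \<in> V \<Longrightarrow> Q u v = inner_r (card V) (f u) (f v)"
    using psd_on_gram_representation[OF fin] by blast
  have "sphere_map (card V) V f"
    unfolding sphere_map_def using B by (auto simp: Q_def simp flip: f)
  then have "sdp_obj (card V) V E A f \<le> SDP_inf V E A"
    unfolding SDP_inf_def by (rule sdp_obj_le_SDP)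
  moreover have "edge_form V E A K = edge_form V E A (\<lambda>u v. B * inner_r (card V) (f u) (f v))"
  proof (rule edge_form_cong)
    fix u v assume uv: "u \<in> V" "v \<in> V" "{u, v} \<in> E"
    then have "c u \<noteq> c v" "u \<noteq> v" using col[of u v] by auto
    then show "K u v = B * inner_r (card V) (f u) (f v)"
      using B uv P(3) by (simp add: Q_def flip: f)
  qed
  ultimately show ?thesis
    using B by (simp add: edge_form_cmult sdp_obj_eq_edge_form)
qed

text \<open>In the absence of loops the objective is affine in each single vector. A zero vector is
  the midpoint of \<open>e\<close> and \<open>- e\<close>, so the value is the mean of two values
  with one zero vector fewer. Rounding can thus be treated outcome by outcome, including those where
  a Gaussian image vanishes.\<close>

lemma edge_form_le_SDP_of_zero_or_unit:
  assumes "finite V" "0 < r" and no_loop: "\<And>v. {v} \<notin> E"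
    and "\<And>v. v \<in> V \<Longrightarrow> inner_r r (f v) (f v) = 1 \<or> inner_r r (f v) (f v) = 0"
  shows "edge_form V E A (\<lambda>u v. inner_r r (f u) (f v)) \<le> SDP r V E A"
  using assms(4)
proof (induction "card {v\<in>V. inner_r r (f v) (f v) = 0}" arbitrary: f rule: less_induct)
  case less
  show ?case
  proof (cases "{v\<in>V. inner_r r (f v) (f v) = 0} = {}")
    case True
    then have "sphere_map r V f"
      using less.prems by (auto simp: sphere_map_def)
    then show ?thesis
      using sdp_obj_le_SDP by (simp add: sdp_obj_eq_edge_form)
  next
    case False
    then obtain w where w: "w \<in> V" "inner_r r (f w) (f w) = 0" by blast
    then have f0: "f w i = 0" if "i < r" for i
      using that by (simp add: inner_r_def sum_nonneg_eq_0_iff)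
    define e :: "nat \<Rightarrow> real" where "e i = (if i = 0 then 1 else 0)" for i
    have e: "inner_r r e e = 1"
      using assms(2) by (simp add: inner_r_def e_def if_distrib cong: if_cong)
    define F where "F s = f(w := (\<lambda>i. s * e i))" for s :: real
    have le: "edge_form V E A (\<lambda>u v. inner_r r (F s u) (F s v)) \<le> SDP r V E A"
      if "s = 1 \<or> s = -1" for s
    proof (rule less.hyps)
      have Fw: "inner_r r (F s w) (F s w) = 1"
        using e that by (auto simp: F_def inner_r_def)
      show "inner_r r (F s v) (F s v) = 1 \<or> inner_r r (F s v) (F s v) = 0" if "v \<in> V" for v
        using less.prems[OF that] Fw by (cases "v = w") (auto simp: F_def)
      show "card {v \<in> V. inner_r r (F s v) (F s v) = 0} < card {v \<in> V. inner_r r (f v) (f v) = 0}"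
      proof (rule psubset_card_mono)
        show "{v \<in> V. inner_r r (F s v) (F s v) = 0} \<subset> {v \<in> V. inner_r r (f v) (f v) = 0}"
          using w Fw by (auto simp: F_def split: if_splits)
      qed (use assms in simp)
    qed
    have "2 * edge_form V E A (\<lambda>u v. inner_r r (f u) (f v))
        = edge_form V E A (\<lambda>u v. 2 * inner_r r (f u) (f v))"
      by (simp add: edge_form_cmult)
    also have "\<dots> = edge_form V E A (\<lambda>u v. inner_r r (F 1 u) (F 1 v) + inner_r r (F (-1) u) (F (-1) v))"
    proof (rule edge_form_cong)
      fix u v assume "{u, v} \<in> E"
      then have "u \<noteq> v" using no_loop[of u] by auto
      then show "2 * inner_r r (f u) (f v)
          = inner_r r (F 1 u) (F 1 v) + inner_r r (F (-1) u) (F (-1) v)"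
        by (auto simp: F_def inner_r_def sum_negf f0)
    qed
    finally show ?thesis
      using le[of 1] le[of "-1"] by (simp add: edge_form_add)
  qed
qed

text \<open>The infimum is controlled only if the admissible constants are bounded below. All-ones
  weights give positive SDP values as soon as there is an edge, so admissible constants are
  nonnegative; with no edge every real number would be admissible.\<close>

lemma groth_K_le:
  assumes fin: "finite V" and "0 < r" "E \<noteq> {}" and sg: "simple_graph V E" and "0 < L"
    and le: "\<And>A. symmetric_on V A \<Longrightarrow> L * SDP_inf V E A \<le> SDP r V E A"
  shows "groth_K r V E \<le> 1 / L"
  unfolding groth_K_def
proof (rule cInf_lower)
  show "1 / L \<in> {K. \<forall>A. symmetric_on V A \<longrightarrow> SDP_inf V E A \<le> K * SDP r V E A}"
    using le \<open>0 < L\<close> by (simp add: field_simps)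
  let ?A = "\<lambda>u v :: 'a. 1 :: real"
  let ?S = "{(u, v). u \<in> V \<and> v \<in> V \<and> {u, v} \<in> E}"
  obtain u v where uv: "u \<in> V" "v \<in> V" "{u, v} \<in> E"
    using sg \<open>E \<noteq> {}\<close> unfolding simple_graph_def by fastforce
  have "?S \<subseteq> V \<times> V" by auto
  then have fS: "finite ?S"
    using fin finite_subset by blast
  have pos: "0 < SDP n V E ?A" if n: "0 < n" for n
  proof -
    have "0 < (1/2) * (\<Sum>(u, v)\<in>?S. 1 :: real)"
      using fS uv by (auto simp: card_gt_0_iff)
    also have "\<dots> = sdp_obj n V E ?A (\<lambda>v i. if i = 0 then 1 else 0)"
      using n by (simp add: sdp_obj_def inner_r_def if_distrib cong: if_cong)
    also have "\<dots> \<le> SDP n V E ?A"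
      using n by (intro sdp_obj_le_SDP) (auto simp: sphere_map_def inner_r_def if_distrib cong: if_cong)
    finally show ?thesis .
  qed
  have "0 < card V"
    using uv fin by (auto simp: card_gt_0_iff)
  show "bdd_below {K. \<forall>A. symmetric_on V A \<longrightarrow> SDP_inf V E A \<le> K * SDP r V E A}"
  proof (rule bdd_belowI[of _ 0], clarify)
    fix K assume "\<forall>A. symmetric_on V A \<longrightarrow> SDP_inf V E A \<le> K * SDP r V E A"
    then have "SDP_inf V E ?A \<le> K * SDP r V E ?A"
      by (simp add: symmetric_on_def)
    then have "0 < K * SDP r V E ?A"
      using pos[OF \<open>0 < card V\<close>] by (simp add: SDP_inf_def)
    then show "0 \<le> K"
      using pos[OF \<open>0 < r\<close>] by (simp add: zero_less_mult_iff)
  qed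
qed

section \<open>Gaussian integrals\<close>

lemma lborel_integral_FTC:
  fixes F f :: "real \<Rightarrow> real"
  assumes "\<And>x. (F has_real_derivative f x) (at x)" "\<And>x. isCont f x" "integrable lborel f"
    and "(F \<longlongrightarrow> A) at_bot" "(F \<longlongrightarrow> B) at_top"
  shows "(\<integral>x. f x \<partial>lborel) = B - A"
proof -
  have "(LBINT x=-\<infinity>..\<infinity>. f x) = B - A"
    by (rule interval_integral_FTC_integrable)
      (use assms in \<open>auto simp: has_real_derivative_iff_has_vector_derivative set_integrable_def
         ereal_tendsto_simps\<close>)
  then show ?thesis
    by (simp add: interval_lebesgue_integral_def set_lebesgue_integral_def)
qed

lemma integral_swap_bounded:
  fixes f :: "'a \<Rightarrow> 'b \<Rightarrow> real"
  assumes M1: "prob_space M1" and M2: "sigma_finite_measure M2"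
    and f: "case_prod f \<in> borel_measurable (M1 \<Otimes>\<^sub>M M2)"
    and int: "\<And>x. x \<in> space M1 \<Longrightarrow> integrable M2 (f x)"
    and bound: "\<And>x. x \<in> space M1 \<Longrightarrow> (\<integral>y. \<bar>f x y\<bar> \<partial>M2) \<le> C"
  shows "(\<integral>x. (\<integral>y. f x y \<partial>M2) \<partial>M1) = (\<integral>y. (\<integral>x. f x y \<partial>M1) \<partial>M2)"
proof -
  interpret M1: prob_space M1 by fact
  interpret M2: sigma_finite_measure M2 by fact
  interpret pair_sigma_finite M1 M2 ..
  have "integrable (M1 \<Otimes>\<^sub>M M2) (case_prod f)"
  proof (rule Fubini_integrable[OF f])
    show "integrable M1 (\<lambda>x. \<integral>y. norm (case_prod f (x, y)) \<partial>M2)"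
    proof (rule M1.integrable_const_bound[where B = C])
      show "AE x in M1. norm (\<integral>y. norm (case_prod f (x, y)) \<partial>M2) \<le> C"
        using bound by (intro AE_I2) (simp add: integral_nonneg_AE)
    qed (use f in measurable)
    show "AE x in M1. integrable M2 (\<lambda>y. case_prod f (x, y))"
      using int by (intro AE_I2) auto
  qed
  then show ?thesis
    by (rule Fubini_integral[symmetric])
qed

lemma integral_swap_dominated:
  fixes f :: "'a \<Rightarrow> 'b \<Rightarrow> real"
  assumes M1: "sigma_finite_measure M1" and M2: "prob_space M2"
    and f: "case_prod f \<in> borel_measurable (M1 \<Otimes>\<^sub>M M2)"
    and g: "integrable M1 g" and fg: "\<And>x y. x \<in> space M1 \<Longrightarrow> y \<in> space M2 \<Longrightarrow> \<bar>f x y\<bar> \<le> g x"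
  shows "(\<integral>y. (\<integral>x. f x y \<partial>M1) \<partial>M2) = (\<integral>x. (\<integral>y. f x y \<partial>M2) \<partial>M1)"
proof (rule integral_swap_bounded[OF M2 M1])
  interpret M1: sigma_finite_measure M1 by fact
  interpret M2: prob_space M2 by fact
  show "(\<lambda>(y, x). f x y) \<in> borel_measurable (M2 \<Otimes>\<^sub>M M1)"
    using measurable_compose[OF measurable_pair_swap' f] by (simp add: split_def)
  show int: "integrable M1 (\<lambda>x. f x y)" if y: "y \<in> space M2" for y
  proof (rule Bochner_Integration.integrable_bound[OF g])
    show "(\<lambda>x. f x y) \<in> borel_measurable M1"
      using measurable_compose[OF measurable_Pair2'[OF y] f] by simp
    show "AE x in M1. norm (f x y) \<le> norm (g x)"
      using fg[OF _ y] by (intro AE_I2) force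
  qed
  show "(\<integral>x. \<bar>f x y\<bar> \<partial>M1) \<le> (\<integral>x. g x \<partial>M1)" if y: "y \<in> space M2" for y
    by (rule integral_mono[OF _ g]) (use int[OF y] fg[OF _ y] in auto)
qed

interpretation std_normal: prob_space std_normal_distribution
  using real_dist_normal_dist by (simp add: real_distribution_def)

lemma std_normal_integral:
  assumes "f \<in> borel_measurable borel"
  shows "(\<integral>x. f x \<partial>std_normal_distribution) = (\<integral>x. std_normal_density x * f x \<partial>lborel)"
    and "integrable std_normal_distribution f \<longleftrightarrow> integrable lborel (\<lambda>x. std_normal_density x * f x)"
  using assms by (simp_all add: integral_density integrable_density)

text \<open>Completing the square: a tilted normal density is a constant times another normal
  density, whose moments yield the integrals of \<open>std_normal_gauss\<close>.\<close>

lemma std_normal_density_exp: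
  fixes q c w :: real
  assumes "-1 < q"
  shows "std_normal_density w * exp (- q * w\<^sup>2 / 2 - c * w) =
    exp (c\<^sup>2 / (2 * (1 + q))) / sqrt (1 + q) * normal_density (- c / (1 + q)) (1 / sqrt (1 + q)) w"
proof -
  let ?p = "1 + q"
  have p: "0 < ?p" using assms by simp
  have "normal_density (- c / ?p) (1 / sqrt ?p) w
      = 1 / sqrt (2 * pi * (1 / ?p)) * exp (- (w + c / ?p)\<^sup>2 / (2 * (1 / ?p)))"
    using p by (simp add: normal_density_def power_divide)
  also have "sqrt (2 * pi * (1 / ?p)) = sqrt (2 * pi) / sqrt ?p"
    by (simp add: real_sqrt_divide)
  also have "- (w + c / ?p)\<^sup>2 / (2 * (1 / ?p)) = - w\<^sup>2 / 2 + (- q * w\<^sup>2 / 2 - c * w) - c\<^sup>2 / (2 * ?p)"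
  proof -
    have "- (w + c / a)\<^sup>2 / (2 * (1 / a)) = - w\<^sup>2 / 2 + (- (a - 1) * w\<^sup>2 / 2 - c * w) - c\<^sup>2 / (2 * a)"
      if "0 < a" for a :: real
      using that by (simp add: field_simps power2_eq_square)
    from this[OF p] show ?thesis by simp
  qed
  also have "exp \<dots> = exp (- w\<^sup>2 / 2) * exp (- q * w\<^sup>2 / 2 - c * w) / exp (c\<^sup>2 / (2 * ?p))"
    by (simp only: exp_add exp_diff)
  finally show ?thesis
    using p by (simp add: std_normal_density_def)
qed

lemma std_normal_gauss:
  fixes q c :: real
  assumes "-1 < q"
  shows "(\<integral>w. exp (- q * w\<^sup>2 / 2 - c * w) \<partial>std_normal_distribution)
      = exp (c\<^sup>2 / (2 * (1 + q))) / sqrt (1 + q)" (is "?A = ?K")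
    and "(\<integral>w. w * exp (- q * w\<^sup>2 / 2 - c * w) \<partial>std_normal_distribution)
      = exp (c\<^sup>2 / (2 * (1 + q))) / sqrt (1 + q) * (- c / (1 + q))" (is "?B = _")
    and "(\<integral>w. w\<^sup>2 * exp (- q * w\<^sup>2 / 2) \<partial>std_normal_distribution) = 1 / sqrt (1 + q) ^ 3" (is "?C = _")
proof -
  let ?m = "- c / (1 + q)" and ?s = "1 / sqrt (1 + q)"
  have s: "0 < ?s" using assms by simp
  have "?A = (\<integral>w. ?K * normal_density ?m ?s w \<partial>lborel)"
    by (subst std_normal_integral) (simp_all only: std_normal_density_exp[OF assms], measurable)
  then show "?A = ?K"
    using s by simp
  have "?B = (\<integral>w. ?K * (normal_density ?m ?s w * w) \<partial>lborel)"
  proof (subst std_normal_integral)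
    show "(\<integral>w. std_normal_density w * (w * exp (- q * w\<^sup>2 / 2 - c * w)) \<partial>lborel)
        = (\<integral>w. ?K * (normal_density ?m ?s w * w) \<partial>lborel)"
    proof (rule Bochner_Integration.integral_cong[OF refl])
      fix w
      have "std_normal_density w * (w * exp (- q * w\<^sup>2 / 2 - c * w))
          = (std_normal_density w * exp (- q * w\<^sup>2 / 2 - c * w)) * w"
        by (simp only: ac_simps)
      then show "std_normal_density w * (w * exp (- q * w\<^sup>2 / 2 - c * w)) = ?K * (normal_density ?m ?s w * w)"
        unfolding std_normal_density_exp[OF assms] by (simp only: ac_simps)
    qed
  qed simp
  then show "?B = ?K * ?m"
    using integral_normal_moment_nz_1[OF s, of ?m] by simp
  have "?C = (\<integral>w. ?s * (normal_density 0 ?s w * w\<^sup>2) \<partial>lborel)"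
  proof (subst std_normal_integral)
    show "(\<integral>w. std_normal_density w * (w\<^sup>2 * exp (- q * w\<^sup>2 / 2)) \<partial>lborel)
        = (\<integral>w. ?s * (normal_density 0 ?s w * w\<^sup>2) \<partial>lborel)"
    proof (rule Bochner_Integration.integral_cong[OF refl])
      fix w
      have "std_normal_density w * (w\<^sup>2 * exp (- q * w\<^sup>2 / 2))
          = (std_normal_density w * exp (- q * w\<^sup>2 / 2 - 0 * w)) * w\<^sup>2"
        by simp
      then show "std_normal_density w * (w\<^sup>2 * exp (- q * w\<^sup>2 / 2)) = ?s * (normal_density 0 ?s w * w\<^sup>2)"
        unfolding std_normal_density_exp[OF assms, of w 0] by simp
    qed
  qed simp
  then show "?C = 1 / sqrt (1 + q) ^ 3"
    using integral_normal_moment_even[OF s, of 0 1]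
    by (simp add: power2_eq_square power3_eq_cube)
qed

lemma char_std_normal: "(\<integral>w. iexp (t * w) \<partial>std_normal_distribution) = complex_of_real (exp (- (t\<^sup>2) / 2))"
  using char_std_normal_distribution by (simp add: char_def fun_eq_iff)

lemma std_normal_cos: "(\<integral>w. cos (t * w) \<partial>std_normal_distribution) = exp (- (t\<^sup>2) / 2)"
proof -
  have int: "integrable std_normal_distribution (\<lambda>w. iexp (t * w))"
    by (rule std_normal.integrable_iexp) simp_all
  have "(\<integral>w. cos (t * w) \<partial>std_normal_distribution) = (\<integral>w. Re (iexp (t * w)) \<partial>std_normal_distribution)"
    by (simp add: Re_exp)
  also have "\<dots> = Re (\<integral>w. iexp (t * w) \<partial>std_normal_distribution)"
    using int by (rule integral_Re)
  also have "\<dots> = exp (- (t\<^sup>2) / 2)"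
    by (simp only: char_std_normal Re_complex_of_real)
  finally show ?thesis .
qed

lemma integrable_std_normal_abs: "integrable std_normal_distribution (\<lambda>w. \<bar>w\<bar>)"
  using integrable_std_normal_distribution_moment[of 1] by simp

lemma std_normal_sin: "(\<integral>w. w * sin (t * w) \<partial>std_normal_distribution) = t * exp (- (t\<^sup>2) / 2)"
proof -
  have int_cos: "integrable std_normal_distribution (\<lambda>w. cos (t * w))"
    by (rule std_normal.integrable_const_bound[where B = 1]) auto
  have int_sin: "integrable std_normal_distribution (\<lambda>w. w * sin (t * w))"
    by (rule Bochner_Integration.integrable_bound[OF integrable_std_normal_abs])
      (auto simp: abs_mult intro!: mult_left_le)
  \<comment> \<open>The boundary term of integration by parts, since the derivative of the density
    is minus \<open>w\<close> times the density.\<close>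
  define F where "F w = - std_normal_density w * sin (t * w)" for w
  define f where "f w = std_normal_density w * (w * sin (t * w) - t * cos (t * w))" for w
  have "(\<integral>w. f w \<partial>lborel) = 0 - 0"
  proof (rule lborel_integral_FTC)
    show "(F has_real_derivative f w) (at w)" for w
    proof -
      have "((\<lambda>w. - (k * exp (- w\<^sup>2 / 2)) * sin (t * w)) has_real_derivative
          k * exp (- w\<^sup>2 / 2) * (w * sin (t * w) - t * cos (t * w))) (at w)" for k
        by (auto intro!: derivative_eq_intros simp: algebra_simps)
      then show ?thesis
        unfolding F_def f_def std_normal_density_def .
    qed
    show "isCont f w" for w
      unfolding f_def std_normal_density_def by (auto intro!: continuous_intros)
    show "integrable lborel f"
      unfolding f_def using int_cos int_sin
      by (subst std_normal_integral(2)[symmetric]) auto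
    have lim: "(std_normal_density \<longlongrightarrow> 0) at_top" "(std_normal_density \<longlongrightarrow> 0) at_bot"
      unfolding std_normal_density_def by real_asymp+
    have "norm (F w) \<le> std_normal_density w" for w
      by (auto simp: F_def abs_mult intro!: mult_left_le)
    then show "(F \<longlongrightarrow> 0) at_bot" "(F \<longlongrightarrow> 0) at_top"
      using lim by (auto intro!: Lim_null_comparison[of F std_normal_density] always_eventually)
  qed
  then have "(\<integral>w. w * sin (t * w) - t * cos (t * w) \<partial>std_normal_distribution) = 0"
    by (subst std_normal_integral) (simp_all add: f_def)
  then show ?thesis
    using int_cos int_sin std_normal_cos by simp
qed

section \<open>Correlated Gaussian pairs\<close>

definition gauss_row :: "nat \<Rightarrow> (nat \<Rightarrow> real) measure" where
  "gauss_row n = PiM {..<n} (\<lambda>_. std_normal_distribution)"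

lemma prob_space_gauss_row: "prob_space (gauss_row n)"
  unfolding gauss_row_def by (intro prob_space_PiM std_normal.prob_space_axioms)

lemma gauss_row_inner_measurable [measurable]: "inner_r n a \<in> borel_measurable (gauss_row n)"
proof -
  have "(\<lambda>z. z i) \<in> borel_measurable (gauss_row n)" if "i \<in> {..<n}" for i
    using measurable_component_singleton[OF that, of "\<lambda>_. std_normal_distribution"]
    by (simp add: gauss_row_def)
  then have "(\<lambda>z. \<Sum>i<n. a i * z i) \<in> borel_measurable (gauss_row n)"
    by (intro borel_measurable_sum borel_measurable_times) auto
  then show ?thesis
    by (simp add: inner_r_def[abs_def])
qed

lemma gauss_row_cos: "(\<integral>z. cos (inner_r n a z) \<partial>gauss_row n) = exp (- inner_r n a a / 2)"
proof -
  interpret prob_space "gauss_row n" by (rule prob_space_gauss_row)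
  interpret P: product_sigma_finite "\<lambda>_::nat. std_normal_distribution"
    by (simp add: product_sigma_finite_def std_normal.sigma_finite_measure_axioms)
  have iexp: "iexp (inner_r n a z) = (\<Prod>i<n. iexp (a i * z i))" for z
    by (simp add: inner_r_def sum_distrib_left exp_sum of_real_sum)
  have int: "integrable std_normal_distribution (\<lambda>w. iexp (t * w))" for t
    by (rule std_normal.integrable_iexp) simp_all
  have "(\<integral>z. iexp (inner_r n a z) \<partial>gauss_row n)
      = (\<Prod>i<n. (\<integral>w. iexp (a i * w) \<partial>std_normal_distribution))"
    unfolding iexp gauss_row_def by (rule P.product_integral_prod) (use int in auto)
  also have "\<dots> = complex_of_real (exp (\<Sum>i<n. - (a i)\<^sup>2 / 2))"
    by (simp only: char_std_normal exp_sum[OF finite_lessThan] of_real_prod)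
  also have "(\<Sum>i<n. - (a i)\<^sup>2 / 2) = - inner_r n a a / 2"
    by (simp add: inner_r_def power2_eq_square sum_negf sum_divide_distrib)
  finally have *: "(\<integral>z. iexp (inner_r n a z) \<partial>gauss_row n) = complex_of_real (exp (- inner_r n a a / 2))" .
  have "(\<integral>z. cos (inner_r n a z) \<partial>gauss_row n) = (\<integral>z. Re (iexp (inner_r n a z)) \<partial>gauss_row n)"
    by (simp add: Re_exp)
  also have "\<dots> = Re (\<integral>z. iexp (inner_r n a z) \<partial>gauss_row n)"
    by (rule integral_Re) (rule integrable_iexp, measurable)
  finally show ?thesis
    unfolding * by simp
qed

lemma inner_r_add_left: "inner_r n (\<lambda>i. x i + y i) z = inner_r n x z + inner_r n y z"
  by (simp add: inner_r_def algebra_simps sum.distrib)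

lemma inner_r_cmult_left: "inner_r n (\<lambda>i. c * x i) z = c * inner_r n x z"
  by (simp add: inner_r_def algebra_simps sum_distrib_left)

lemma inner_r_commute: "inner_r n x y = inner_r n y x"
  by (simp add: inner_r_def mult.commute)

lemma gauss_row_cos_pair:
  assumes a: "inner_r n a a = 1" and b: "inner_r n b b = 1"
  shows "(\<integral>z. cos (x * inner_r n a z + y * inner_r n b z) \<partial>gauss_row n)
    = exp (- (x\<^sup>2 + y\<^sup>2 + 2 * x * y * inner_r n a b) / 2)"
proof -
  let ?c = "\<lambda>i. x * a i + y * b i"
  have "inner_r n ?c z = x * inner_r n a z + y * inner_r n b z" for z
    by (simp add: inner_r_add_left inner_r_cmult_left)
  moreover have "inner_r n ?c ?c = x * (x * 1 + y * inner_r n a b) + y * (x * inner_r n a b + y * 1)"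
    by (simp add: inner_r_add_left inner_r_cmult_left inner_r_commute[of n _ ?c] a b
        inner_r_commute[of n b a] algebra_simps)
  ultimately show ?thesis
    using gauss_row_cos[of n ?c] by (simp add: power2_eq_square algebra_simps)
qed

text \<open>Both factors are written as Gaussian averages of a bounded trigonometric function \<^term>\<open>\<tau>\<close>
  with weight \<^term>\<open>p\<close>; this linearizes their dependence on the row.\<close>

lemma gauss_row_product_swap:
  fixes p \<tau> :: "real \<Rightarrow> real"
  assumes [measurable]: "p \<in> borel_measurable borel" "\<tau> \<in> borel_measurable borel"
    and p: "integrable std_normal_distribution (\<lambda>w. \<bar>p w\<bar>)" and \<tau>: "\<And>x. \<bar>\<tau> x\<bar> \<le> 1"
  shows "(\<integral>z. (\<integral>w. p w * \<tau> (s * w * inner_r n a z) \<partial>std_normal_distribution)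
        * (\<integral>w'. p w' * \<tau> (t * w' * inner_r n b z) \<partial>std_normal_distribution) \<partial>gauss_row n)
    = (\<integral>w. p w * (\<integral>w'. p w' * (\<integral>z. \<tau> (s * w * inner_r n a z) * \<tau> (t * w' * inner_r n b z)
        \<partial>gauss_row n) \<partial>std_normal_distribution) \<partial>std_normal_distribution)" (is "?L = ?R")
proof -
  let ?N = std_normal_distribution and ?R = "gauss_row n"
  interpret R: prob_space ?R by (rule prob_space_gauss_row)
  define C where "C = (\<integral>w. \<bar>p w\<bar> \<partial>?N)"
  define G where "G z = (\<integral>w'. p w' * \<tau> (t * w' * inner_r n b z) \<partial>?N)" for z
  have le: "\<bar>p w * \<tau> x\<bar> \<le> \<bar>p w\<bar>" for w x
    using \<tau>[of x] by (simp add: abs_mult mult_left_le)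
  have G_le: "\<bar>G z\<bar> \<le> C" for z
  proof -
    have "\<bar>G z\<bar> \<le> (\<integral>w'. \<bar>p w' * \<tau> (t * w' * inner_r n b z)\<bar> \<partial>?N)"
      unfolding G_def by (rule integral_abs_bound)
    also have "\<dots> \<le> C"
      unfolding C_def by (rule integral_mono_AE'[OF p]) (auto simp: le)
    finally show ?thesis .
  qed
  have [measurable]: "G \<in> borel_measurable ?R"
    unfolding G_def by measurable
  have 1: "p w * (\<integral>z. \<tau> (s * w * inner_r n a z) * G z \<partial>?R)
      = p w * (\<integral>w'. p w' * (\<integral>z. \<tau> (s * w * inner_r n a z) * \<tau> (t * w' * inner_r n b z) \<partial>?R) \<partial>?N)" for w
  proof -
    have "(\<integral>z. \<tau> (s * w * inner_r n a z) * G z \<partial>?R)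
        = (\<integral>z. (\<integral>w'. \<tau> (s * w * inner_r n a z) * (p w' * \<tau> (t * w' * inner_r n b z)) \<partial>?N) \<partial>?R)"
      by (simp add: G_def)
    also have "\<dots> = (\<integral>w'. (\<integral>z. \<tau> (s * w * inner_r n a z) * (p w' * \<tau> (t * w' * inner_r n b z)) \<partial>?R) \<partial>?N)"
    proof (rule integral_swap_dominated[OF _ R.prob_space_axioms _ p])
      show "\<bar>\<tau> (s * w * inner_r n a z) * (p w' * \<tau> (t * w' * inner_r n b z))\<bar> \<le> \<bar>p w'\<bar>" for w' z
        using mult_mono[OF \<tau> le[of w']] by (simp add: abs_mult)
    qed (simp add: std_normal.sigma_finite_measure_axioms, measurable)
    also have "\<dots> = (\<integral>w'. p w' * (\<integral>z. \<tau> (s * w * inner_r n a z) * \<tau> (t * w' * inner_r n b z) \<partial>?R) \<partial>?N)"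
      by (simp add: mult.left_commute)
    finally show ?thesis by simp
  qed
  have "?L = (\<integral>z. (\<integral>w. p w * \<tau> (s * w * inner_r n a z) * G z \<partial>?N) \<partial>?R)"
    by (simp add: G_def)
  also have "\<dots> = (\<integral>w. (\<integral>z. p w * \<tau> (s * w * inner_r n a z) * G z \<partial>?R) \<partial>?N)"
  proof (rule integral_swap_dominated[OF _ R.prob_space_axioms])
    show "integrable ?N (\<lambda>w. \<bar>p w\<bar> * C)"
      using p by simp
    show "\<bar>p w * \<tau> (s * w * inner_r n a z) * G z\<bar> \<le> \<bar>p w\<bar> * C" for w z
      using mult_mono[OF le G_le] by (simp add: abs_mult)
  qed (simp add: std_normal.sigma_finite_measure_axioms, measurable)
  also have "\<dots> = (\<integral>w. p w * (\<integral>z. \<tau> (s * w * inner_r n a z) * G z \<partial>?R) \<partial>?N)"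
    by (simp add: mult.assoc)
  finally show ?thesis
    by (simp only: 1)
qed

text \<open>The determinant of I + D C, with C the correlation matrix of two standard normals X, Y
  with correlation \<rho> and D = diag (s^2, t^2). Its inverse square root is the expectation of exp
  (- (s^2 X^2 + t^2 Y^2) / 2).\<close>

definition gauss_det :: "real \<Rightarrow> real \<Rightarrow> real \<Rightarrow> real" where
  "gauss_det \<rho> s t = (1 + s\<^sup>2) * (1 + t\<^sup>2) - (\<rho> * s * t)\<^sup>2"

text \<open>The two factors are those produced by integrating out one auxiliary variable after the
  other: 1 + t^2 from the inner integral, the Schur complement from the outer one.\<close>

lemma gauss_det_factor:
  "gauss_det \<rho> s t = (1 + (s\<^sup>2 - (\<rho> * s * t)\<^sup>2 / (1 + t\<^sup>2))) * (1 + t\<^sup>2)"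
proof -
  have "1 + t\<^sup>2 \<noteq> 0"
    using zero_le_power2[of t] by linarith
  then show ?thesis
    by (simp add: gauss_det_def field_simps)
qed

lemma gauss_det_aux:
  fixes \<rho> s t :: real
  assumes "\<bar>\<rho>\<bar> \<le> 1"
  shows "0 \<le> s\<^sup>2 - (\<rho> * s * t)\<^sup>2 / (1 + t\<^sup>2)"
proof -
  have "0 < 1 + t\<^sup>2"
    using zero_le_power2[of t] by linarith
  have "\<rho>\<^sup>2 \<le> 1"
    using assms by (simp add: abs_square_le_1)
  then have "\<rho>\<^sup>2 * (s\<^sup>2 * t\<^sup>2) \<le> 1 * (s\<^sup>2 * t\<^sup>2)"
    by (intro mult_right_mono) auto
  then have "(\<rho> * s * t)\<^sup>2 \<le> s\<^sup>2 * (1 + t\<^sup>2)"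
    by (simp add: power_mult_distrib algebra_simps add_increasing)
  then show ?thesis
    using \<open>0 < 1 + t\<^sup>2\<close> by (simp add: field_simps)
qed

lemma gauss_det_pos: "\<bar>\<rho>\<bar> \<le> 1 \<Longrightarrow> 0 < gauss_det \<rho> s t"
  unfolding gauss_det_factor
  using gauss_det_aux[of \<rho> s t] zero_le_power2[of t] by (intro mult_pos_pos) linarith+

text \<open>The inner integral completes the square in \<open>w'\<close> and leaves a Gaussian in
  \<open>w\<close> with parameter s^2 - k^2 / (1 + t^2). The two signs of \<open>k\<close> are the
  two terms of the product-to-sum formulas for sine and cosine.\<close>

lemma gauss_double_integrals:
  fixes k s t \<rho> :: real
  assumes \<rho>: "\<bar>\<rho>\<bar> \<le> 1" and k: "k = \<rho> * s * t \<or> k = - (\<rho> * s * t)"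
  shows "(\<integral>w. (\<integral>w'. exp (- ((s * w)\<^sup>2 + (t * w')\<^sup>2 + 2 * k * w * w') / 2) \<partial>std_normal_distribution)
      \<partial>std_normal_distribution) = 1 / sqrt (gauss_det \<rho> s t)" (is "?A = _")
    and "(\<integral>w. w * (\<integral>w'. w' * exp (- ((s * w)\<^sup>2 + (t * w')\<^sup>2 + 2 * k * w * w') / 2) \<partial>std_normal_distribution)
      \<partial>std_normal_distribution) = - k / sqrt (gauss_det \<rho> s t) ^ 3" (is "?B = _")
proof -
  let ?N = std_normal_distribution
  define T where "T = 1 + t\<^sup>2"
  have T: "0 < T" using zero_le_power2[of t] by (simp add: T_def add_pos_nonneg)
  define q where "q = s\<^sup>2 - k\<^sup>2 / T"
  have k2: "k\<^sup>2 = (\<rho> * s * t)\<^sup>2" using k by auto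
  have q: "0 \<le> q"
    unfolding q_def k2 T_def by (rule gauss_det_aux[OF \<rho>])
  have det: "gauss_det \<rho> s t = (1 + q) * T"
    by (simp add: gauss_det_factor q_def k2 T_def)
  have split: "exp (- ((s * w)\<^sup>2 + (t * w')\<^sup>2 + 2 * k * w * w') / 2)
      = exp (- (s * w)\<^sup>2 / 2) * exp (- t\<^sup>2 * w'\<^sup>2 / 2 - (k * w) * w')" for w w'
    by (subst exp_add[symmetric]) (simp add: power_mult_distrib field_simps)
  have comb: "exp (- (s * w)\<^sup>2 / 2) * exp ((k * w)\<^sup>2 / (2 * T)) = exp (- q * w\<^sup>2 / 2)" for w
    using T by (subst exp_add[symmetric]) (simp add: q_def power_mult_distrib field_simps)
  have t1: "-1 < t\<^sup>2" using zero_le_power2[of t] by linarith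
  have q1: "-1 < q" using q by linarith
  have "(\<integral>w'. exp (- ((s * w)\<^sup>2 + (t * w')\<^sup>2 + 2 * k * w * w') / 2) \<partial>?N) = exp (- q * w\<^sup>2 / 2 - 0 * w) / sqrt T" for w
    unfolding split using std_normal_gauss(1)[OF t1, of "k * w"] comb[of w] by (simp add: T_def)
  then have "?A = (\<integral>w. exp (- q * w\<^sup>2 / 2 - 0 * w) / sqrt T \<partial>?N)"
    by simp
  also have "\<dots> = 1 / sqrt ((1 + q) * T)"
    using std_normal_gauss(1)[OF q1, of 0] by (simp add: real_sqrt_mult)
  finally show "?A = 1 / sqrt (gauss_det \<rho> s t)"
    by (simp add: det)
  have "w * (\<integral>w'. w' * exp (- ((s * w)\<^sup>2 + (t * w')\<^sup>2 + 2 * k * w * w') / 2) \<partial>?N)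
      = (- k / sqrt T ^ 3) * (w\<^sup>2 * exp (- q * w\<^sup>2 / 2))" for w
  proof -
    have "(\<integral>w'. w' * exp (- ((s * w)\<^sup>2 + (t * w')\<^sup>2 + 2 * k * w * w') / 2) \<partial>?N)
        = exp (- (s * w)\<^sup>2 / 2) * (\<integral>w'. w' * exp (- t\<^sup>2 * w'\<^sup>2 / 2 - (k * w) * w') \<partial>?N)"
      unfolding split
      by (subst integral_mult_right_zero[symmetric])
        (intro Bochner_Integration.integral_cong refl, simp only: ac_simps)
    also have "\<dots> = exp (- (s * w)\<^sup>2 / 2) * (exp ((k * w)\<^sup>2 / (2 * T)) / sqrt T * (- (k * w) / T))"
      unfolding std_normal_gauss(2)[OF t1] T_def by simp
    also have "\<dots> = exp (- q * w\<^sup>2 / 2) / sqrt T * (- (k * w) / T)"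
      unfolding comb[symmetric] by simp
    also have "\<dots> = exp (- q * w\<^sup>2 / 2) * (- (k * w) / sqrt T ^ 3)"
      using T by (simp add: power3_eq_cube)
    finally show ?thesis
      by (simp add: power2_eq_square)
  qed
  then have "?B = (\<integral>w. (- k / sqrt T ^ 3) * (w\<^sup>2 * exp (- q * w\<^sup>2 / 2)) \<partial>?N)"
    by simp
  also have "\<dots> = (- k / sqrt T ^ 3) * (1 / sqrt (1 + q) ^ 3)"
    unfolding std_normal_gauss(3)[OF q1, symmetric] by (rule integral_mult_right_zero)
  finally show "?B = - k / sqrt (gauss_det \<rho> s t) ^ 3"
    by (simp add: det real_sqrt_mult power_mult_distrib)
qed

text \<open>By \<open>c1\<close> and \<open>s1\<close> below, the Gaussian factors are averages of
  cosines and sines over auxiliary normals, so the row integral becomes that of a cosine of a linear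
  form. Only characteristic functions enter, which covers \<rho> = 1 and \<rho> = -1, where the pair
  has no joint density.\<close>

lemma gauss_row_exp:
  assumes a: "inner_r n a a = 1" and b: "inner_r n b b = 1"
  shows "(\<integral>z. exp (- (s * inner_r n a z)\<^sup>2 / 2) * exp (- (t * inner_r n b z)\<^sup>2 / 2) \<partial>gauss_row n)
    = 1 / sqrt (gauss_det (inner_r n a b) s t)" (is "?A = _")
    and "(\<integral>z. (s * inner_r n a z * exp (- (s * inner_r n a z)\<^sup>2 / 2))
      * (t * inner_r n b z * exp (- (t * inner_r n b z)\<^sup>2 / 2)) \<partial>gauss_row n)
    = inner_r n a b * s * t / sqrt (gauss_det (inner_r n a b) s t) ^ 3" (is "?B = _")
proof -
  let ?N = std_normal_distribution and ?R = "gauss_row n" and ?\<rho> = "inner_r n a b"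
  let ?e = "\<lambda>k w w'. exp (- ((s * w)\<^sup>2 + (t * w')\<^sup>2 + 2 * k * w * w') / 2)"
  let ?ok = "\<lambda>k. k = ?\<rho> * s * t \<or> k = - (?\<rho> * s * t)"
  interpret R: prob_space ?R by (rule prob_space_gauss_row)
  have \<rho>: "\<bar>?\<rho>\<bar> \<le> 1"
    using inner_r_abs_le[of n a b] a b by simp
  have intc: "integrable ?R (\<lambda>z. cos (x * inner_r n a z + y * inner_r n b z))" for x y
    by (rule R.integrable_const_bound[where B = 1]) auto
  have plus: "(\<integral>z. cos (s * w * inner_r n a z + t * w' * inner_r n b z) \<partial>?R) = ?e (?\<rho> * s * t) w w'" for w w'
    by (subst gauss_row_cos_pair[OF a b]) (simp add: algebra_simps)
  have minus: "(\<integral>z. cos (s * w * inner_r n a z + (- (t * w')) * inner_r n b z) \<partial>?R) = ?e (- (?\<rho> * s * t)) w w'" for w w'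
    by (subst gauss_row_cos_pair[OF a b]) (simp add: algebra_simps)
  have cc: "(\<integral>z. cos (s * w * inner_r n a z) * cos (t * w' * inner_r n b z) \<partial>?R)
      = (?e (- (?\<rho> * s * t)) w w' + ?e (?\<rho> * s * t) w w') / 2" for w w'
  proof -
    have "(\<integral>z. cos (s * w * inner_r n a z) * cos (t * w' * inner_r n b z) \<partial>?R)
        = (\<integral>z. (cos (s * w * inner_r n a z + (- (t * w')) * inner_r n b z)
          + cos (s * w * inner_r n a z + t * w' * inner_r n b z)) / 2 \<partial>?R)"
      by (simp add: cos_times_cos)
    also have "\<dots> = (?e (- (?\<rho> * s * t)) w w' + ?e (?\<rho> * s * t) w w') / 2"
      unfolding plus[symmetric] minus[symmetric] using intc
      by (simp only: integral_divide_zero Bochner_Integration.integral_add)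
    finally show ?thesis .
  qed
  have ss: "(\<integral>z. sin (s * w * inner_r n a z) * sin (t * w' * inner_r n b z) \<partial>?R)
      = (?e (- (?\<rho> * s * t)) w w' - ?e (?\<rho> * s * t) w w') / 2" for w w'
  proof -
    have "(\<integral>z. sin (s * w * inner_r n a z) * sin (t * w' * inner_r n b z) \<partial>?R)
        = (\<integral>z. (cos (s * w * inner_r n a z + (- (t * w')) * inner_r n b z)
          - cos (s * w * inner_r n a z + t * w' * inner_r n b z)) / 2 \<partial>?R)"
      by (simp add: sin_times_sin)
    also have "\<dots> = (?e (- (?\<rho> * s * t)) w w' - ?e (?\<rho> * s * t) w w') / 2"
      unfolding plus[symmetric] minus[symmetric] using intc
      by (simp only: integral_divide_zero Bochner_Integration.integral_diff)
    finally show ?thesis .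
  qed
  \<comment> \<open>By \<open>plus\<close> and \<open>minus\<close>, \<open>?e\<close> is the mean
    of a cosine, which bounds it directly.\<close>
  have e_le: "?e k w w' \<le> 1" if "?ok k" for k w w'
  proof -
    have "\<bar>?e k w w'\<bar> \<le> 1"
    proof -
      have *: "\<bar>\<integral>z. cos (x * inner_r n a z + y * inner_r n b z) \<partial>?R\<bar> \<le> 1" for x y
      proof -
        have "\<bar>\<integral>z. cos (x * inner_r n a z + y * inner_r n b z) \<partial>?R\<bar>
            \<le> (\<integral>z. \<bar>cos (x * inner_r n a z + y * inner_r n b z)\<bar> \<partial>?R)"
          by (rule integral_abs_bound)
        also have "\<dots> \<le> 1"
          by (rule R.integral_le_const) (use intc in auto)
        finally show ?thesis .
      qed
      show ?thesis
        using that *[of "s * w" "t * w'"] *[of "s * w" "- (t * w')"] by (elim disjE) (simp_all only: plus minus)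
    qed
    then show ?thesis by simp
  qed
  have int1: "integrable ?N (?e k w)" if "?ok k" for k w
    by (rule std_normal.integrable_const_bound[where B = 1]) (use e_le[OF that] in auto)
  have int2: "integrable ?N (\<lambda>w'. w' * ?e k w w')" if "?ok k" for k w
    by (rule Bochner_Integration.integrable_bound[OF integrable_std_normal_abs])
      (use e_le[OF that] in \<open>auto simp: abs_mult intro!: mult_left_le\<close>)
  have le1: "\<bar>\<integral>w'. ?e k w w' \<partial>?N\<bar> \<le> 1" if k: "?ok k" for k w
  proof -
    have "(\<integral>w'. ?e k w w' \<partial>?N) \<le> 1"
      by (rule std_normal.integral_le_const[OF int1[OF k]]) (use e_le[OF k] in auto)
    then show ?thesis
      by (simp add: integral_nonneg_AE)
  qed
  have le2: "\<bar>\<integral>w'. w' * ?e k w w' \<partial>?N\<bar> \<le> (\<integral>w'. \<bar>w'\<bar> \<partial>?N)"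
    if k: "?ok k" for k w
  proof -
    have "\<bar>\<integral>w'. w' * ?e k w w' \<partial>?N\<bar> \<le> (\<integral>w'. \<bar>w' * ?e k w w'\<bar> \<partial>?N)"
      by (rule integral_abs_bound)
    also have "\<dots> \<le> (\<integral>w'. \<bar>w'\<bar> \<partial>?N)"
      by (rule integral_mono_AE'[OF integrable_std_normal_abs])
        (use e_le[OF k] in \<open>auto simp: abs_mult intro!: mult_left_le\<close>)
    finally show ?thesis .
  qed
  have I1: "integrable ?N (\<lambda>w. \<integral>w'. ?e k w w' \<partial>?N)" if "?ok k" for k
    by (rule std_normal.integrable_const_bound[where B = 1]) (use le1[OF that] in auto)
  have I2: "integrable ?N (\<lambda>w. w * (\<integral>w'. w' * ?e k w w' \<partial>?N))"
    if "?ok k" for k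
    by (rule Bochner_Integration.integrable_bound[where f = "\<lambda>w. \<bar>w\<bar> * (\<integral>w'. \<bar>w'\<bar> \<partial>?N)"])
      (use le2[OF that] integrable_std_normal_abs in \<open>auto simp: abs_mult intro!: mult_left_mono\<close>)
  have c1: "(\<integral>w. 1 * cos (x * w * y) \<partial>?N) = exp (- (x * y)\<^sup>2 / 2)" for x y
    using std_normal_cos[of "x * y"] by (simp add: ac_simps)
  have s1: "(\<integral>w. w * sin (x * w * y) \<partial>?N) = x * y * exp (- (x * y)\<^sup>2 / 2)" for x y
    using std_normal_sin[of "x * y"] by (simp add: ac_simps)
  have "?A = (\<integral>z. (\<integral>w. 1 * cos (s * w * inner_r n a z) \<partial>?N) * (\<integral>w'. 1 * cos (t * w' * inner_r n b z) \<partial>?N) \<partial>?R)"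
    by (simp only: c1)
  also have "\<dots> = (\<integral>w. 1 * (\<integral>w'. 1 * ((?e (- (?\<rho> * s * t)) w w' + ?e (?\<rho> * s * t) w w') / 2) \<partial>?N) \<partial>?N)"
    by (subst gauss_row_product_swap) (simp_all add: cc)
  also have "\<dots> = ((\<integral>w. (\<integral>w'. ?e (- (?\<rho> * s * t)) w w' \<partial>?N) \<partial>?N) + (\<integral>w. (\<integral>w'. ?e (?\<rho> * s * t) w w' \<partial>?N) \<partial>?N)) / 2"
    using int1 I1 by (simp only: mult_1 integral_divide_zero Bochner_Integration.integral_add simp_thms)
  also have "\<dots> = 1 / sqrt (gauss_det ?\<rho> s t)"
    by (subst (1 2) gauss_double_integrals(1)[OF \<rho>]) auto
  finally show "?A = 1 / sqrt (gauss_det ?\<rho> s t)" .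
  have "?B = (\<integral>z. (\<integral>w. w * sin (s * w * inner_r n a z) \<partial>?N) * (\<integral>w'. w' * sin (t * w' * inner_r n b z) \<partial>?N) \<partial>?R)"
    by (simp only: s1)
  also have "\<dots> = (\<integral>w. w * (\<integral>w'. w' * ((?e (- (?\<rho> * s * t)) w w' - ?e (?\<rho> * s * t) w w') / 2) \<partial>?N) \<partial>?N)"
    by (subst gauss_row_product_swap) (use integrable_std_normal_abs in \<open>simp_all add: ss\<close>)
  also have "\<dots> = ((\<integral>w. w * (\<integral>w'. w' * ?e (- (?\<rho> * s * t)) w w' \<partial>?N) \<partial>?N)
      - (\<integral>w. w * (\<integral>w'. w' * ?e (?\<rho> * s * t) w w' \<partial>?N) \<partial>?N)) / 2"
    using int2 I2 by (simp only: times_divide_eq_right right_diff_distrib integral_divide_zero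
        Bochner_Integration.integral_diff simp_thms)
  also have "\<dots> = ?\<rho> * s * t / sqrt (gauss_det ?\<rho> s t) ^ 3"
    by (subst (1 2) gauss_double_integrals(2)[OF \<rho>]) auto
  finally show "?B = ?\<rho> * s * t / sqrt (gauss_det ?\<rho> s t) ^ 3" .
qed

section \<open>Rounding by a Gaussian matrix\<close>

definition radial_weight :: "nat \<Rightarrow> real \<Rightarrow> real" where
  "radial_weight r t = 1 / sqrt (1 + t\<^sup>2) ^ (r + 2)"

text \<open>This is 1 / (2 pi) times the double integral over s and t of r \<rho> / gauss_det^((r +
  2) / 2), with one of the two integrations carried out. For r = 1 it equals (2 / pi) arcsin
  \<rho>.\<close>

definition rounding_kernel :: "nat \<Rightarrow> real \<Rightarrow> real" where
  "rounding_kernel r \<rho> = real r / (2 * pi) * (\<integral>t. radial_weight r t \<partial>lborel) * \<rho> *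
     (\<integral>t. radial_weight r t / sqrt (1 - \<rho>\<^sup>2 * t\<^sup>2 / (1 + t\<^sup>2)) \<partial>lborel)"

definition gauss_matrix :: "nat \<Rightarrow> nat \<Rightarrow> (nat \<Rightarrow> nat \<Rightarrow> real) measure" where
  "gauss_matrix r n = PiM {..<r} (\<lambda>_. gauss_row n)"

lemma prob_space_gauss_matrix: "prob_space (gauss_matrix r n)"
  unfolding gauss_matrix_def by (intro prob_space_PiM prob_space_gauss_row)

lemma gauss_matrix_row_measurable:
  assumes "i < r" shows "(\<lambda>Z. inner_r n a (Z i)) \<in> borel_measurable (gauss_matrix r n)"
proof -
  have "(\<lambda>Z. Z i) \<in> measurable (gauss_matrix r n) (gauss_row n)"
    unfolding gauss_matrix_def by (rule measurable_component_singleton) (use assms in simp)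
  then show ?thesis
    by (rule measurable_compose[OF _ gauss_row_inner_measurable])
qed

lemma gauss_matrix_inner_measurable [measurable]:
  "(\<lambda>Z. inner_r r (\<lambda>i. inner_r n a (Z i)) (\<lambda>i. inner_r n b (Z i))) \<in> borel_measurable (gauss_matrix r n)"
  unfolding inner_r_def[of r]
  by (intro borel_measurable_sum borel_measurable_times gauss_matrix_row_measurable) auto

text \<open>Represents the reciprocal of a length as a Gaussian integral over a scale
  \<open>s\<close>, so that normalization turns into exponentials of squared lengths, which factor
  over coordinates. The extra factor \<open>x\<close> keeps the integral finite at
  \<open>x = 0\<close>.\<close>

lemma gaussian_scaled_integral:
  fixes x :: real
  assumes "0 \<le> x"
  shows "integrable lborel (\<lambda>s. x * exp (- (s * x)\<^sup>2 / 2))"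
    and "(\<integral>s. x * exp (- (s * x)\<^sup>2 / 2) \<partial>lborel) = (if x = 0 then 0 else sqrt (2 * pi))"
proof -
  have eq: "x * exp (- (s * x)\<^sup>2 / 2) = sqrt (2 * pi) * normal_density 0 (1 / x) s" if "x \<noteq> 0" for s
    using that assms by (simp add: normal_density_def power_divide power_mult_distrib real_sqrt_divide)
  show "integrable lborel (\<lambda>s. x * exp (- (s * x)\<^sup>2 / 2))"
  proof (cases "x = 0")
    case False
    then show ?thesis
      unfolding eq[OF False] using assms by (intro integrable_mult_right integrable_normal_density) simp
  qed simp
  show "(\<integral>s. x * exp (- (s * x)\<^sup>2 / 2) \<partial>lborel) = (if x = 0 then 0 else sqrt (2 * pi))"
  proof (cases "x = 0")
    case False
    then show ?thesis
      unfolding eq[OF False] using assms by (simp only: integral_mult_right_zero) simp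
  qed simp
qed

lemma mult_exp_square_le: "\<bar>x * exp (- x\<^sup>2 / 2)\<bar> \<le> (1 :: real)"
proof -
  have "\<bar>x\<bar> \<le> 1 + x\<^sup>2 / 2"
    using zero_le_power2[of "\<bar>x\<bar> - 1"] by (simp add: power2_eq_square algebra_simps)
  also have "\<dots> \<le> exp (x\<^sup>2 / 2)"
    by (rule exp_ge_add_one_self)
  finally have "\<bar>x\<bar> * exp (- x\<^sup>2 / 2) \<le> exp (x\<^sup>2 / 2) * exp (- x\<^sup>2 / 2)"
    by (intro mult_right_mono) auto
  then show ?thesis
    by (simp add: abs_mult flip: exp_add)
qed

text \<open>For each summand of the inner product the integrand factors over the independent rows.
  With d the root of \<open>gauss_det\<close>, the row of that summand contributes \<rho> / d^3 and
  each of the other r - 1 rows 1 / d. The scales are nonzero because \<open>gauss_row_exp\<close>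
  carries a factor \<open>s * t\<close> that has to be divided out.\<close>

lemma gauss_matrix_exp:
  assumes a: "inner_r n a a = 1" and b: "inner_r n b b = 1" and "s \<noteq> 0" "t \<noteq> 0"
  defines "X \<equiv> \<lambda>Z i. inner_r n a (Z i)" and "Y \<equiv> \<lambda>Z i. inner_r n b (Z i)"
  shows "(\<integral>Z. inner_r r (X Z) (Y Z) * (exp (- s\<^sup>2 * inner_r r (X Z) (X Z) / 2) * exp (- t\<^sup>2 * inner_r r (Y Z) (Y Z) / 2))
      \<partial>gauss_matrix r n) = real r * inner_r n a b / sqrt (gauss_det (inner_r n a b) s t) ^ (r + 2)"
proof -
  let ?R = "gauss_row n" and ?\<rho> = "inner_r n a b"
  let ?d = "sqrt (gauss_det ?\<rho> s t)"
  interpret R: prob_space ?R by (rule prob_space_gauss_row)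
  interpret P: product_sigma_finite "\<lambda>_::nat. ?R"
    by (simp add: product_sigma_finite_def R.sigma_finite_measure_axioms)
  have \<rho>: "\<bar>?\<rho>\<bar> \<le> 1"
    using inner_r_abs_le[of n a b] a b by simp
  have d: "0 < ?d"
    using gauss_det_pos[OF \<rho>] by simp
  let ?e = "\<lambda>z. exp (- (s * inner_r n a z)\<^sup>2 / 2) * exp (- (t * inner_r n b z)\<^sup>2 / 2)"
  define g where "g i k z = (if k = i then inner_r n a z * inner_r n b z else 1) * ?e z" for i k :: nat and z
  have e_le: "\<bar>?e z\<bar> \<le> 1" for z
    using mult_mono[of "exp (- (s * inner_r n a z)\<^sup>2 / 2)" 1 "exp (- (t * inner_r n b z)\<^sup>2 / 2)" 1] by simp
  have inte: "integrable ?R ?e"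
    by (rule R.integrable_const_bound[where B = 1]) (use e_le in auto)
  have xy: "inner_r n a z * inner_r n b z * ?e z = 1 / (s * t) *
      ((s * inner_r n a z * exp (- (s * inner_r n a z)\<^sup>2 / 2)) * (t * inner_r n b z * exp (- (t * inner_r n b z)\<^sup>2 / 2)))" for z
    using assms(3,4) by simp
  have intxy: "integrable ?R (\<lambda>z. inner_r n a z * inner_r n b z * ?e z)"
    unfolding xy
  proof (intro integrable_mult_right R.integrable_const_bound[where B = 1] AE_I2)
    fix z
    show "norm ((s * inner_r n a z * exp (- (s * inner_r n a z)\<^sup>2 / 2))
        * (t * inner_r n b z * exp (- (t * inner_r n b z)\<^sup>2 / 2))) \<le> 1"
      using mult_mono[OF mult_exp_square_le[of "s * inner_r n a z"] mult_exp_square_le[of "t * inner_r n b z"]]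
      by (simp add: abs_mult)
  qed measurable
  have Ixy: "(\<integral>z. inner_r n a z * inner_r n b z * ?e z \<partial>?R) = ?\<rho> / ?d ^ 3"
    unfolding xy by (simp only: integral_mult_right_zero gauss_row_exp(2)[OF a b]) (use assms(3,4) in simp)
  have intg: "integrable ?R (g i k)" for i k
    using inte intxy by (cases "k = i") (simp_all add: g_def[abs_def])
  have Ig: "(\<integral>z. g i k z \<partial>?R) = (if k = i then ?\<rho> / ?d ^ 2 else 1) * (1 / ?d)" for i k
    using Ixy gauss_row_exp(1)[OF a b, of s t]
    by (cases "k = i") (simp_all add: g_def power3_eq_cube power2_eq_square)
  have prod: "X Z i * Y Z i * (exp (- s\<^sup>2 * inner_r r (X Z) (X Z) / 2) * exp (- t\<^sup>2 * inner_r r (Y Z) (Y Z) / 2))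
      = (\<Prod>k<r. g i k (Z k))" if i: "i < r" for Z i
  proof -
    have 1: "exp (- c\<^sup>2 * inner_r r x x / 2) = (\<Prod>k<r. exp (- (c * x k)\<^sup>2 / 2))" for c x
      by (simp add: inner_r_def exp_sum[symmetric] sum_distrib_left sum_negf sum_divide_distrib
          power2_eq_square algebra_simps)
    have 2: "(\<Prod>k<r. if k = i then X Z k * Y Z k else 1) = X Z i * Y Z i"
      using i by (simp add: prod.delta)
    have "(\<Prod>k<r. g i k (Z k)) = (\<Prod>k<r. if k = i then X Z k * Y Z k else 1)
        * ((\<Prod>k<r. exp (- (s * X Z k)\<^sup>2 / 2)) * (\<Prod>k<r. exp (- (t * Y Z k)\<^sup>2 / 2)))"
      by (simp only: g_def X_def Y_def prod.distrib)
    then show ?thesis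
      by (simp only: 1 2)
  qed
  have Iprod: "(\<integral>Z. (\<Prod>k<r. g i k (Z k)) \<partial>gauss_matrix r n) = ?\<rho> / ?d ^ (r + 2)" if i: "i < r" for i
  proof -
    have "(\<integral>Z. (\<Prod>k<r. g i k (Z k)) \<partial>gauss_matrix r n) = (\<Prod>k<r. \<integral>z. g i k z \<partial>?R)"
      unfolding gauss_matrix_def by (rule P.product_integral_prod) (use intg in auto)
    also have "\<dots> = (\<Prod>k<r. if k = i then ?\<rho> / ?d ^ 2 else 1) * (1 / ?d) ^ r"
      by (simp only: Ig prod.distrib prod_constant card_lessThan)
    also have "\<dots> = ?\<rho> / ?d ^ (r + 2)"
      using i gauss_det_pos[OF \<rho>, of s t] by (simp add: prod.delta power_add power_divide power2_eq_square)
    finally show ?thesis .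
  qed
  have intprod: "integrable (gauss_matrix r n) (\<lambda>Z. \<Prod>k<r. g i k (Z k))" for i
    unfolding gauss_matrix_def by (rule P.product_integrable_prod) (use intg in auto)
  have "(\<integral>Z. inner_r r (X Z) (Y Z) * (exp (- s\<^sup>2 * inner_r r (X Z) (X Z) / 2) * exp (- t\<^sup>2 * inner_r r (Y Z) (Y Z) / 2))
      \<partial>gauss_matrix r n) = (\<integral>Z. (\<Sum>i<r. \<Prod>k<r. g i k (Z k)) \<partial>gauss_matrix r n)"
    unfolding inner_r_def[of r "X _" "Y _"] sum_distrib_right
    by (intro Bochner_Integration.integral_cong refl sum.cong prod) simp
  also have "\<dots> = (\<Sum>i<r. \<integral>Z. (\<Prod>k<r. g i k (Z k)) \<partial>gauss_matrix r n)"
    by (rule Bochner_Integration.integral_sum) (rule intprod)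
  also have "\<dots> = (\<Sum>i<r. ?\<rho> / ?d ^ (r + 2))"
    by (rule sum.cong) (use Iprod in auto)
  finally show ?thesis by simp
qed

text \<open>Division by zero sends the zero vector to itself, whence the alternative in
  \<open>unit_vec_zero_or_unit\<close>.\<close>

definition unit_vec :: "nat \<Rightarrow> (nat \<Rightarrow> real) \<Rightarrow> nat \<Rightarrow> real" where
  "unit_vec r x i = x i / sqrt (inner_r r x x)"

lemma inner_r_self_nonneg: "0 \<le> inner_r r x x"
  by (simp add: inner_r_def sum_nonneg)

lemma inner_unit_vec: "inner_r r (unit_vec r x) (unit_vec r y) = inner_r r x y / (sqrt (inner_r r x x) * sqrt (inner_r r y y))"
  by (simp add: inner_r_def unit_vec_def[abs_def] sum_divide_distrib)

lemma unit_vec_zero_or_unit: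
  "inner_r r (unit_vec r x) (unit_vec r x) = 1 \<or> inner_r r (unit_vec r x) (unit_vec r x) = 0"
  using inner_r_self_nonneg[of r x] by (simp add: inner_unit_vec)

lemma inner_unit_vec_abs_le: "\<bar>inner_r r (unit_vec r x) (unit_vec r y)\<bar> \<le> 1"
  using inner_r_abs_le[of r "unit_vec r x" "unit_vec r y"] unit_vec_zero_or_unit[of r x] unit_vec_zero_or_unit[of r y]
  by linarith

lemma inner_r_eq_zero_of_null: "inner_r r x x = 0 \<Longrightarrow> inner_r r x y = 0"
  by (auto simp: inner_r_def sum_nonneg_eq_0_iff intro!: sum.neutral)

text \<open>Both reciprocal lengths are replaced by integrals over scales \<open>s\<close> and
  \<open>t\<close>. After interchanging them with the expectation one after the other,
  \<open>gauss_matrix_exp\<close> evaluates the expectation, and a rescaling of \<open>t\<close>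
  separates the two remaining integrals.\<close>

lemma expectation_unit_vec:
  assumes a: "inner_r n a a = 1" and b: "inner_r n b b = 1"
  shows "(\<integral>Z. inner_r r (unit_vec r (\<lambda>i. inner_r n a (Z i))) (unit_vec r (\<lambda>i. inner_r n b (Z i)))
      \<partial>gauss_matrix r n) = rounding_kernel r (inner_r n a b)"
proof -
  let ?G = "gauss_matrix r n" and ?\<rho> = "inner_r n a b"
  interpret G: prob_space ?G by (rule prob_space_gauss_matrix)
  define X where "X Z i = inner_r n a (Z i)" for Z :: "nat \<Rightarrow> nat \<Rightarrow> real" and i
  define Y where "Y Z i = inner_r n b (Z i)" for Z :: "nat \<Rightarrow> nat \<Rightarrow> real" and i
  define x where "x Z = sqrt (inner_r r (X Z) (X Z))" for Z
  define y where "y Z = sqrt (inner_r r (Y Z) (Y Z))" for Z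
  define u where "u Z = inner_r r (X Z) (Y Z) / (x Z * y Z)" for Z
  have u_eq: "u Z = inner_r r (unit_vec r (X Z)) (unit_vec r (Y Z))" for Z
    by (simp add: u_def x_def y_def inner_unit_vec)
  have u_le: "\<bar>u Z\<bar> \<le> 1" for Z
    unfolding u_eq by (rule inner_unit_vec_abs_le)
  have [measurable]: "x \<in> borel_measurable ?G" "y \<in> borel_measurable ?G" "u \<in> borel_measurable ?G"
    unfolding x_def[abs_def] y_def[abs_def] u_def[abs_def] X_def Y_def by measurable
  have x0: "0 \<le> x Z" and y0: "0 \<le> y Z" for Z
    by (simp_all add: x_def y_def inner_r_self_nonneg)
  have \<rho>: "\<bar>?\<rho>\<bar> \<le> 1"
    using inner_r_abs_le[of n a b] a b by simp
  define ex where "ex s Z = x Z * exp (- (s * x Z)\<^sup>2 / 2)" for s Z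
  define ey where "ey t Z = y Z * exp (- (t * y Z)\<^sup>2 / 2)" for t Z
  \<comment> \<open>The factor \<open>u Z\<close> vanishes when one of the lengths does, so the
    identity also holds in the case where the integral is 0.\<close>
  have Iex: "u Z * (\<integral>s. ex s Z \<partial>lborel) = sqrt (2 * pi) * u Z"
    and Iey: "u Z * (\<integral>s. ey s Z \<partial>lborel) = sqrt (2 * pi) * u Z" for Z
    using gaussian_scaled_integral(2)[OF x0[of Z]] gaussian_scaled_integral(2)[OF y0[of Z]]
    by (auto simp: ex_def ey_def u_def)
  have nn: "0 \<le> ex s Z" "0 \<le> ey s Z" for s Z
    using x0 y0 by (simp_all add: ex_def ey_def)
  have Iex_le: "(\<integral>s. ex s Z \<partial>lborel) \<le> sqrt (2 * pi)" and Iey_le: "(\<integral>s. ey s Z \<partial>lborel) \<le> sqrt (2 * pi)" for Z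
    using gaussian_scaled_integral(2)[OF x0[of Z]] gaussian_scaled_integral(2)[OF y0[of Z]]
    by (auto simp: ex_def ey_def)
  have int_ex: "integrable lborel (\<lambda>s. ex s Z)" and int_ey: "integrable lborel (\<lambda>s. ey s Z)" for Z
    using gaussian_scaled_integral(1)[OF x0[of Z]] gaussian_scaled_integral(1)[OF y0[of Z]]
    by (auto simp: ex_def ey_def)
  have sf: "sigma_finite_measure (lborel :: real measure)"
    by (rule lborel.sigma_finite_measure_axioms)
  have 1: "sqrt (2 * pi) * (\<integral>Z. u Z \<partial>?G) = (\<integral>s. (\<integral>Z. u Z * ex s Z \<partial>?G) \<partial>lborel)"
  proof -
    have "sqrt (2 * pi) * (\<integral>Z. u Z \<partial>?G) = (\<integral>Z. (\<integral>s. u Z * ex s Z \<partial>lborel) \<partial>?G)"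
      by (simp add: Iex)
    also have "\<dots> = (\<integral>s. (\<integral>Z. u Z * ex s Z \<partial>?G) \<partial>lborel)"
    proof (rule integral_swap_bounded[OF G.prob_space_axioms sf])
      show "(\<integral>s. \<bar>u Z * ex s Z\<bar> \<partial>lborel) \<le> sqrt (2 * pi)" for Z
      proof -
        have "(\<integral>s. \<bar>u Z * ex s Z\<bar> \<partial>lborel) = \<bar>u Z\<bar> * (\<integral>s. ex s Z \<partial>lborel)"
          using nn by (simp add: abs_mult)
        also have "\<dots> \<le> 1 * sqrt (2 * pi)"
          using u_le Iex_le nn by (intro mult_mono) (auto intro!: integral_nonneg_AE)
        finally show ?thesis by simp
      qed
    qed (use int_ex in \<open>simp_all add: ex_def[abs_def]\<close>)
    finally show ?thesis .
  qed
  \<comment> \<open>For a fixed nonzero scale, \<open>ex s Z\<close> is at most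
    \<open>1 / \<bar>s\<bar>\<close>; this is the bound uniform in \<open>Z\<close> that the second
    interchange requires. The point s = 0 is a null set.\<close>
  have 2: "sqrt (2 * pi) * (\<integral>Z. u Z * ex s Z \<partial>?G) = (\<integral>t. (\<integral>Z. u Z * ex s Z * ey t Z \<partial>?G) \<partial>lborel)"
    if s: "s \<noteq> 0" for s
  proof -
    have "sqrt (2 * pi) * (\<integral>Z. u Z * ex s Z \<partial>?G) = (\<integral>Z. (sqrt (2 * pi) * u Z) * ex s Z \<partial>?G)"
      by (subst integral_mult_right_zero[symmetric]) (simp only: ac_simps)
    also have "\<dots> = (\<integral>Z. (\<integral>t. u Z * ex s Z * ey t Z \<partial>lborel) \<partial>?G)"
      unfolding Iey[symmetric]
      by (intro Bochner_Integration.integral_cong refl) (simp add: ac_simps)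
    also have "\<dots> = (\<integral>t. (\<integral>Z. u Z * ex s Z * ey t Z \<partial>?G) \<partial>lborel)"
    proof (rule integral_swap_bounded[OF G.prob_space_axioms sf])
      show "(\<integral>t. \<bar>u Z * ex s Z * ey t Z\<bar> \<partial>lborel) \<le> 1 * (1 / \<bar>s\<bar>) * sqrt (2 * pi)" for Z
      proof -
        have "\<bar>s\<bar> * ex s Z \<le> 1"
          using mult_exp_square_le[of "s * x Z"] x0[of Z] by (simp add: ex_def abs_mult)
        then have "ex s Z \<le> 1 / \<bar>s\<bar>"
          using s by (simp add: field_simps)
        have "(\<integral>t. \<bar>u Z * ex s Z * ey t Z\<bar> \<partial>lborel) = \<bar>u Z\<bar> * ex s Z * (\<integral>t. ey t Z \<partial>lborel)"
          using nn by (simp add: abs_mult)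
        also have "\<dots> \<le> 1 * (1 / \<bar>s\<bar>) * sqrt (2 * pi)"
          using u_le Iey_le nn \<open>ex s Z \<le> 1 / \<bar>s\<bar>\<close> by (intro mult_mono) (auto intro!: integral_nonneg_AE)
        finally show ?thesis .
      qed
    qed (use int_ey in \<open>simp_all add: ex_def[abs_def] ey_def[abs_def]\<close>)
    finally show ?thesis .
  qed
  have prod: "u Z * ex s Z * ey t Z = inner_r r (X Z) (Y Z) *
      (exp (- s\<^sup>2 * inner_r r (X Z) (X Z) / 2) * exp (- t\<^sup>2 * inner_r r (Y Z) (Y Z) / 2))" for s t Z
  proof -
    have "u Z * (x Z * y Z) = inner_r r (X Z) (Y Z)"
      using inner_r_eq_zero_of_null[of r "X Z" "Y Z"] inner_r_eq_zero_of_null[of r "Y Z" "X Z"]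
      by (auto simp: u_def x_def y_def inner_r_commute[of r "Y Z" "X Z"])
    moreover have "(s * x Z)\<^sup>2 = s\<^sup>2 * inner_r r (X Z) (X Z)" "(t * y Z)\<^sup>2 = t\<^sup>2 * inner_r r (Y Z) (Y Z)"
      by (simp_all add: power_mult_distrib x_def y_def inner_r_self_nonneg)
    ultimately show ?thesis
      by (simp add: ex_def ey_def mult.assoc mult.left_commute)
  qed
  have 3: "(\<integral>Z. u Z * ex s Z * ey t Z \<partial>?G) = real r * ?\<rho> / sqrt (gauss_det ?\<rho> s t) ^ (r + 2)"
    if "s \<noteq> 0" "t \<noteq> 0" for s t
    unfolding prod X_def Y_def by (rule gauss_matrix_exp[OF a b that])
  let ?J = "\<integral>t. radial_weight r t \<partial>lborel"
  have 4: "(\<integral>t. 1 / sqrt (gauss_det ?\<rho> s t) ^ (r + 2) \<partial>lborel)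
      = ?J * (radial_weight r s / sqrt (1 - ?\<rho>\<^sup>2 * s\<^sup>2 / (1 + s\<^sup>2)))" for s
  proof -
    define P where "P = 1 + s\<^sup>2"
    define q where "q = 1 - ?\<rho>\<^sup>2 * s\<^sup>2 / P"
    have P: "0 < P" using zero_le_power2[of s] by (simp add: P_def add_pos_nonneg)
    have "?\<rho>\<^sup>2 \<le> 1" using \<rho> by (simp add: abs_square_le_1)
    then have "?\<rho>\<^sup>2 * s\<^sup>2 \<le> 1 * s\<^sup>2" by (intro mult_right_mono) auto
    then have "?\<rho>\<^sup>2 * s\<^sup>2 < P" by (simp add: P_def)
    then have q: "0 < q" using P by (simp add: q_def)
    \<comment> \<open>As a function of t the determinant is \<open>P * (1 + q * t\<^sup>2)\<close>,
      so scaling t by \<open>1 / sqrt q\<close> normalizes it. The summand 0 gives the affine shape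
      of the substitution rule.\<close>
    have det: "gauss_det ?\<rho> s (0 + 1 / sqrt q * t) = P * (1 + t\<^sup>2)" for t
    proof -
      have "gauss_det ?\<rho> s t' = P * (1 + q * t'\<^sup>2)" for t'
        using P by (simp add: gauss_det_def q_def P_def field_simps power_mult_distrib)
      then show ?thesis
        using q by (simp add: power_divide)
    qed
    have "(\<integral>t. 1 / sqrt (gauss_det ?\<rho> s t) ^ (r + 2) \<partial>lborel)
        = \<bar>1 / sqrt q\<bar> *\<^sub>R (\<integral>t. 1 / sqrt (gauss_det ?\<rho> s (0 + 1 / sqrt q * t)) ^ (r + 2) \<partial>lborel)"
      by (rule lborel_integral_real_affine) (use q in simp)
    also have "\<dots> = 1 / sqrt q * (\<integral>t. 1 / sqrt P ^ (r + 2) * radial_weight r t \<partial>lborel)"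
    proof -
      have "1 / sqrt (P * (1 + t\<^sup>2)) ^ (r + 2) = 1 / sqrt P ^ (r + 2) * radial_weight r t" for t
        by (simp only: real_sqrt_mult power_mult_distrib radial_weight_def times_divide_times_eq mult_1)
      then show ?thesis
        unfolding det using q by simp
    qed
    also have "\<dots> = ?J * (radial_weight r s / sqrt q)"
      by (subst integral_mult_right_zero) (simp add: radial_weight_def P_def)
    finally show ?thesis
      by (simp add: q_def P_def)
  qed
  have "2 * pi * (\<integral>Z. u Z \<partial>?G) = sqrt (2 * pi) * (sqrt (2 * pi) * (\<integral>Z. u Z \<partial>?G))"
    by simp
  also have "\<dots> = (\<integral>s. sqrt (2 * pi) * (\<integral>Z. u Z * ex s Z \<partial>?G) \<partial>lborel)"
    by (simp add: 1)
  also have "\<dots> = (\<integral>s. real r * ?\<rho> * ?J * (radial_weight r s / sqrt (1 - ?\<rho>\<^sup>2 * s\<^sup>2 / (1 + s\<^sup>2))) \<partial>lborel)"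
  proof (rule integral_cong_AE)
    show "AE s in lborel. sqrt (2 * pi) * (\<integral>Z. u Z * ex s Z \<partial>?G)
        = real r * ?\<rho> * ?J * (radial_weight r s / sqrt (1 - ?\<rho>\<^sup>2 * s\<^sup>2 / (1 + s\<^sup>2)))"
      using AE_lborel_singleton[of "0::real"]
    proof eventually_elim
      fix s :: real assume s: "s \<noteq> 0"
      have "(\<integral>t. (\<integral>Z. u Z * ex s Z * ey t Z \<partial>?G) \<partial>lborel)
          = (\<integral>t. real r * ?\<rho> * (1 / sqrt (gauss_det ?\<rho> s t) ^ (r + 2)) \<partial>lborel)"
      proof (rule integral_cong_AE)
        show "AE t in lborel. (\<integral>Z. u Z * ex s Z * ey t Z \<partial>?G)
            = real r * ?\<rho> * (1 / sqrt (gauss_det ?\<rho> s t) ^ (r + 2))"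
          using AE_lborel_singleton[of "0::real"] by eventually_elim (simp add: 3[OF s])
      qed (simp_all add: ex_def[abs_def] ey_def[abs_def] gauss_det_def)
      then show "sqrt (2 * pi) * (\<integral>Z. u Z * ex s Z \<partial>?G)
        = real r * ?\<rho> * ?J * (radial_weight r s / sqrt (1 - ?\<rho>\<^sup>2 * s\<^sup>2 / (1 + s\<^sup>2)))"
        by (simp only: 2[OF s] integral_mult_right_zero 4 mult.assoc)
    qed
  qed (simp_all add: ex_def[abs_def] radial_weight_def)
  also have "\<dots> = 2 * pi * rounding_kernel r ?\<rho>"
    by (subst integral_mult_right_zero) (simp add: rounding_kernel_def)
  finally show ?thesis
    by (simp add: u_eq X_def[abs_def] Y_def[abs_def])
qed

theorem edge_form_rounding_le:
  assumes fin: "finite V" and "0 < r" and no_loop: "\<And>v. {v} \<notin> E"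
    and H: "psd_on V H" "\<And>v. v \<in> V \<Longrightarrow> H v v = 1"
  shows "edge_form V E A (\<lambda>u v. rounding_kernel r (H u v)) \<le> SDP r V E A"
proof -
  let ?n = "card V"
  let ?S = "{(u, v). u \<in> V \<and> v \<in> V \<and> {u, v} \<in> E}"
  let ?G = "gauss_matrix r ?n"
  interpret G: prob_space ?G by (rule prob_space_gauss_matrix)
  obtain h where h: "\<And>u v. u \<in> V \<Longrightarrow> v \<in> V \<Longrightarrow> H u v = inner_r ?n (h u) (h v)"
    using psd_on_gram_representation[OF fin H(1)] by blast
  define f where "f Z v = unit_vec r (\<lambda>i. inner_r ?n (h v) (Z i))" for Z :: "nat \<Rightarrow> nat \<Rightarrow> real" and v
  have meas: "(\<lambda>Z. inner_r r (f Z u) (f Z v)) \<in> borel_measurable ?G" for u v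
    unfolding f_def inner_unit_vec by measurable
  have int: "integrable ?G (\<lambda>Z. inner_r r (f Z u) (f Z v))" for u v
    by (rule G.integrable_const_bound[where B = 1]) (use meas inner_unit_vec_abs_le in \<open>auto simp: f_def\<close>)
  have unit: "inner_r ?n (h v) (h v) = 1" if "v \<in> V" for v
    using H(2)[OF that] h[OF that that] by simp
  have "edge_form V E A (\<lambda>u v. rounding_kernel r (H u v))
      = edge_form V E A (\<lambda>u v. \<integral>Z. inner_r r (f Z u) (f Z v) \<partial>?G)"
    by (rule edge_form_cong) (simp add: f_def h expectation_unit_vec unit)
  also have "\<dots> = (\<integral>Z. edge_form V E A (\<lambda>u v. inner_r r (f Z u) (f Z v)) \<partial>?G)"
    unfolding edge_form_def
    by (subst integral_mult_right_zero, subst Bochner_Integration.integral_sum)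
      (auto simp: int intro!: sum.cong)
  also have "\<dots> \<le> SDP r V E A"
  proof (rule G.integral_le_const)
    show "integrable ?G (\<lambda>Z. edge_form V E A (\<lambda>u v. inner_r r (f Z u) (f Z v)))"
      unfolding edge_form_def by (auto intro!: integrable_mult_right Bochner_Integration.integrable_sum int simp: split_def)
    show "AE Z in ?G. edge_form V E A (\<lambda>u v. inner_r r (f Z u) (f Z v)) \<le> SDP r V E A"
      by (intro AE_I2 edge_form_le_SDP_of_zero_or_unit[OF fin \<open>0 < r\<close> no_loop])
        (simp add: f_def unit_vec_zero_or_unit)
  qed
  finally show ?thesis .
qed

section \<open>Power series of the rounding kernel\<close>

text \<open>The Taylor coefficients of 1 / sqrt (1 - x), that is, the central binomial coefficients
  divided by 4^n.\<close>

definition inv_sqrt_coeff :: "nat \<Rightarrow> real" where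
  "inv_sqrt_coeff n = (-1) ^ n * ((-1/2) gchoose n)"

lemma inv_sqrt_coeff_0 [simp]: "inv_sqrt_coeff 0 = 1"
  by (simp add: inv_sqrt_coeff_def)

lemma inv_sqrt_coeff_Suc: "inv_sqrt_coeff (Suc n) = inv_sqrt_coeff n * (real (2 * n + 1) / real (2 * n + 2))"
proof -
  have "(-1/2) * ((-1/2 :: real) gchoose n) = of_nat n * ((-1/2) gchoose n) + of_nat (Suc n) * ((-1/2) gchoose (Suc n))"
    by (rule gbinomial_mult_1)
  then have "((-1/2 :: real) gchoose (Suc n)) = - ((real n + 1/2) * ((-1/2) gchoose n)) / (real n + 1)"
    by (simp add: field_simps)
  also have "\<dots> = - ((-1/2) gchoose n) * (real (2 * n + 1) / real (2 * n + 2))"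
    by (simp add: field_simps)
  finally show ?thesis
    by (simp add: inv_sqrt_coeff_def)
qed

lemma inv_sqrt_coeff_bounds: "0 \<le> inv_sqrt_coeff n" "inv_sqrt_coeff n \<le> 1"
proof -
  have "0 \<le> inv_sqrt_coeff n \<and> inv_sqrt_coeff n \<le> 1"
  proof (induction n)
    case (Suc n)
    then show ?case
      unfolding inv_sqrt_coeff_Suc by (intro conjI mult_nonneg_nonneg mult_le_one) auto
  qed simp
  then show "0 \<le> inv_sqrt_coeff n" "inv_sqrt_coeff n \<le> 1" by auto
qed

text \<open>The square of 1 / sqrt (1 - x) is the geometric series; on coefficients this is the
  Vandermonde identity with both upper arguments -1/2. It also shows that the products are weights
  with sum 1, which bounds all later coefficients.\<close>

lemma inv_sqrt_coeff_convolution: "(\<Sum>i\<le>n. inv_sqrt_coeff i * inv_sqrt_coeff (n - i)) = 1"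
proof -
  have "(\<Sum>i\<le>n. inv_sqrt_coeff i * inv_sqrt_coeff (n - i))
      = (\<Sum>i\<le>n. (-1) ^ n * (((-1/2) gchoose i) * ((-1/2) gchoose (n - i))))"
  proof (rule sum.cong)
    fix i assume "i \<in> {..n}"
    then have "(-1 :: real) ^ n = (-1) ^ i * (-1) ^ (n - i)"
      by (simp flip: power_add)
    then show "inv_sqrt_coeff i * inv_sqrt_coeff (n - i)
        = (-1) ^ n * (((-1/2) gchoose i) * ((-1/2) gchoose (n - i)))"
      by (simp add: inv_sqrt_coeff_def)
  qed simp
  also have "\<dots> = (-1) ^ n * ((-1/2 + (-1/2)) gchoose n)"
    using gbinomial_Vandermonde[of "-1/2 :: real" "-1/2" n]
    by (simp only: sum_distrib_left[symmetric] atLeast0AtMost)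
  also have "(-1/2 + (-1/2 :: real)) gchoose n = (-1) ^ n"
    using gbinomial_minus[of "1 :: real" n] by (simp flip: binomial_gbinomial)
  also have "(-1) ^ n * (-1) ^ n = (1 :: real)"
    by (simp flip: power_mult_distrib)
  finally show ?thesis .
qed

text \<open>The coefficients come from \<open>1 / \<bar>1 + z\<bar> = S z * cnj (S z)\<close> for the binomial series
  \<open>S z\<close> of \<open>1 / sqrt (1 + z)\<close> and \<open>z = x * cis \<theta>\<close>; only \<open>(S z)\<^sup>2 = 1 / (1 + z)\<close> is
  needed, so that no branch of the square root has to be chosen.\<close>

lemma sums_inv_sqrt_trinomial:
  fixes x \<theta> :: real
  assumes "\<bar>x\<bar> < 1"
  shows "(\<lambda>n. (- x) ^ n * (\<Sum>i\<le>n. inv_sqrt_coeff i * inv_sqrt_coeff (n - i) * cos ((real n - 2 * real i) * \<theta>)))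
    sums (1 / sqrt (1 + 2 * x * cos \<theta> + x\<^sup>2))"
proof -
  define z where "z = of_real (- x) * cis \<theta>"
  have nz: "norm z < 1" using assms by (simp add: z_def norm_mult)
  define a where "a n = of_real (inv_sqrt_coeff n) * z ^ n" for n
  define b where "b n = of_real (inv_sqrt_coeff n) * cnj z ^ n" for n
  have "summable (\<lambda>n. norm (of_real (inv_sqrt_coeff n) * w ^ n))" if "norm w < 1" for w :: complex
  proof (rule summable_comparison_test'[OF summable_geometric[of "norm w"], of 0])
    show "norm (norm (of_real (inv_sqrt_coeff n) * w ^ n)) \<le> norm w ^ n" for n
      using mult_right_mono[OF inv_sqrt_coeff_bounds(2), of "norm w ^ n" n] inv_sqrt_coeff_bounds(1)[of n]
      by (simp add: norm_mult norm_power)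
  qed (use that in simp)
  from this[of z] this[of "cnj z"]
  have sa: "summable (\<lambda>n. norm (a n))" and sb: "summable (\<lambda>n. norm (b n))"
    using nz by (simp_all add: a_def b_def)
  define S where "S = (\<Sum>n. a n)"
  have cnjS: "(\<Sum>n. b n) = cnj S"
  proof -
    have "(\<lambda>n. cnj (a n)) sums cnj S"
      unfolding S_def sums_cnj by (rule summable_sums[OF summable_norm_cancel[OF sa]])
    then have "(\<Sum>n. cnj (a n)) = cnj S"
      by (rule sums_unique[symmetric])
    moreover have "(\<lambda>n. cnj (a n)) = b"
      by (rule ext) (simp add: a_def b_def)
    ultimately show ?thesis
      by simp
  qed
  have conv: "(\<Sum>i\<le>n. a i * a (n - i)) = z ^ n" for n
  proof -
    have "a i * a (n - i) = of_real (inv_sqrt_coeff i * inv_sqrt_coeff (n - i)) * z ^ n" if "i \<le> n" for i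
    proof -
      have "z ^ n = z ^ i * z ^ (n - i)"
        using that by (simp flip: power_add)
      then show ?thesis
        by (simp add: a_def)
    qed
    then have "(\<Sum>i\<le>n. a i * a (n - i)) = (\<Sum>i\<le>n. of_real (inv_sqrt_coeff i * inv_sqrt_coeff (n - i)) * z ^ n)"
      by (intro sum.cong) auto
    also have "\<dots> = of_real (\<Sum>i\<le>n. inv_sqrt_coeff i * inv_sqrt_coeff (n - i)) * z ^ n"
      by (simp only: sum_distrib_right of_real_sum)
    finally show ?thesis
      by (simp add: inv_sqrt_coeff_convolution)
  qed
  have "S * S = (\<Sum>n. \<Sum>i\<le>n. a i * a (n - i))"
    unfolding S_def by (rule Cauchy_product[OF sa sa])
  also have "\<dots> = (\<Sum>n. z ^ n)"
    by (simp only: conv)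
  also have "(\<Sum>n. z ^ n) = 1 / (1 - z)"
    using nz by (rule suminf_geometric)
  finally have "norm (S * S) = norm (1 / (1 - z))" by simp
  then have normS: "(norm S)\<^sup>2 = 1 / norm (1 - z)"
    by (simp add: norm_mult norm_divide power2_eq_square)
  have "norm (1 - z) = sqrt ((1 + x * cos \<theta>)\<^sup>2 + (x * sin \<theta>)\<^sup>2)"
    by (simp add: cmod_def z_def)
  also have "(1 + x * cos \<theta>)\<^sup>2 + (x * sin \<theta>)\<^sup>2 = 1 + 2 * x * cos \<theta> + x\<^sup>2 * ((cos \<theta>)\<^sup>2 + (sin \<theta>)\<^sup>2)"
    by (simp add: power2_eq_square algebra_simps
        del: sin_cos_squared_add sin_cos_squared_add2 sin_cos_squared_add3)
  finally have norm1z: "norm (1 - z) = sqrt (1 + 2 * x * cos \<theta> + x\<^sup>2)" by simp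
  have "(\<lambda>n. \<Sum>i\<le>n. a i * b (n - i)) sums (S * cnj S)"
    using Cauchy_product_sums[OF sa sb] by (simp add: S_def[symmetric] cnjS)
  then have "(\<lambda>n. Re (\<Sum>i\<le>n. a i * b (n - i))) sums Re (S * cnj S)"
    by (rule sums_Re)
  moreover have "S * cnj S = of_real ((norm S)\<^sup>2)"
    by (rule complex_norm_square[symmetric])
  moreover have "Re (\<Sum>i\<le>n. a i * b (n - i)) = (- x) ^ n *
      (\<Sum>i\<le>n. inv_sqrt_coeff i * inv_sqrt_coeff (n - i) * cos ((real n - 2 * real i) * \<theta>))" for n
  proof -
    have "Re (a i * b (n - i)) = (- x) ^ n * (inv_sqrt_coeff i * inv_sqrt_coeff (n - i) * cos ((real n - 2 * real i) * \<theta>))"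
      if "i \<le> n" for i
    proof -
      have "z ^ i = of_real ((- x) ^ i) * cis (real i * \<theta>)"
        by (simp only: z_def power_mult_distrib Complex.DeMoivre of_real_power)
      moreover have "cnj z = of_real (- x) * cis (- \<theta>)"
        by (simp add: z_def cis_cnj)
      then have "cnj z ^ (n - i) = of_real ((- x) ^ (n - i)) * cis (- (real (n - i) * \<theta>))"
        by (simp only: power_mult_distrib Complex.DeMoivre of_real_power mult_minus_right)
      ultimately have "a i * b (n - i) = of_real ((inv_sqrt_coeff i * inv_sqrt_coeff (n - i)) * ((- x) ^ i * (- x) ^ (n - i)))
          * (cis (real i * \<theta>) * cis (- (real (n - i) * \<theta>)))"
        by (simp add: a_def b_def)
      also have "(- x) ^ i * (- x) ^ (n - i) = (- x) ^ n"
        using that by (simp flip: power_add)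
      also have "cis (real i * \<theta>) * cis (- (real (n - i) * \<theta>)) = cis (- ((real n - 2 * real i) * \<theta>))"
        using that by (simp add: cis_mult of_nat_diff algebra_simps)
      finally show ?thesis by simp
    qed
    then show ?thesis
      by (simp add: sum_distrib_left)
  qed
  ultimately show ?thesis
    by (simp add: normS norm1z)
qed

section \<open>Cosine moments of the radial weight\<close>

lemma radial_weight_arctan: "radial_weight r t = cos (arctan t) ^ (r + 2)"
  by (simp add: radial_weight_def cos_arctan power_divide power_one)

lemma integrable_radial_weight: "integrable lborel (radial_weight r)"
proof (rule Bochner_Integration.integrable_bound)
  show "integrable lborel (\<lambda>t::real. inverse (1 + t\<^sup>2))"
    using integrable_inverse_1_plus_square by (simp add: set_integrable_def)
  show "radial_weight r \<in> borel_measurable lborel"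
    unfolding radial_weight_def[abs_def] by measurable
  show "AE t in lborel. norm (radial_weight r t) \<le> norm (inverse (1 + t\<^sup>2))"
  proof (rule AE_I2)
    fix t :: real
    have t: "1 \<le> 1 + t\<^sup>2" by simp
    then have "1 \<le> sqrt (1 + t\<^sup>2) ^ r" by (intro one_le_power) simp
    then have "1 + t\<^sup>2 \<le> sqrt (1 + t\<^sup>2) ^ r * (1 + t\<^sup>2)"
      using t mult_right_mono[of 1 "sqrt (1 + t\<^sup>2) ^ r" "1 + t\<^sup>2"] by simp
    moreover have "sqrt (1 + t\<^sup>2) ^ (r + 2) = sqrt (1 + t\<^sup>2) ^ r * (1 + t\<^sup>2)"
      using t by (simp add: power_add)
    moreover have "0 < 1 + t\<^sup>2" using t by linarith
    ultimately have "radial_weight r t \<le> 1 / (1 + t\<^sup>2)"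
      using frac_le[of 1 1 "1 + t\<^sup>2" "sqrt (1 + t\<^sup>2) ^ (r + 2)"]
      unfolding radial_weight_def by linarith
    then show "norm (radial_weight r t) \<le> norm (inverse (1 + t\<^sup>2))"
      by (simp add: radial_weight_def inverse_eq_divide)
  qed
qed

text \<open>With t = tan \<alpha> this is the integral of (cos \<alpha>)^r cos (2 l \<alpha>) over
  the interval from - pi / 2 to pi / 2.\<close>

definition cos_moment :: "nat \<Rightarrow> nat \<Rightarrow> real" where
  "cos_moment r l = (\<integral>t. radial_weight r t * cos (2 * real l * arctan t) \<partial>lborel)"

lemma integrable_radial_weight_mult:
  assumes [measurable]: "g \<in> borel_measurable borel" and "\<And>t. \<bar>g t\<bar> \<le> 1"
  shows "integrable lborel (\<lambda>t. radial_weight r t * g t)"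
proof (rule Bochner_Integration.integrable_bound[OF integrable_radial_weight[of r]])
  show "(\<lambda>t. radial_weight r t * g t) \<in> borel_measurable lborel"
    unfolding radial_weight_def[abs_def] by measurable
qed (use assms(2) in \<open>auto simp: abs_mult intro!: mult_left_le\<close>)

lemma measurable_arctan [measurable]: "arctan \<in> borel_measurable borel"
  by (intro borel_measurable_continuous_onI continuous_intros continuous_on_arctan)

text \<open>The function (cos \<alpha>)^(r + 1) sin ((2 l + 1) \<alpha>) vanishes at both ends, and
  by the product-to-sum formulas its derivative is a combination of the integrands for
  \<open>l\<close> and \<open>Suc l\<close>.\<close>

lemma cos_moment_Suc:
  "cos_moment r (Suc l) = cos_moment r l * ((real r - 2 * real l) / (real r + 2 * real l + 2))"
proof -
  define F where "F t = cos (arctan t) ^ (r + 1) * sin (real (2 * l + 1) * arctan t)" for t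
  define f where "f t = (1/2) * ((2 * real l - real r) * (radial_weight r t * cos (2 * real l * arctan t))
      + (2 * real l + 2 + real r) * (radial_weight r t * cos (2 * real (Suc l) * arctan t)))" for t
  have int: "integrable lborel (\<lambda>t. radial_weight r t * cos (2 * real l * arctan t))" for l
    by (rule integrable_radial_weight_mult) auto
  have "(\<integral>t. f t \<partial>lborel) = 0 - 0"
  proof (rule lborel_integral_FTC)
    show "(F has_real_derivative f t) (at t)" for t
    proof -
      define \<alpha> where "\<alpha> = arctan t"
      let ?m = "real (2 * l + 1)"
      have c2: "inverse (1 + t\<^sup>2) = (cos \<alpha>)\<^sup>2"
        by (simp add: \<alpha>_def cos_arctan power_divide inverse_eq_divide)
      have "(F has_real_derivative
          (real (r + 1) * cos \<alpha> ^ r * (- sin \<alpha> * inverse (1 + t\<^sup>2))) * sin (?m * \<alpha>)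
          + (cos (?m * \<alpha>) * (?m * inverse (1 + t\<^sup>2))) * cos \<alpha> ^ (r + 1)) (at t)"
        unfolding F_def \<alpha>_def
        by (rule derivative_eq_intros refl | simp)+
      also have "(real (r + 1) * cos \<alpha> ^ r * (- sin \<alpha> * inverse (1 + t\<^sup>2))) * sin (?m * \<alpha>)
          + (cos (?m * \<alpha>) * (?m * inverse (1 + t\<^sup>2))) * cos \<alpha> ^ (r + 1)
        = cos \<alpha> ^ (r + 2) * (?m * (cos (?m * \<alpha>) * cos \<alpha>) - real (r + 1) * (sin (?m * \<alpha>) * sin \<alpha>))"
        unfolding c2 by (simp add: algebra_simps power2_eq_square)
      also have "cos (?m * \<alpha>) * cos \<alpha> = (cos (2 * real l * \<alpha>) + cos (2 * real (Suc l) * \<alpha>)) / 2"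
        unfolding cos_times_cos by (simp add: algebra_simps)
      also have "sin (?m * \<alpha>) * sin \<alpha> = (cos (2 * real l * \<alpha>) - cos (2 * real (Suc l) * \<alpha>)) / 2"
        unfolding sin_times_sin by (simp add: algebra_simps)
      also have "cos \<alpha> ^ (r + 2) * (?m * ((cos (2 * real l * \<alpha>) + cos (2 * real (Suc l) * \<alpha>)) / 2)
          - real (r + 1) * ((cos (2 * real l * \<alpha>) - cos (2 * real (Suc l) * \<alpha>)) / 2)) = f t"
      proof -
        have "w * ((2 * L + 1) * ((A + B) / 2) - (R + 1) * ((A - B) / 2))
            = 1/2 * ((2 * L - R) * (w * A) + (2 * L + 2 + R) * (w * B))" for w A B R L :: real
          by (simp add: field_simps)
        from this[of "cos \<alpha> ^ (r + 2)" "real l" _ _ "real r"] show ?thesis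
          unfolding f_def radial_weight_arctan \<alpha>_def[symmetric]
          by (simp only: of_nat_add of_nat_mult of_nat_numeral of_nat_1)
      qed
      finally show ?thesis .
    qed
    show "isCont f t" for t
      unfolding f_def radial_weight_arctan by (intro continuous_intros isCont_arctan)
    show "integrable lborel f"
      unfolding f_def by (intro integrable_mult_right Bochner_Integration.integrable_add int)
    have le: "norm (F t) \<le> cos (arctan t)" for t
    proof -
      have c: "0 \<le> cos (arctan t)" "cos (arctan t) \<le> 1"
        by (subst cos_arctan, simp) (rule cos_le_one)
      have "cos (arctan t) ^ r * cos (arctan t) \<le> 1 * cos (arctan t)"
        using c by (intro mult_right_mono power_le_one) auto
      then have "cos (arctan t) ^ (r + 1) * \<bar>sin (real (2 * l + 1) * arctan t)\<bar> \<le> cos (arctan t) * 1"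
        using c by (intro mult_mono) (auto simp: mult.commute)
      then show ?thesis
        using c by (simp add: F_def abs_mult)
    qed
    have "((\<lambda>t. cos (arctan t)) \<longlongrightarrow> cos (pi / 2)) at_top"
      by (intro tendsto_intros tendsto_arctan_at_top)
    then show "(F \<longlongrightarrow> 0) at_top"
      using le by (intro Lim_null_comparison[of F "\<lambda>t. cos (arctan t)"] always_eventually) auto
    have "((\<lambda>t. cos (arctan t)) \<longlongrightarrow> cos (- (pi / 2))) at_bot"
      by (intro tendsto_intros tendsto_arctan_at_bot)
    then show "(F \<longlongrightarrow> 0) at_bot"
      using le by (intro Lim_null_comparison[of F "\<lambda>t. cos (arctan t)"] always_eventually) auto
  qed
  moreover have "(\<integral>t. f t \<partial>lborel) = (1/2) * ((2 * real l - real r) * cos_moment r l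
      + (2 * real l + 2 + real r) * cos_moment r (Suc l))"
    unfolding f_def cos_moment_def
    by (simp only: integral_mult_right_zero Bochner_Integration.integral_add integrable_mult_right int)
  ultimately have "(2 * real l + 2 + real r) * cos_moment r (Suc l) = (real r - 2 * real l) * cos_moment r l"
    by (simp add: algebra_simps)
  then show ?thesis
    by (simp add: field_simps)
qed

lemma cos_moment_0_0: "cos_moment 0 0 = pi"
proof -
  have "cos_moment 0 0 = (\<integral>t. inverse (1 + t\<^sup>2) \<partial>lborel)"
    by (simp add: cos_moment_def radial_weight_def inverse_eq_divide)
  also have "\<dots> = pi / 2 - (- (pi / 2))"
  proof (rule lborel_integral_FTC)
    show "(arctan has_real_derivative inverse (1 + t\<^sup>2)) (at t)" for t
      by (rule DERIV_arctan)
    show "isCont (\<lambda>t::real. inverse (1 + t\<^sup>2)) t" for t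
      by (intro continuous_intros) (simp add: sum_power2_eq_zero_iff[of 1, simplified])
    show "integrable lborel (\<lambda>t::real. inverse (1 + t\<^sup>2))"
      using integrable_inverse_1_plus_square by (simp add: set_integrable_def)
  qed (rule tendsto_arctan_at_bot tendsto_arctan_at_top)+
  finally show ?thesis by simp
qed

lemma cos_moment_1_0: "cos_moment 1 0 = 2"
proof -
  have "cos_moment 1 0 = (\<integral>t. radial_weight 1 t \<partial>lborel)"
    by (simp add: cos_moment_def)
  also have "\<dots> = 1 - (- 1)"
  proof (rule lborel_integral_FTC)
    show "((\<lambda>t. sin (arctan t)) has_real_derivative radial_weight 1 t) (at t)" for t
    proof -
      have "((\<lambda>t. sin (arctan t)) has_real_derivative cos (arctan t) * inverse (1 + t\<^sup>2)) (at t)"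
        by (auto intro!: derivative_eq_intros)
      moreover have "inverse (1 + t\<^sup>2) = (cos (arctan t))\<^sup>2"
        by (simp add: cos_arctan power_divide inverse_eq_divide)
      ultimately show ?thesis
        by (simp add: radial_weight_arctan power2_eq_square power3_eq_cube)
    qed
    show "isCont (radial_weight 1) t" for t
      unfolding radial_weight_arctan[abs_def] by (intro continuous_intros isCont_arctan)
    show "integrable lborel (radial_weight 1)"
      by (rule integrable_radial_weight)
    have "((\<lambda>t. sin (arctan t)) \<longlongrightarrow> sin (pi / 2)) at_top"
      by (intro tendsto_intros tendsto_arctan_at_top)
    then show "((\<lambda>t. sin (arctan t)) \<longlongrightarrow> 1) at_top" by simp
    have "((\<lambda>t. sin (arctan t)) \<longlongrightarrow> sin (- (pi / 2))) at_bot"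
      by (intro tendsto_intros tendsto_arctan_at_bot)
    then show "((\<lambda>t. sin (arctan t)) \<longlongrightarrow> - 1) at_bot" by simp
  qed
  finally show ?thesis by simp
qed

lemma cos_moment_add_2: "cos_moment (r + 2) 0 = cos_moment r 0 * (real (r + 1) / real (r + 2))"
proof -
  have int: "integrable lborel (\<lambda>t. radial_weight r t * cos (2 * real l * arctan t))" for l
    by (rule integrable_radial_weight_mult) auto
  have "cos_moment (r + 2) 0 = (\<integral>t. (1/2) * (radial_weight r t * cos (2 * real 0 * arctan t)
      + radial_weight r t * cos (2 * real 1 * arctan t)) \<partial>lborel)"
    unfolding cos_moment_def
  proof (rule Bochner_Integration.integral_cong[OF refl])
    fix t
    have c2: "(cos (arctan t))\<^sup>2 = (1 + cos (2 * arctan t)) / 2"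
      using cos_double_cos[of "arctan t"] by simp
    have "radial_weight (r + 2) t = radial_weight r t * (cos (arctan t))\<^sup>2"
      by (simp add: radial_weight_arctan power_add power2_eq_square)
    then show "radial_weight (r + 2) t * cos (2 * real 0 * arctan t) = (1/2) * (radial_weight r t * cos (2 * real 0 * arctan t)
      + radial_weight r t * cos (2 * real 1 * arctan t))"
      unfolding c2 by (simp add: algebra_simps)
  qed
  also have "\<dots> = (1/2) * (cos_moment r 0 + cos_moment r (Suc 0))"
    unfolding cos_moment_def using int[of 0] int[of 1]
    by (simp only: integral_mult_right_zero Bochner_Integration.integral_add One_nat_def)
  also have "\<dots> = cos_moment r 0 * (real (r + 1) / real (r + 2))"
    unfolding cos_moment_Suc by (simp add: field_simps)
  finally show ?thesis .
qed

text \<open>Separates the rational part of the moments from the single number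
  \<open>cos_moment r 0\<close>, the only place where pi enters. The coefficients of the series thus
  become accessible to integer arithmetic.\<close>

primrec cos_ratio :: "nat \<Rightarrow> nat \<Rightarrow> real" where
  "cos_ratio r 0 = 1"
| "cos_ratio r (Suc l) = cos_ratio r l * ((real r - 2 * real l) / (real r + 2 * real l + 2))"

lemma cos_moment_eq: "cos_moment r l = cos_moment r 0 * cos_ratio r l"
  by (induction l) (simp_all add: cos_moment_Suc)

lemma cos_ratio_abs_le: "\<bar>cos_ratio r l\<bar> \<le> 1"
proof (induction l)
  case (Suc l)
  have "\<bar>(real r - 2 * real l) / (real r + 2 * real l + 2)\<bar> \<le> 1"
    by (simp add: abs_divide)
  from mult_mono[OF Suc this] show ?case
    by (simp add: abs_mult)
qed simp

text \<open>The absolute value of n - 2 i as a natural number, since cosine is even in its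
  frequency.\<close>

abbreviation gap :: "nat \<Rightarrow> nat \<Rightarrow> nat" where
  "gap n i \<equiv> if 2 * i \<le> n then n - 2 * i else 2 * i - n"

definition kernel_coeff :: "nat \<Rightarrow> nat \<Rightarrow> real" where
  "kernel_coeff r n = (-1) ^ n * (\<Sum>i\<le>n. inv_sqrt_coeff i * inv_sqrt_coeff (n - i) *
     cos_ratio r (gap n i))"

lemma kernel_coeff_0 [simp]: "kernel_coeff r 0 = 1"
  by (simp add: kernel_coeff_def)

text \<open>Up to sign the coefficient is an average of values of \<open>cos_ratio\<close>, with the
  weights of \<open>inv_sqrt_coeff_convolution\<close>.\<close>

lemma kernel_coeff_abs_le: "\<bar>kernel_coeff r n\<bar> \<le> 1"
proof -
  have "\<bar>kernel_coeff r n\<bar> = \<bar>\<Sum>i\<le>n. inv_sqrt_coeff i * inv_sqrt_coeff (n - i) *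
     cos_ratio r (gap n i)\<bar>"
    by (simp add: kernel_coeff_def abs_mult[of "(-1) ^ n"] power_abs)
  also have "\<dots> \<le> (\<Sum>i\<le>n. \<bar>inv_sqrt_coeff i * inv_sqrt_coeff (n - i) *
     cos_ratio r (gap n i)\<bar>)"
    by (rule sum_abs)
  also have "\<dots> \<le> (\<Sum>i\<le>n. inv_sqrt_coeff i * inv_sqrt_coeff (n - i))"
    by (intro sum_mono) (simp add: abs_mult inv_sqrt_coeff_bounds mult_left_le cos_ratio_abs_le)
  finally show ?thesis
    by (simp add: inv_sqrt_coeff_convolution)
qed

definition kernel_scale :: "nat \<Rightarrow> real" where
  "kernel_scale r = real r / (2 * pi) * (cos_moment r 0)\<^sup>2"

text \<open>With t = tan \<alpha> and \<rho> = 2 v / (1 + v^2), the radicand 1 - \<rho>^2 (sin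
  \<alpha>)^2 is (1 + 2 v^2 cos (2 \<alpha>) + v^4) / (1 + v^2)^2. The denominators 1 + v^2 cancel
  and leave the trinomial series at x = v^2, integrated term by term.\<close>

theorem rounding_kernel_series:
  assumes "\<bar>v\<bar> < 1"
  shows "(\<lambda>n. 2 * kernel_scale r * (kernel_coeff r n * v ^ (2 * n + 1)))
    sums rounding_kernel r (2 * v / (1 + v\<^sup>2))"
proof -
  let ?J = "cos_moment r 0"
  have v2: "\<bar>v\<^sup>2\<bar> < 1" using assms by (simp add: abs_square_less_1)
  \<comment> \<open>The trigonometric expansion of the Legendre polynomial P_n at cos (2 arctan t);
    the trinomial series is the Legendre generating function.\<close>
  define Q where "Q n t = (\<Sum>i\<le>n. inv_sqrt_coeff i * inv_sqrt_coeff (n - i) *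
      cos ((real n - 2 * real i) * (2 * arctan t)))" for n t
  define g where "g n t = radial_weight r t * ((- v\<^sup>2) ^ n * Q n t)" for n t
  have Q_le: "\<bar>Q n t\<bar> \<le> 1" for n t
  proof -
    have "\<bar>Q n t\<bar> \<le> (\<Sum>i\<le>n. \<bar>inv_sqrt_coeff i * inv_sqrt_coeff (n - i) * cos ((real n - 2 * real i) * (2 * arctan t))\<bar>)"
      unfolding Q_def by (rule sum_abs)
    also have "\<dots> \<le> (\<Sum>i\<le>n. inv_sqrt_coeff i * inv_sqrt_coeff (n - i))"
      by (intro sum_mono) (simp add: abs_mult inv_sqrt_coeff_bounds mult_left_le)
    finally show ?thesis
      by (simp add: inv_sqrt_coeff_convolution)
  qed
  have [measurable]: "Q n \<in> borel_measurable borel" for n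
    unfolding Q_def[abs_def] by measurable
  have intQ: "integrable lborel (\<lambda>t. radial_weight r t * Q n t)" for n
    using Q_le by (intro integrable_radial_weight_mult) auto
  have int: "integrable lborel (g n)" for n
  proof -
    have "integrable lborel (\<lambda>t. (- v\<^sup>2) ^ n * (radial_weight r t * Q n t))"
      using intQ by simp
    then show ?thesis
      by (simp add: g_def[abs_def] mult.left_commute)
  qed
  have w0: "0 \<le> radial_weight r t" for t
    by (simp add: radial_weight_def)
  have norm_le: "norm (g n t) \<le> (v\<^sup>2) ^ n * radial_weight r t" for n t
  proof -
    have "norm (g n t) = (v\<^sup>2) ^ n * radial_weight r t * \<bar>Q n t\<bar>"
      using w0 by (simp add: g_def abs_mult power_abs)
    also have "\<dots> \<le> (v\<^sup>2) ^ n * radial_weight r t * 1"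
      using Q_le w0 by (intro mult_left_mono) auto
    finally show ?thesis by simp
  qed
  have geo: "summable (\<lambda>n. (v\<^sup>2) ^ n * c)" for c
    using v2 by (intro summable_mult2 summable_geometric) simp
  have sg: "(\<lambda>n. integral\<^sup>L lborel (g n)) sums (\<integral>t. (\<Sum>n. g n t) \<partial>lborel)"
  proof (rule sums_integral[OF int])
    show "AE t in lborel. summable (\<lambda>n. norm (g n t))"
      by (intro AE_I2 summable_comparison_test'[OF geo, of 0]) (use norm_le in simp)
    show "summable (\<lambda>n. \<integral>t. norm (g n t) \<partial>lborel)"
    proof (rule summable_comparison_test'[OF geo, of 0])
      fix n
      have "(\<integral>t. norm (g n t) \<partial>lborel) \<le> (\<integral>t. (v\<^sup>2) ^ n * radial_weight r t \<partial>lborel)"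
        using int integrable_radial_weight norm_le by (intro integral_mono) auto
      then show "norm (\<integral>t. norm (g n t) \<partial>lborel) \<le> (v\<^sup>2) ^ n * (\<integral>t. radial_weight r t \<partial>lborel)"
        by (simp add: integral_nonneg_AE)
    qed
  qed
  have Ig: "integral\<^sup>L lborel (g n) = ?J * (kernel_coeff r n * (v\<^sup>2) ^ n)" for n
  proof -
    have "integral\<^sup>L lborel (g n) = (- v\<^sup>2) ^ n * (\<integral>t. radial_weight r t * Q n t \<partial>lborel)"
      by (subst integral_mult_right_zero[symmetric]) (simp add: g_def[abs_def] mult.left_commute)
    also have "(\<lambda>t. radial_weight r t * Q n t) = (\<lambda>t. \<Sum>i\<le>n. inv_sqrt_coeff i * inv_sqrt_coeff (n - i) *
        (radial_weight r t * cos (2 * real (gap n i) * arctan t)))"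
    proof
      fix t
      have "cos ((real n - 2 * real i) * (2 * arctan t))
          = cos (2 * real (gap n i) * arctan t)" for i
      proof (cases "2 * i \<le> n")
        case True
        then show ?thesis by (simp add: of_nat_diff algebra_simps)
      next
        case False
        then have "(real n - 2 * real i) * (2 * arctan t) = - (2 * real (2 * i - n) * arctan t)"
          by (simp add: of_nat_diff algebra_simps)
        then show ?thesis
          using False by (simp only: cos_minus if_False)
      qed
      then show "radial_weight r t * Q n t = (\<Sum>i\<le>n. inv_sqrt_coeff i * inv_sqrt_coeff (n - i) *
        (radial_weight r t * cos (2 * real (gap n i) * arctan t)))"
        unfolding Q_def sum_distrib_left by (intro sum.cong refl) (simp only: ac_simps)
    qed
    also have "(\<integral>t. (\<Sum>i\<le>n. inv_sqrt_coeff i * inv_sqrt_coeff (n - i) *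
        (radial_weight r t * cos (2 * real (gap n i) * arctan t))) \<partial>lborel)
      = (\<Sum>i\<le>n. inv_sqrt_coeff i * inv_sqrt_coeff (n - i) * cos_moment r (gap n i))"
      unfolding cos_moment_def
      by (subst Bochner_Integration.integral_sum)
        (auto intro!: integrable_mult_right integrable_radial_weight_mult)
    also have "\<dots> = ?J * (\<Sum>i\<le>n. inv_sqrt_coeff i * inv_sqrt_coeff (n - i) *
        cos_ratio r (gap n i))"
      unfolding sum_distrib_left by (intro sum.cong refl, subst cos_moment_eq) (simp only: ac_simps)
    finally show ?thesis
      by (simp add: kernel_coeff_def power_minus[of "v\<^sup>2"])
  qed
  have v1: "0 < 1 + v\<^sup>2" using zero_le_power2[of v] by linarith
  have sumg: "(2 * v / (1 + v\<^sup>2)) * (radial_weight r t / sqrt (1 - (2 * v / (1 + v\<^sup>2))\<^sup>2 * t\<^sup>2 / (1 + t\<^sup>2)))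
      = 2 * v * (\<Sum>n. g n t)" for t
  proof -
    define \<alpha> where "\<alpha> = arctan t"
    have s2: "t\<^sup>2 / (1 + t\<^sup>2) = (sin \<alpha>)\<^sup>2"
      by (simp add: \<alpha>_def sin_arctan power_divide)
    have "1 - (2 * v / (1 + v\<^sup>2))\<^sup>2 * t\<^sup>2 / (1 + t\<^sup>2) = 1 - (2 * v / (1 + v\<^sup>2))\<^sup>2 * (sin \<alpha>)\<^sup>2"
      by (simp flip: s2)
    also have "\<dots> = ((1 + v\<^sup>2)\<^sup>2 - 4 * v\<^sup>2 * (sin \<alpha>)\<^sup>2) / (1 + v\<^sup>2)\<^sup>2"
      using v1 by (simp add: field_simps power_mult_distrib)
    also have "(1 + v\<^sup>2)\<^sup>2 - 4 * v\<^sup>2 * (sin \<alpha>)\<^sup>2 = 1 + 2 * v\<^sup>2 * cos (2 * \<alpha>) + (v\<^sup>2)\<^sup>2"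
      unfolding cos_double_sin by (simp add: power2_eq_square algebra_simps)
    finally have "sqrt (1 - (2 * v / (1 + v\<^sup>2))\<^sup>2 * t\<^sup>2 / (1 + t\<^sup>2))
        = sqrt (1 + 2 * v\<^sup>2 * cos (2 * \<alpha>) + (v\<^sup>2)\<^sup>2) / (1 + v\<^sup>2)"
      using v1 by (simp add: real_sqrt_divide)
    moreover have "(\<Sum>n. g n t) = radial_weight r t * (1 / sqrt (1 + 2 * v\<^sup>2 * cos (2 * \<alpha>) + (v\<^sup>2)\<^sup>2))"
      using sums_mult[OF sums_inv_sqrt_trinomial[OF v2, of "2 * \<alpha>"], of "radial_weight r t"]
      by (simp add: g_def Q_def \<alpha>_def sums_iff)
    ultimately show ?thesis
      using v1 by simp
  qed
  have J: "?J = (\<integral>t. radial_weight r t \<partial>lborel)"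
    by (simp add: cos_moment_def)
  have "rounding_kernel r (2 * v / (1 + v\<^sup>2)) = real r / (2 * pi) * ?J *
      (\<integral>t. (2 * v / (1 + v\<^sup>2)) * (radial_weight r t / sqrt (1 - (2 * v / (1 + v\<^sup>2))\<^sup>2 * t\<^sup>2 / (1 + t\<^sup>2))) \<partial>lborel)"
    unfolding rounding_kernel_def J by (simp only: integral_mult_right_zero mult.assoc)
  also have "\<dots> = real r / (2 * pi) * ?J * (2 * v * (\<integral>t. (\<Sum>n. g n t) \<partial>lborel))"
    unfolding sumg by simp
  finally have "rounding_kernel r (2 * v / (1 + v\<^sup>2)) = real r / (2 * pi) * ?J * (2 * v) * (\<integral>t. (\<Sum>n. g n t) \<partial>lborel)"
    by simp
  moreover have "(\<lambda>n. real r / (2 * pi) * ?J * (2 * v) * integral\<^sup>L lborel (g n)) sums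
      (real r / (2 * pi) * ?J * (2 * v) * (\<integral>t. (\<Sum>n. g n t) \<partial>lborel))"
    by (rule sums_mult[OF sg])
  moreover have "real r / (2 * pi) * ?J * (2 * v) * integral\<^sup>L lborel (g n)
      = 2 * kernel_scale r * (kernel_coeff r n * v ^ (2 * n + 1))" for n
    unfolding Ig by (simp add: kernel_scale_def power2_eq_square power_mult)
  ultimately show ?thesis by simp
qed

section \<open>From kernels to Grothendieck constants\<close>

lemma dominated_zero: "dominated V c (\<lambda>u v. 0) 0"
  by (rule dominatedI[where P = "\<lambda>u v. 0"]) (simp_all add: psd_on_def)

lemma dominated_scale:
  assumes fin: "finite V" and dom: "dominated V c K B" and "0 \<le> B" and k: "0 < k"
    and col: "\<And>v. v \<in> V \<Longrightarrow> c v < Suc k"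
  shows "dominated V c (\<lambda>u v. a * K u v) (real k * (\<bar>a\<bar> * B))"
proof (cases "0 \<le> a")
  case True
  have "1 * (\<bar>a\<bar> * B) \<le> real k * (\<bar>a\<bar> * B)"
    using assms(3) k by (intro mult_right_mono) auto
  with dominated_cmult[OF True dom] show ?thesis
    using True by (auto intro: dominated_mono)
next
  case False
  then have "0 \<le> - a" by simp
  from dominated_uminus[OF fin dominated_cmult[OF this dom] k col] False show ?thesis
    by simp
qed

lemma dominated_gram: "psd_on V G \<Longrightarrow> (\<And>v. v \<in> V \<Longrightarrow> G v v = 1) \<Longrightarrow> dominated V c G 1"
  by (rule dominatedI) auto

lemma kernel_scale_nonneg: "0 \<le> kernel_scale r"
  by (simp add: kernel_scale_def)

text \<open>All coefficients are at most 1 in absolute value, so the terms cost no more than a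
  geometric series in b^2. The factor \<open>k\<close> pays for whichever sign a term has.\<close>

lemma dominated_kernel_tail:
  assumes fin: "finite V" and Q: "dominated V c Q b" and b: "0 \<le> b" "b < 1" and k: "0 < k"
    and col: "\<And>v. v \<in> V \<Longrightarrow> c v < Suc k"
  shows "dominated V c (\<lambda>u v. 2 * kernel_scale r * (\<Sum>n<N. kernel_coeff r n * Q u v ^ (2 * n + 1))
      - rounding_kernel r (2 * Q u v / (1 + (Q u v)\<^sup>2)))
    (2 * kernel_scale r * (real k * (b ^ (2 * N + 1) / (1 - b\<^sup>2))))"
proof -
  let ?f = "\<lambda>n u v. 2 * kernel_scale r * (kernel_coeff r n * Q u v ^ (2 * n + 1))"
  have b2: "\<bar>b\<^sup>2\<bar> < 1" using b by (simp add: abs_square_less_1)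
  have "dominated V c (\<lambda>u v. \<Sum>n. - ?f (n + N) u v)
      (\<Sum>n. 2 * kernel_scale r * (real k * (b ^ (2 * N + 1) * (b\<^sup>2) ^ n)))"
  proof (rule dominated_suminf[OF fin])
    fix n
    have "dominated V c (\<lambda>u v. (- (2 * kernel_scale r * kernel_coeff r (n + N))) * Q u v ^ (2 * (n + N) + 1))
        (real k * (\<bar>- (2 * kernel_scale r * kernel_coeff r (n + N))\<bar> * b ^ (2 * (n + N) + 1)))"
      by (rule dominated_scale[OF fin dominated_power[OF fin Q] _ k col]) (use b in auto)
    moreover have "\<bar>- (2 * kernel_scale r * kernel_coeff r (n + N))\<bar> \<le> 2 * kernel_scale r"
      using kernel_coeff_abs_le[of r "n + N"] kernel_scale_nonneg[of r]
      by (simp add: abs_mult mult_left_le)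
    then have "real k * (\<bar>- (2 * kernel_scale r * kernel_coeff r (n + N))\<bar> * b ^ (2 * (n + N) + 1))
        \<le> real k * ((2 * kernel_scale r) * b ^ (2 * (n + N) + 1))"
      using b by (intro mult_left_mono mult_right_mono) auto
    moreover have "b ^ (2 * (n + N) + 1) = b ^ (2 * N + 1) * (b\<^sup>2) ^ n"
      by (simp add: power_mult[symmetric] power_add[symmetric] algebra_simps)
    ultimately show "dominated V c (\<lambda>u v. - ?f (n + N) u v) (2 * kernel_scale r * (real k * (b ^ (2 * N + 1) * (b\<^sup>2) ^ n)))"
      by (auto elim!: dominated_mono[rotated] simp: mult_ac)
  next
    show "summable (\<lambda>n. 2 * kernel_scale r * (real k * (b ^ (2 * N + 1) * (b\<^sup>2) ^ n)))"
      using b2 by (intro summable_mult summable_geometric) simp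
  qed
  moreover have "(\<Sum>n. 2 * kernel_scale r * (real k * (b ^ (2 * N + 1) * (b\<^sup>2) ^ n)))
      = 2 * kernel_scale r * (real k * (b ^ (2 * N + 1) / (1 - b\<^sup>2)))"
    using b2 sums_mult[OF sums_mult[OF sums_mult[OF geometric_sums[of "b\<^sup>2"], of "b ^ (2 * N + 1)"], of "real k"],
        of "2 * kernel_scale r"]
    by (simp add: sums_iff)
  ultimately have dom: "dominated V c (\<lambda>u v. \<Sum>n. - ?f (n + N) u v)
      (2 * kernel_scale r * (real k * (b ^ (2 * N + 1) / (1 - b\<^sup>2))))"
    by simp
  show ?thesis
  proof (rule dominated_cong[OF dom])
    fix u v assume uv: "u \<in> V" "v \<in> V" "c u \<noteq> c v"
    have "\<bar>Q u v\<bar> < 1"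
      using dominated_abs_le[OF fin Q uv] b by simp
    from rounding_kernel_series[OF this, of r]
    have s: "(\<lambda>n. ?f n u v) sums rounding_kernel r (2 * Q u v / (1 + (Q u v)\<^sup>2))" .
    from sums_minus[OF sums_split_initial_segment[OF s, of N]]
    show "(\<Sum>n. - ?f (n + N) u v) = 2 * kernel_scale r * (\<Sum>n<N. kernel_coeff r n * Q u v ^ (2 * n + 1))
      - rounding_kernel r (2 * Q u v / (1 + (Q u v)\<^sup>2))"
      by (simp add: sums_iff sum_distrib_left)
  qed
qed

lemma simple_graph_no_loop: "simple_graph V E \<Longrightarrow> {v} \<notin> E"
  by (force simp: simple_graph_def)

text \<open>For every feasible \<open>f\<close> the error is bounded by \<open>\<epsilon>\<close>
  times the supremum \<open>SDP_inf\<close>, not times the value at \<open>f\<close>. Passing to the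
  supremum over \<open>f\<close> therefore gives an inequality in \<open>SDP_inf\<close> alone, and
  the error can be moved to the left side. No maximizer has to be chosen.\<close>

theorem SDP_inf_le_SDP_of_kernel:
  assumes sg: "simple_graph V E" and "0 < r" and col: "proper_colouring V E k c"
    and "0 \<le> \<epsilon>" "0 < \<beta>"
    and approx: "\<And>G. psd_on V G \<Longrightarrow> (\<And>v. v \<in> V \<Longrightarrow> G v v = 1) \<Longrightarrow>
      \<exists>K. dominated V c K 1 \<and> dominated V c (\<lambda>u v. \<beta> * G u v - rounding_kernel r (K u v)) \<epsilon>"
  shows "(\<beta> - \<epsilon>) * SDP_inf V E A \<le> SDP r V E A"
proof -
  have fin: "finite V" using sg by (simp add: simple_graph_def)
  have edge: "c u \<noteq> c v" if "u \<in> V" "v \<in> V" "{u, v} \<in> E" for u v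
    using col that by (auto simp: proper_colouring_def)
  have no_loop: "{v} \<notin> E" for v using simple_graph_no_loop[OF sg] .
  have main: "\<beta> * sdp_obj (card V) V E A f \<le> SDP r V E A + \<epsilon> * SDP_inf V E A"
    if f: "sphere_map (card V) V f" for f
  proof -
    let ?G = "\<lambda>u v. inner_r (card V) (f u) (f v)"
    obtain K where K: "dominated V c K 1" "dominated V c (\<lambda>u v. \<beta> * ?G u v - rounding_kernel r (K u v)) \<epsilon>"
      using approx[OF psd_on_gram[of V "card V" f]] f by (auto simp: sphere_map_def)
    obtain P where P: "psd_on V P" "\<And>v. v \<in> V \<Longrightarrow> P v v \<le> 1"
      "\<And>u v. u \<in> V \<Longrightarrow> v \<in> V \<Longrightarrow> c u \<noteq> c v \<Longrightarrow> K u v = P u v"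
      using dominatedE[OF K(1)] by blast
    define H where "H u v = P u v + (if u = v then 1 - P u u else 0)" for u v
    have "psd_on V H"
      unfolding H_def by (intro psd_on_add P(1) psd_on_diagonal fin) (use P(2) in auto)
    then have "edge_form V E A (\<lambda>u v. rounding_kernel r (H u v)) \<le> SDP r V E A"
      by (rule edge_form_rounding_le[OF fin \<open>0 < r\<close> no_loop]) (simp add: H_def)
    also have "edge_form V E A (\<lambda>u v. rounding_kernel r (H u v)) = edge_form V E A (\<lambda>u v. rounding_kernel r (K u v))"
    proof (rule edge_form_cong)
      fix u v assume uv: "u \<in> V" "v \<in> V" "{u, v} \<in> E"
      then have "c u \<noteq> c v" "u \<noteq> v" using edge[of u v] by auto
      then show "rounding_kernel r (H u v) = rounding_kernel r (K u v)"
        using P(3)[of u v] uv by (simp add: H_def)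
    qed
    finally have 1: "edge_form V E A (\<lambda>u v. rounding_kernel r (K u v)) \<le> SDP r V E A" .
    have 2: "edge_form V E A (\<lambda>u v. \<beta> * ?G u v - rounding_kernel r (K u v)) \<le> \<epsilon> * SDP_inf V E A"
      by (rule edge_form_dominated_le[OF fin K(2) \<open>0 \<le> \<epsilon>\<close> edge])
    have "\<beta> * sdp_obj (card V) V E A f
        = edge_form V E A (\<lambda>u v. rounding_kernel r (K u v) + (\<beta> * ?G u v - rounding_kernel r (K u v)))"
      by (simp add: sdp_obj_eq_edge_form edge_form_cmult)
    also have "\<dots> = edge_form V E A (\<lambda>u v. rounding_kernel r (K u v))
        + edge_form V E A (\<lambda>u v. \<beta> * ?G u v - rounding_kernel r (K u v))"
      by (rule edge_form_add)
    finally show ?thesis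
      using 1 2 by linarith
  qed
  show ?thesis
  \<comment> \<open>For empty \<open>V\<close> the dimension \<open>card V\<close> is 0, where
    \<open>exists_sphere_map\<close> does not apply.\<close>
  proof (cases "V = {}")
    case True
    then have "sdp_obj n V E A f = 0" for n f
      by (simp add: sdp_obj_def)
    then have "SDP n V E A = 0" for n
      using True by (simp add: SDP_def sphere_map_def)
    then show ?thesis by (simp add: SDP_inf_def)
  next
    case False
    have "SDP_inf V E A \<le> (SDP r V E A + \<epsilon> * SDP_inf V E A) / \<beta>"
      unfolding SDP_inf_def SDP_def[of "card V"]
    proof (rule cSup_least)
      have "0 < card V" using fin False by (simp add: card_gt_0_iff)
      then show "{sdp_obj (card V) V E A f |f. sphere_map (card V) V f} \<noteq> {}"
        using exists_sphere_map by blast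
      fix x assume "x \<in> {sdp_obj (card V) V E A f |f. sphere_map (card V) V f}"
      then show "x \<le> (SDP r V E A + \<epsilon> * Sup {sdp_obj (card V) V E A f |f. sphere_map (card V) V f}) / \<beta>"
        using main \<open>0 < \<beta>\<close> by (auto simp: SDP_inf_def SDP_def[of "card V"] field_simps)
    qed
    then show ?thesis
      using \<open>0 < \<beta>\<close> by (simp add: field_simps)
  qed
qed

lemma suminf_geometric_abs:
  assumes "\<bar>x\<bar> < (1 :: real)" shows "(\<Sum>n. x ^ n) = 1 / (1 - x)"
  using assms by (intro suminf_geometric) simp

text \<open>2 x / (1 + x^2) = (2 x - 2 x^3) / (1 - x^4) gathers the signs into a single negative
  term, for which the factor 2 is paid; the geometric series is positive. At x = 3/8 the cost is
  (3/4 + 4 (3/8)^3) / (1 - (3/8)^4), about 0.98, just within the budget 1.\<close>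

lemma tripartite_kernel:
  assumes fin: "finite V" and col: "\<And>v. v \<in> V \<Longrightarrow> c v < 3"
    and G: "psd_on V G" "\<And>v. v \<in> V \<Longrightarrow> G v v = 1"
  shows "\<exists>K. dominated V c K 1 \<and> dominated V c (\<lambda>u v. (3/4 * kernel_scale r) * G u v - rounding_kernel r (K u v))
    (27/110 * kernel_scale r)"
proof -
  define Q where "Q u v = 3/8 * G u v" for u v
  have col': "c v < Suc 2" if "v \<in> V" for v using col[OF that] by simp
  have Q: "dominated V c Q (3/8)"
    using dominated_cmult[OF _ dominated_gram[OF G], of "3/8"] by (simp add: Q_def[abs_def])
  define K where "K u v = 2 * Q u v / (1 + (Q u v)\<^sup>2)" for u v
  have "dominated V c (\<lambda>u v. 2 * Q u v + (- 2) * Q u v ^ 3) (2 * (3/8) + real 2 * (\<bar>- 2\<bar> * (3/8) ^ 3))"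
    by (intro dominated_add dominated_cmult Q dominated_scale dominated_power fin col') auto
  then have dom: "dominated V c (\<lambda>u v. (2 * Q u v + (- 2) * Q u v ^ 3) * (\<Sum>n. (Q u v ^ 4) ^ n))
      ((2 * (3/8) + real 2 * (\<bar>- 2\<bar> * (3/8) ^ 3)) * (\<Sum>n. ((3/8) ^ 4) ^ n))"
    by (intro dominated_mult fin dominated_suminf dominated_power Q summable_geometric) (auto simp: power_divide)
  have le: "(2 * (3/8) + real 2 * (\<bar>- 2\<bar> * (3/8) ^ 3)) * (\<Sum>n. ((3/8 :: real) ^ 4) ^ n) \<le> 1"
    by (subst suminf_geometric_abs) (simp_all add: power_divide)
  have eq: "(2 * Q u v + (- 2) * Q u v ^ 3) * (\<Sum>n. (Q u v ^ 4) ^ n) = K u v"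
    if uv: "u \<in> V" "v \<in> V" "c u \<noteq> c v" for u v
  proof -
    define x where "x = Q u v"
    have x: "\<bar>x\<bar> \<le> 3/8" unfolding x_def by (rule dominated_abs_le[OF fin Q uv])
    then have x2: "x\<^sup>2 < 1" by (simp add: abs_square_less_1)
    have x4: "\<bar>x ^ 4\<bar> < 1"
      using power_strict_mono[of "\<bar>x\<bar>" 1 4] x by (simp add: power_abs)
    have "1 - x ^ 4 = (1 - x\<^sup>2) * (1 + x\<^sup>2)"
      by (simp add: algebra_simps flip: power_add)
    moreover have "2 * x + (- 2) * x ^ 3 = 2 * x * (1 - x\<^sup>2)"
      by (simp add: algebra_simps power2_eq_square power3_eq_cube)
    ultimately have "(2 * x + (- 2) * x ^ 3) * (1 / (1 - x ^ 4)) = 2 * x / (1 + x\<^sup>2)"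
      using x2 by simp
    then show ?thesis
      using suminf_geometric_abs[OF x4] by (simp add: K_def x_def)
  qed
  have "dominated V c K 1"
    by (rule dominated_cong[OF dominated_mono[OF dom le] eq])
  \<comment> \<open>Only the linear term of the series is kept. In units of
    \<open>kernel_scale r\<close> the rest costs 4 (3/8)^3 / (1 - (3/8)^2) = 27/110.\<close>
  moreover have "dominated V c (\<lambda>u v. (3/4 * kernel_scale r) * G u v - rounding_kernel r (K u v)) (27/110 * kernel_scale r)"
    using dominated_kernel_tail[OF fin Q, of 2 r 1] col'
    by (simp add: Q_def K_def power2_eq_square field_simps)
  ultimately show ?thesis by blast
qed

section \<open>Certified composition of Taylor polynomials\<close>

text \<open>A pair \<open>(xs, e)\<close> stands for any kernel \<open>K\<close> such that the cost of
  \<open>2 ^ 36 * K - (\<Sum>i. xs ! i * G ^ (2 * i))\<close> is at most \<open>e\<close>; see \<open>models\<close> below. The literal 68719476736 is \<open>2 ^ 36\<close>.\<close>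

type_synonym taylor = "int list \<times> int"

definition shift_right :: "int \<Rightarrow> int" where
  "shift_right x = drop_bit 36 x"

fun abs_sum :: "int list \<Rightarrow> int" where
  "abs_sum [] = 0"
| "abs_sum (x # xs) = \<bar>x\<bar> + abs_sum xs"

fun add_coeffs :: "int list \<Rightarrow> int list \<Rightarrow> int list" where
  "add_coeffs [] ys = ys"
| "add_coeffs (x # xs) [] = x # xs"
| "add_coeffs (x # xs) (y # ys) = (x + y) # add_coeffs xs ys"

fun mult_coeffs :: "int list \<Rightarrow> int list \<Rightarrow> int list" where
  "mult_coeffs [] ys = []"
| "mult_coeffs (x # xs) ys = add_coeffs (map ((*) x) ys) (0 # mult_coeffs xs ys)"

fun taylor_add :: "taylor \<Rightarrow> taylor \<Rightarrow> taylor" where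
  "taylor_add (xs, e) (ys, f) = (add_coeffs xs ys, e + f)"

fun taylor_neg :: "taylor \<Rightarrow> taylor" where
  "taylor_neg (xs, e) = (map uminus xs, e)"

fun taylor_shift :: "taylor \<Rightarrow> taylor" where
  "taylor_shift (xs, e) = (0 # xs, e)"

text \<open>Error budget: the two input errors propagated through the product and the full weight of
  the dropped coefficients, all rescaled; \<open>+ 1\<close> rounds this quotient up, and each kept
  coefficient loses at most 1 to the floor.\<close>

fun taylor_mult :: "nat \<Rightarrow> taylor \<Rightarrow> taylor \<Rightarrow> taylor" where
  "taylor_mult M (xs, e) (ys, f) = (let zs = mult_coeffs xs ys; hs = take M zs in
     (map shift_right hs,
      shift_right (e * abs_sum ys + f * abs_sum xs + e * f + abs_sum (drop M zs)) + 1 + int (length hs)))"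

fun product_taylors :: "(int \<Rightarrow> int) \<Rightarrow> (int \<Rightarrow> int) \<Rightarrow> nat \<Rightarrow> int \<Rightarrow> int \<Rightarrow> taylor list" where
  "product_taylors a b 0 l x = []"
| "product_taylors a b (Suc n) l x = ([x], l) # product_taylors a b n (l + 1) (x * a l div b l)"

definition inv_sqrt_taylors :: "nat \<Rightarrow> taylor list" where
  "inv_sqrt_taylors n = product_taylors (\<lambda>l. 2 * l + 1) (\<lambda>l. 2 * l + 2) n 0 68719476736"

definition cos_ratio_taylors :: "nat \<Rightarrow> int \<Rightarrow> taylor list" where
  "cos_ratio_taylors n r = product_taylors (\<lambda>l. r - 2 * l) (\<lambda>l. r + 2 * l + 2) n 0 68719476736"

definition taylor_sum :: "taylor list \<Rightarrow> taylor" where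
  "taylor_sum ts = foldr taylor_add ts ([], 0)"

definition kernel_coeff_taylor :: "taylor list \<Rightarrow> taylor list \<Rightarrow> nat \<Rightarrow> taylor" where
  "kernel_coeff_taylor as cs n =
    (let t = taylor_sum (map (\<lambda>i. taylor_mult 1 (taylor_mult 1 (as ! i) (as ! (n - i)))
         (cs ! (gap n i))) [0..<Suc n])
     in if even n then t else taylor_neg t)"

definition kernel_coeff_taylors :: "nat \<Rightarrow> nat \<Rightarrow> taylor list" where
  "kernel_coeff_taylors n r =
    (let as = inv_sqrt_taylors n; cs = cos_ratio_taylors n (int r)
     in map (kernel_coeff_taylor as cs) [0..<n])"

text \<open>A Horner scheme in the fourth power: within a block of four terms only constants are
  multiplied with polynomials, so each block needs just one product of full length.
  \<open>composed_taylor\<close> supplies a list whose length is a multiple of 4, so the last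
  equation is reached with the empty list.\<close>

fun taylor_series :: "nat \<Rightarrow> taylor \<Rightarrow> taylor \<Rightarrow> taylor \<Rightarrow> taylor \<Rightarrow> taylor list \<Rightarrow> taylor" where
  "taylor_series M w1 w2 w3 w4 (a # b # c # d # ts) =
     taylor_add a (taylor_add (taylor_mult M b w1) (taylor_add (taylor_mult M c w2)
       (taylor_add (taylor_mult M d w3) (taylor_mult M w4 (taylor_series M w1 w2 w3 w4 ts)))))"
| "taylor_series M w1 w2 w3 w4 _ = ([], 0)"

text \<open>All series involved are odd in G; dividing by G makes them polynomials in G^2. With q =
  Q / G, \<open>w1\<close> stands for Q^2 = G^2 q^2, and the result stands for the first 4 n terms
  of the series at Q, divided by G.\<close>

definition composed_taylor :: "nat \<Rightarrow> nat \<Rightarrow> nat \<Rightarrow> int list \<Rightarrow> taylor" where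
  "composed_taylor r M n qs =
    (let w1 = taylor_shift (taylor_mult M (qs, 0) (qs, 0));
         w2 = taylor_mult M w1 w1; w3 = taylor_mult M w1 w2; w4 = taylor_mult M w2 w2
     in taylor_mult M (qs, 0) (taylor_series M w1 w2 w3 w4 (kernel_coeff_taylors (4 * n) r)))"

text \<open>Bounds the cost of 2 q - p (1 + G^2 q^2), which would be 0 if G p were exactly 2 Q / (1
  + Q^2).\<close>

definition residual :: "nat \<Rightarrow> int list \<Rightarrow> int list \<Rightarrow> int" where
  "residual M qs ps =
    (let (ys, f) = taylor_mult M (ps, 0) (taylor_shift (taylor_mult M (qs, 0) (qs, 0)))
     in abs_sum (add_coeffs (add_coeffs qs qs) (map uminus (add_coeffs ps ys))) + f)"

text \<open>The lists \<open>qs\<close> and \<open>ps\<close> are the coefficients of \<open>G, G\<^sup>3, G\<^sup>5, \<dots>\<close> in \<open>Q\<close> and in an approximation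
  to \<open>2 Q / (1 + Q\<^sup>2)\<close>, times \<open>2 ^ 36\<close>. The cost of \<open>Q\<close> is at most \<open>m / 100\<close>, and the last condition gives
  \<open>2 Q / (1 + Q\<^sup>2)\<close> cost at most 1.\<close>

definition certifies :: "nat \<Rightarrow> nat \<Rightarrow> nat \<Rightarrow> int list \<Rightarrow> int list \<Rightarrow> int \<Rightarrow> int \<Rightarrow> bool" where
  "certifies r M n qs ps m low \<longleftrightarrow>
    (case composed_taylor r M n qs of
       ([], e) \<Rightarrow> False
     | (z # zs, e) \<Rightarrow> 0 < low \<and> low \<le> z - abs_sum zs - e) \<and>
    0 \<le> m \<and> m < 100 \<and> 100 * abs_sum qs \<le> m * 68719476736 \<and>
    10000 * residual M qs ps \<le> (68719476736 - abs_sum ps) * (10000 - m * m)"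

primrec peval :: "int list \<Rightarrow> real \<Rightarrow> real" where
  "peval [] y = 0"
| "peval (a # as) y = of_int a + y * peval as y"

abbreviation precision :: real where
  "precision \<equiv> 68719476736"

text \<open>The first neglected power of Q after 4 n terms is 2 (4 n) + 1 = 8 n + 1.\<close>

abbreviation tail_bound :: "int \<Rightarrow> nat \<Rightarrow> real" where
  "tail_bound m n \<equiv> (of_int m / 100) ^ (8 * n + 1) / (1 - (of_int m / 100)\<^sup>2)"

abbreviation certified_ratio :: "nat \<Rightarrow> int \<Rightarrow> int \<Rightarrow> nat \<Rightarrow> real" where
  "certified_ratio r low m n \<equiv> 2 * kernel_scale r * (of_int low / precision - tail_bound m n)"

lemma shift_right_eq: "shift_right x = x div 68719476736"
  by (simp add: shift_right_def drop_bit_eq_div)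

lemma shift_right_bounds: "of_int (shift_right x) \<le> of_int x / precision" "of_int x / precision \<le> of_int (shift_right x) + 1"
proof -
  have "shift_right x = \<lfloor>of_int x / precision\<rfloor>"
    using floor_divide_of_int_eq[of x 68719476736, where 'a = real] by (simp add: shift_right_eq)
  then show "of_int (shift_right x) \<le> of_int x / precision" "of_int x / precision \<le> of_int (shift_right x) + 1"
    by linarith+
qed

lemma abs_sum_nonneg: "0 \<le> abs_sum xs"
  by (induction xs) auto

lemma peval_add_coeffs: "peval (add_coeffs xs ys) y = peval xs y + peval ys y"
  by (induction xs ys rule: add_coeffs.induct) (simp_all add: algebra_simps)

lemma peval_map_mult: "peval (map ((*) a) xs) y = of_int a * peval xs y"
  by (induction xs) (simp_all add: algebra_simps)

lemma peval_map_uminus: "peval (map uminus xs) y = - peval xs y"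
  by (induction xs) simp_all

lemma peval_mult_coeffs: "peval (mult_coeffs xs ys) y = peval xs y * peval ys y"
  by (induction xs) (simp_all add: peval_add_coeffs peval_map_mult algebra_simps)

section \<open>Soundness of the coefficient arithmetic for two colours\<close>

locale bipartite_gram =
  fixes V :: "'v set" and c :: "'v \<Rightarrow> nat" and G :: "'v \<Rightarrow> 'v \<Rightarrow> real"
  assumes fin: "finite V" and col: "\<And>v. v \<in> V \<Longrightarrow> c v < 2"
    and gram: "psd_on V G" "\<And>v. v \<in> V \<Longrightarrow> G v v = 1"
begin

lemma col_Suc: "v \<in> V \<Longrightarrow> c v < Suc 1"
  using col[of v] by simp

lemma dominated_signed:
  assumes "dominated V c K B" "0 \<le> B"
  shows "dominated V c (\<lambda>u v. a * K u v) (\<bar>a\<bar> * B)"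
  using dominated_scale[OF fin assms _ col_Suc, where a = a] by simp

lemma dominated_const: "dominated V c (\<lambda>u v. a) \<bar>a\<bar>"
  using dominated_signed[OF dominated_one, of a] by simp

lemma dominated_minus: "dominated V c K B \<Longrightarrow> dominated V c (\<lambda>u v. - K u v) B"
  using dominated_uminus[OF fin _ _ col_Suc, where K = K and B = B] by simp

lemma dominated_diff:
  "dominated V c K B \<Longrightarrow> dominated V c L B' \<Longrightarrow> dominated V c (\<lambda>u v. K u v - L u v) (B + B')"
  using dominated_add[OF _ dominated_minus, of K B L B'] by simp

lemma dominated_G: "dominated V c G 1"
  by (rule dominated_gram[OF gram])

lemma dominated_square_mult: "dominated V c K B \<Longrightarrow> dominated V c (\<lambda>u v. (G u v)\<^sup>2 * K u v) B"
  using dominated_mult[OF fin dominated_power[OF fin dominated_G, of 2]] by force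

lemma dominated_peval: "dominated V c (\<lambda>u v. peval xs ((G u v)\<^sup>2)) (of_int (abs_sum xs))"
proof (induction xs)
  case Nil
  then show ?case using dominated_zero by simp
next
  case (Cons a xs)
  from dominated_add[OF dominated_const[of "of_int a"] dominated_square_mult[OF Cons]]
  show ?case by simp
qed

lemma dominated_rounding:
  "dominated V c (\<lambda>u v. peval zs ((G u v)\<^sup>2) / precision - peval (map shift_right (take M zs)) ((G u v)\<^sup>2))
    (real (length (take M zs)) + of_int (abs_sum (drop M zs)) / precision)"
proof (induction zs arbitrary: M)
  case Nil
  then show ?case using dominated_zero by simp
next
  case (Cons z zs)
  show ?case
  proof (cases M)
    case 0
    have "dominated V c (\<lambda>u v. (1 / precision) * peval (z # zs) ((G u v)\<^sup>2)) ((1 / precision) * of_int (abs_sum (z # zs)))"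
      by (rule dominated_cmult[OF _ dominated_peval]) simp
    then show ?thesis
      using 0 by simp
  next
    case (Suc N)
    have "\<bar>of_int z / precision - of_int (shift_right z)\<bar> \<le> 1"
      using shift_right_bounds[of z] by linarith
    with dominated_const[of "of_int z / precision - of_int (shift_right z)"]
    have "dominated V c (\<lambda>u v. of_int z / precision - of_int (shift_right z)) 1"
      by (rule dominated_mono)
    from dominated_add[OF this dominated_square_mult[OF Cons[of N]]]
    have "dominated V c (\<lambda>u v. of_int z / precision - of_int (shift_right z) + (G u v)\<^sup>2 *
        (peval zs ((G u v)\<^sup>2) / precision - peval (map shift_right (take N zs)) ((G u v)\<^sup>2)))
      (1 + (real (length (take N zs)) + of_int (abs_sum (drop N zs)) / precision))" .
    then show ?thesis
      unfolding Suc by (simp add: algebra_simps add_divide_distrib)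
  qed
qed

definition models :: "('v \<Rightarrow> 'v \<Rightarrow> real) \<Rightarrow> taylor \<Rightarrow> bool" where
  "models K X \<longleftrightarrow> 0 \<le> snd X \<and>
     dominated V c (\<lambda>u v. precision * K u v - peval (fst X) ((G u v)\<^sup>2)) (of_int (snd X))"

lemma models_const:
  assumes "\<bar>precision * a - of_int x\<bar> \<le> of_int l" shows "models (\<lambda>u v. a) ([x], l)"
proof -
  have "dominated V c (\<lambda>u v. precision * a - of_int x) (of_int l)"
    by (rule dominated_mono[OF dominated_const assms])
  moreover have "0 \<le> l"
    using assms by linarith
  ultimately show ?thesis
    by (simp add: models_def)
qed

lemma models_zero: "models (\<lambda>u v. 0) ([], 0)"
  using dominated_zero by (simp add: models_def)

lemma models_exact:
  assumes "\<And>u v. precision * K u v = peval xs ((G u v)\<^sup>2)"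
  shows "models K (xs, 0)"
  using dominated_zero assms by (simp add: models_def)

lemma models_add: "models K X \<Longrightarrow> models L Y \<Longrightarrow> models (\<lambda>u v. K u v + L u v) (taylor_add X Y)"
proof (cases X; cases Y)
  fix xs e ys f assume X: "X = (xs, e)" and Y: "Y = (ys, f)" and "models K X" "models L Y"
  then have "dominated V c (\<lambda>u v. (precision * K u v - peval xs ((G u v)\<^sup>2)) + (precision * L u v - peval ys ((G u v)\<^sup>2)))
      (of_int e + of_int f)"
    by (intro dominated_add) (simp_all add: models_def)
  then show ?thesis
    using X Y \<open>models K X\<close> \<open>models L Y\<close> by (simp add: models_def peval_add_coeffs algebra_simps)
qed

lemma models_neg: "models K X \<Longrightarrow> models (\<lambda>u v. - K u v) (taylor_neg X)"
proof (cases X)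
  fix xs e assume X: "X = (xs, e)" and "models K X"
  then show ?thesis
    using dominated_minus[of "\<lambda>u v. precision * K u v - peval xs ((G u v)\<^sup>2)" "of_int e"]
    by (simp add: models_def peval_map_uminus algebra_simps)
qed

lemma models_shift: "models K X \<Longrightarrow> models (\<lambda>u v. (G u v)\<^sup>2 * K u v) (taylor_shift X)"
proof (cases X)
  fix xs e assume X: "X = (xs, e)" and "models K X"
  then show ?thesis
    using dominated_square_mult[of "\<lambda>u v. precision * K u v - peval xs ((G u v)\<^sup>2)" "of_int e"]
    by (simp add: models_def algebra_simps)
qed

lemma models_mult: "models K X \<Longrightarrow> models L Y \<Longrightarrow> models (\<lambda>u v. K u v * L u v) (taylor_mult M X Y)"
proof (cases X; cases Y)
  fix xs e ys f assume X: "X = (xs, e)" and Y: "Y = (ys, f)" and "models K X" "models L Y"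
  then have e: "0 \<le> e" and f: "0 \<le> f"
    and DK: "dominated V c (\<lambda>u v. precision * K u v - peval xs ((G u v)\<^sup>2)) (of_int e)" (is "dominated V c ?DK _")
    and DL: "dominated V c (\<lambda>u v. precision * L u v - peval ys ((G u v)\<^sup>2)) (of_int f)" (is "dominated V c ?DL _")
    by (simp_all add: models_def)
  let ?zs = "mult_coeffs xs ys"
  let ?x = "e * abs_sum ys + f * abs_sum xs + e * f"
  let ?s = "abs_sum (drop M ?zs)" and ?n = "length (take M ?zs)"
  \<comment> \<open>With x, y the two polynomials, the first line is (x + DK) (y + DL) - x y,
    scaled; the second is the rounding and truncation error of the polynomial product.\<close>
  have "dominated V c (\<lambda>u v. (1 / precision) * (?DK u v * peval ys ((G u v)\<^sup>2) + ?DL u v * peval xs ((G u v)\<^sup>2) + ?DK u v * ?DL u v)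
      + (peval ?zs ((G u v)\<^sup>2) / precision - peval (map shift_right (take M ?zs)) ((G u v)\<^sup>2)))
    ((1 / precision) * (of_int e * of_int (abs_sum ys) + of_int f * of_int (abs_sum xs) + of_int e * of_int f)
      + (real ?n + of_int ?s / precision))"
    by (intro dominated_add dominated_cmult dominated_mult fin DK DL dominated_peval dominated_rounding) simp_all
  then have dom: "dominated V c (\<lambda>u v. precision * (K u v * L u v) - peval (map shift_right (take M ?zs)) ((G u v)\<^sup>2))
    ((1 / precision) * (of_int e * of_int (abs_sum ys) + of_int f * of_int (abs_sum xs) + of_int e * of_int f)
      + (real ?n + of_int ?s / precision))"
    by (rule dominated_cong) (simp add: peval_mult_coeffs field_simps)
  have "(1 / precision) * (of_int e * of_int (abs_sum ys) + of_int f * of_int (abs_sum xs) + of_int e * of_int f)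
      + (real ?n + of_int ?s / precision) = of_int (?x + ?s) / precision + real ?n"
    by (simp add: field_simps)
  also have "\<dots> \<le> of_int (shift_right (?x + ?s) + 1 + int ?n)"
    using shift_right_bounds(2)[of "?x + ?s"] by simp
  finally have "dominated V c (\<lambda>u v. precision * (K u v * L u v) - peval (map shift_right (take M ?zs)) ((G u v)\<^sup>2))
      (of_int (shift_right (?x + ?s) + 1 + int ?n))"
    by (rule dominated_mono[OF dom])
  moreover have "0 \<le> shift_right (?x + ?s)"
    using e f by (simp add: shift_right_def abs_sum_nonneg)
  ultimately show ?thesis
    unfolding X Y taylor_mult.simps Let_def models_def fst_conv snd_conv by linarith
qed

text \<open>The error grows by at most 1 per step: a factor of absolute value at most 1 does not
  enlarge the old error, and the integer division adds at most 1. This is why the index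
  \<open>l\<close> itself serves as error bound.\<close>

lemma models_product_taylors:
  fixes s :: "nat \<Rightarrow> real" and a b :: "int \<Rightarrow> int"
  defines "q \<equiv> \<lambda>l. of_int (a (int l)) / of_int (b (int l))"
  assumes s: "\<And>l. s (Suc l) = s l * q l" and q: "\<And>l. \<bar>q l\<bar> \<le> 1"
    and "\<bar>precision * s l - of_int x\<bar> \<le> real l" "i < n"
  shows "models (\<lambda>u v. s (l + i)) (product_taylors a b n (int l) x ! i)"
  using assms(4,5)
proof (induction n arbitrary: l x i)
  case (Suc n)
  show ?case
  proof (cases i)
    case 0
    then show ?thesis
      using models_const[of "s l" x "int l"] Suc.prems by simp
  next
    case (Suc j)
    let ?x = "x * a (int l) div b (int l)"
    have "?x = \<lfloor>of_int (x * a (int l)) / real_of_int (b (int l))\<rfloor>"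
      by (rule floor_divide_of_int_eq[symmetric])
    then have "\<bar>of_int x * q l - of_int ?x\<bar> \<le> 1"
      unfolding q_def of_int_mult times_divide_eq_right by linarith
    moreover have "precision * s (Suc l) - of_int x * q l = (precision * s l - of_int x) * q l"
      by (simp add: s algebra_simps)
    moreover have "\<bar>(precision * s l - of_int x) * q l\<bar> \<le> real l * 1"
      unfolding abs_mult using Suc.prems(1) q by (intro mult_mono) auto
    ultimately have "\<bar>precision * s (Suc l) - of_int ?x\<bar> \<le> real (Suc l)"
      by simp
    from Suc.IH[OF this, of j] show ?thesis
      using Suc.prems Suc by (simp add: add.commute)
  qed
qed simp

lemma models_sum:
  assumes "\<And>i. i \<in> set is \<Longrightarrow> models (\<lambda>u v. a i) (t i)"
  shows "models (\<lambda>u v. \<Sum>i\<leftarrow>is. a i) (taylor_sum (map t is))"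
  using assms
proof (induction "is")
  case Nil
  then show ?case using models_zero by (simp add: taylor_sum_def)
next
  case (Cons i "is")
  then have "models (\<lambda>u v. \<Sum>i\<leftarrow>is. a i) (taylor_sum (map t is))" "models (\<lambda>u v. a i) (t i)"
    by simp_all
  from models_add[OF this(2,1)] show ?case
    by (simp add: taylor_sum_def)
qed

lemma models_kernel_coeff_taylors:
  assumes "k < n"
  shows "models (\<lambda>u v. kernel_coeff r k) (kernel_coeff_taylors n r ! k)"
proof -
  define as where "as = inv_sqrt_taylors n"
  define cs where "cs = cos_ratio_taylors n (int r)"
  have as: "models (\<lambda>u v. inv_sqrt_coeff i) (as ! i)" if "i < n" for i
    using models_product_taylors[of inv_sqrt_coeff "\<lambda>l. 2 * l + 1" "\<lambda>l. 2 * l + 2" 0 68719476736 i n] that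
    by (simp add: as_def inv_sqrt_taylors_def inv_sqrt_coeff_Suc add.commute)
  have cs: "models (\<lambda>u v. cos_ratio r i) (cs ! i)" if "i < n" for i
    using models_product_taylors[of "cos_ratio r" "\<lambda>l. int r - 2 * l" "\<lambda>l. int r + 2 * l + 2" 0 68719476736 i n]
      that by (simp add: cs_def cos_ratio_taylors_def abs_divide)
  let ?l = "gap k"
  let ?t = "\<lambda>i. taylor_mult 1 (taylor_mult 1 (as ! i) (as ! (k - i))) (cs ! ?l i)"
  let ?a = "\<lambda>i. inv_sqrt_coeff i * inv_sqrt_coeff (k - i) * cos_ratio r (?l i)"
  have "models (\<lambda>u v. ?a i) (?t i)" if "i \<in> set [0..<Suc k]" for i
    using that assms by (intro models_mult as cs) auto
  then have sum: "models (\<lambda>u v. \<Sum>i\<leftarrow>[0..<Suc k]. ?a i) (taylor_sum (map ?t [0..<Suc k]))"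
    by (rule models_sum)
  have "(\<Sum>i\<leftarrow>[0..<Suc k]. ?a i) = (\<Sum>i\<le>k. ?a i)"
    unfolding interv_sum_list_conv_sum_set_nat by (rule sum.cong) auto
  then have kc: "kernel_coeff r k = (if even k then \<Sum>i\<leftarrow>[0..<Suc k]. ?a i else - (\<Sum>i\<leftarrow>[0..<Suc k]. ?a i))"
    by (simp only: kernel_coeff_def) simp
  have "models (\<lambda>u v. kernel_coeff r k) (kernel_coeff_taylor as cs k)"
  proof (cases "even k")
    case True
    show ?thesis
      unfolding kernel_coeff_taylor_def Let_def kc if_P[OF True] by (rule sum)
  next
    case False
    show ?thesis
      unfolding kernel_coeff_taylor_def Let_def kc if_not_P[OF False] by (rule models_neg[OF sum])
  qed
  then show ?thesis
    using assms by (simp add: kernel_coeff_taylors_def as_def cs_def)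
qed

primrec horner :: "real list \<Rightarrow> real \<Rightarrow> real" where
  "horner [] w = 0"
| "horner (a # as) w = a + w * horner as w"

lemma models_series:
  assumes w: "models W w1" "models (\<lambda>u v. W u v ^ 2) w2" "models (\<lambda>u v. W u v ^ 3) w3"
      "models (\<lambda>u v. W u v ^ 4) w4"
    and "length as = 4 * n" "length ts = 4 * n"
    and "\<And>i. i < 4 * n \<Longrightarrow> models (\<lambda>u v. as ! i) (ts ! i)"
  shows "models (\<lambda>u v. horner as (W u v)) (taylor_series M w1 w2 w3 w4 ts)"
  using assms(5-)
proof (induction n arbitrary: as ts)
  case 0
  then show ?case using models_zero by simp
next
  case (Suc n)
  have "length as = Suc (Suc (Suc (Suc (4 * n))))" "length ts = Suc (Suc (Suc (Suc (4 * n))))"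
    using Suc.prems by simp_all
  then obtain a0 a1 a2 a3 as' t0 t1 t2 t3 ts' where
    as: "as = a0 # a1 # a2 # a3 # as'" "length as' = 4 * n" and
    ts: "ts = t0 # t1 # t2 # t3 # ts'" "length ts' = 4 * n"
    by (auto simp: length_Suc_conv)
  have m: "models (\<lambda>u v. a0) t0" "models (\<lambda>u v. a1) t1" "models (\<lambda>u v. a2) t2" "models (\<lambda>u v. a3) t3"
    using Suc.prems(3)[of 0] Suc.prems(3)[of 1] Suc.prems(3)[of 2] Suc.prems(3)[of 3] by (simp_all add: as ts)
  have IH: "models (\<lambda>u v. horner as' (W u v)) (taylor_series M w1 w2 w3 w4 ts')"
  proof (rule Suc.IH[OF as(2) ts(2)])
    fix i assume "i < 4 * n"
    then show "models (\<lambda>u v. as' ! i) (ts' ! i)"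
      using Suc.prems(3)[of "i + 4"] by (simp add: as ts numeral_eq_Suc)
  qed
  have "horner as (W u v) = a0 + (a1 * W u v + (a2 * W u v ^ 2 + (a3 * W u v ^ 3 + W u v ^ 4 * horner as' (W u v))))" for u v
    by (simp add: as algebra_simps power2_eq_square power3_eq_cube power4_eq_xxxx)
  moreover have "models (\<lambda>u v. a0 + (a1 * W u v + (a2 * W u v ^ 2 + (a3 * W u v ^ 3 + W u v ^ 4 * horner as' (W u v)))))
      (taylor_series M w1 w2 w3 w4 ts)"
    unfolding ts taylor_series.simps by (intro models_add models_mult m w IH)
  ultimately show ?case
    by simp
qed

lemma horner_map_upt: "horner (map f [0..<n]) w = (\<Sum>k<n. f k * w ^ k)"
proof -
  have "horner as w = (\<Sum>k<length as. as ! k * w ^ k)" for as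
    by (induction as) (simp_all add: sum.lessThan_Suc_shift sum_distrib_left algebra_simps del: sum.lessThan_Suc)
  from this[of "map f [0..<n]"] show ?thesis
    by simp
qed

text \<open>Only the linear coefficient \<open>z\<close> is useful; the other coefficients
  \<open>zs\<close>, nearly cancelled by the choice of \<open>qs\<close>, are charged to the error
  like the arithmetic error \<open>e\<close> and the tail. The cost of 2 Q / (1 + Q^2) is estimated
  through its polynomial approximation \<open>ps\<close>, as direct expansion would lose the
  cancellation of signs.\<close>

theorem certified_kernel:
  assumes cert: "certifies r M n qs ps m low" and zs: "composed_taylor r M n qs = (z # zs, e)"
  shows "0 \<le> e" and "\<exists>K. dominated V c K 1 \<and>
    dominated V c (\<lambda>u v. (2 * kernel_scale r * (of_int z / precision)) * G u v - rounding_kernel r (K u v))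
      (2 * kernel_scale r * ((of_int e + of_int (abs_sum zs)) / precision + tail_bound m n))"
proof -
  define b where "b = real_of_int m / 100"
  have m: "0 \<le> m" "m < 100" "100 * abs_sum qs \<le> m * 68719476736"
    "10000 * residual M qs ps \<le> (68719476736 - abs_sum ps) * (10000 - m * m)"
    using cert by (simp_all add: certifies_def)
  have b: "0 \<le> b" "b < 1"
    using m by (simp_all add: b_def)
  have b2: "b\<^sup>2 < 1"
    using b by (simp add: abs_square_less_1)
  define q where "q u v = peval qs ((G u v)\<^sup>2) / precision" for u v
  define p where "p u v = peval ps ((G u v)\<^sup>2) / precision" for u v
  define Q where "Q u v = G u v * q u v" for u v
  define W where "W u v = (G u v)\<^sup>2 * (q u v * q u v)" for u v
  have W: "W u v = (Q u v)\<^sup>2" for u v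
    by (simp add: W_def Q_def power2_eq_square)
  have "dominated V c Q (1 * ((1 / precision) * of_int (abs_sum qs)))"
    unfolding Q_def q_def using dominated_mult[OF fin dominated_G dominated_cmult[OF _ dominated_peval, of "1 / precision" qs]]
    by simp
  moreover have "real_of_int (100 * abs_sum qs) \<le> real_of_int (m * 68719476736)"
    using m(3) by (rule of_int_le_iff[THEN iffD2])
  then have "1 * ((1 / precision) * of_int (abs_sum qs)) \<le> b"
    by (simp add: b_def)
  ultimately have Q: "dominated V c Q b"
    by (rule dominated_mono)
  have q: "models q (qs, 0)" and p: "models p (ps, 0)"
    by (auto simp: q_def p_def intro!: models_exact)
  define w1 where "w1 = taylor_shift (taylor_mult M (qs, 0) (qs, 0))"
  define w2 where "w2 = taylor_mult M w1 w1"
  define w3 where "w3 = taylor_mult M w1 w2"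
  define w4 where "w4 = taylor_mult M w2 w2"
  have w1: "models W w1"
    unfolding W_def[abs_def] w1_def by (intro models_shift models_mult q)
  have "models (\<lambda>u v. W u v * W u v) w2"
    unfolding w2_def by (intro models_mult w1)
  then have w2: "models (\<lambda>u v. W u v ^ 2) w2"
    by (simp add: power2_eq_square)
  have "models (\<lambda>u v. W u v * W u v ^ 2) w3"
    unfolding w3_def by (intro models_mult w1 w2)
  then have w3: "models (\<lambda>u v. W u v ^ 3) w3"
    by (simp add: power2_eq_square power3_eq_cube mult.assoc)
  have "models (\<lambda>u v. W u v ^ 2 * W u v ^ 2) w4"
    unfolding w4_def by (intro models_mult w2)
  then have w4: "models (\<lambda>u v. W u v ^ 4) w4"
    by (simp flip: power_add)
  let ?h = "\<lambda>u v. horner (map (kernel_coeff r) [0..<4 * n]) (W u v)"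
  have "models ?h (taylor_series M w1 w2 w3 w4 (kernel_coeff_taylors (4 * n) r))"
  proof (rule models_series[OF w1 w2 w3 w4])
    show "length (kernel_coeff_taylors (4 * n) r) = 4 * n"
      by (simp add: kernel_coeff_taylors_def Let_def)
    show "models (\<lambda>u v. map (kernel_coeff r) [0..<4 * n] ! i) (kernel_coeff_taylors (4 * n) r ! i)" if "i < 4 * n" for i
      using models_kernel_coeff_taylors[OF that, of r] that by simp
  qed simp
  from models_mult[OF q this, of M] have "models (\<lambda>u v. q u v * ?h u v) (z # zs, e)"
    using zs by (simp add: composed_taylor_def Let_def w1_def w2_def w3_def w4_def)
  then have Z: "dominated V c (\<lambda>u v. precision * (q u v * ?h u v) - peval (z # zs) ((G u v)\<^sup>2)) (of_int e)"
    and e: "0 \<le> e"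
    by (simp_all add: models_def)
  show "0 \<le> e" by (rule e)
  \<comment> \<open>Adding back the part of \<open>zs\<close> to the modelling error leaves exactly
    the deviation of the truncated series from its linear term.\<close>
  have "dominated V c (\<lambda>u v. - ((1 / precision) * (G u v * (precision * (q u v * ?h u v) - peval (z # zs) ((G u v)\<^sup>2))
      + G u v * ((G u v)\<^sup>2 * peval zs ((G u v)\<^sup>2)))))
    ((1 / precision) * (1 * of_int e + 1 * of_int (abs_sum zs)))"
    by (intro dominated_minus dominated_cmult dominated_add dominated_mult fin dominated_G Z dominated_square_mult
        dominated_peval) simp
  then have D1: "dominated V c (\<lambda>u v. of_int z / precision * G u v - Q u v * ?h u v) ((of_int e + of_int (abs_sum zs)) / precision)"
    by (simp add: Q_def algebra_simps)
  have h: "Q u v * ?h u v = (\<Sum>k<4 * n. kernel_coeff r k * Q u v ^ (2 * k + 1))" for u v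
    unfolding horner_map_upt sum_distrib_left
    by (intro sum.cong refl) (simp add: W power_mult)
  define K where "K u v = 2 * Q u v / (1 + (Q u v)\<^sup>2)" for u v
  have "dominated V c (\<lambda>u v. (2 * kernel_scale r) * (of_int z / precision * G u v - Q u v * ?h u v)
      + (2 * kernel_scale r * (\<Sum>k<4 * n. kernel_coeff r k * Q u v ^ (2 * k + 1)) - rounding_kernel r (K u v)))
    ((2 * kernel_scale r) * ((of_int e + of_int (abs_sum zs)) / precision)
      + 2 * kernel_scale r * (real 1 * (b ^ (2 * (4 * n) + 1) / (1 - b\<^sup>2))))"
    unfolding K_def using kernel_scale_nonneg[of r]
    by (intro dominated_add dominated_cmult D1 dominated_kernel_tail fin Q b col_Suc) simp_all
  then have "dominated V c (\<lambda>u v. (2 * kernel_scale r * (of_int z / precision)) * G u v - rounding_kernel r (K u v))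
      (2 * kernel_scale r * ((of_int e + of_int (abs_sum zs)) / precision + b ^ (8 * n + 1) / (1 - b\<^sup>2)))"
    unfolding h by (simp add: algebra_simps)
  moreover have "dominated V c K 1"
  proof -
    obtain ys f where ys: "taylor_mult M (ps, 0) w1 = (ys, f)"
      by (cases "taylor_mult M (ps, 0) w1")
    let ?l = "add_coeffs (add_coeffs qs qs) (map uminus (add_coeffs ps ys))"
    from models_mult[OF p w1, of M] have Y: "dominated V c (\<lambda>u v. precision * (p u v * W u v) - peval ys ((G u v)\<^sup>2)) (of_int f)"
      and f: "0 \<le> f"
      unfolding ys by (simp_all add: models_def)
    have d: "residual M qs ps = abs_sum ?l + f"
      using ys by (simp add: residual_def w1_def)
    \<comment> \<open>With \<open>R_eq\<close> this gives 2 Q / (1 + Q^2) = G p + R / (1 + Q^2). The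
      geometric series of the last quotient in - Q^2 costs at most 1 / (1 - b^2), which is the
      meaning of the last condition in \<open>certifies\<close>.\<close>
    define R where "R u v = G u v * ((1 / precision) * (peval ?l ((G u v)\<^sup>2) - (precision * (p u v * W u v) - peval ys ((G u v)\<^sup>2))))" for u v
    have R: "dominated V c R (1 * ((1 / precision) * (of_int (abs_sum ?l) + of_int f)))"
      unfolding R_def by (intro dominated_mult dominated_cmult dominated_diff fin dominated_G dominated_peval Y) simp
    have R_eq: "R u v = 2 * Q u v - G u v * p u v * (1 + W u v)" for u v
      by (simp add: R_def Q_def q_def p_def peval_add_coeffs peval_map_uminus field_simps)
    have "dominated V c (\<lambda>u v. \<Sum>k. (- ((Q u v)\<^sup>2)) ^ k) (\<Sum>k. (b\<^sup>2) ^ k)"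
      using b2 by (intro dominated_suminf fin dominated_power dominated_minus Q summable_geometric) simp_all
    then have "dominated V c (\<lambda>u v. G u v * ((1 / precision) * peval ps ((G u v)\<^sup>2)) + R u v * (\<Sum>k. (- ((Q u v)\<^sup>2)) ^ k))
        (1 * ((1 / precision) * of_int (abs_sum ps)) + 1 * ((1 / precision) * (of_int (abs_sum ?l) + of_int f)) * (\<Sum>k. (b\<^sup>2) ^ k))"
      by (intro dominated_add dominated_mult dominated_cmult fin dominated_G dominated_peval R) simp_all
    moreover have "1 * ((1 / precision) * of_int (abs_sum ps)) + 1 * ((1 / precision) * (of_int (abs_sum ?l) + of_int f)) * (\<Sum>k. (b\<^sup>2) ^ k) \<le> 1"
    proof -
      have "real_of_int (10000 * (abs_sum ?l + f)) \<le> real_of_int ((68719476736 - abs_sum ps) * (10000 - m * m))"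
        using m(4) unfolding d by (rule of_int_le_iff[THEN iffD2])
      then have "of_int (abs_sum ?l) + of_int f \<le> (precision - of_int (abs_sum ps)) * (1 - b\<^sup>2)"
        by (simp add: b_def power2_eq_square field_simps)
      then have "(of_int (abs_sum ?l) + of_int f) / (1 - b\<^sup>2) \<le> precision - of_int (abs_sum ps)"
        using b2 by (simp add: pos_divide_le_eq)
      moreover have "(\<Sum>k. (b\<^sup>2) ^ k) = 1 / (1 - b\<^sup>2)"
        using b2 by (intro suminf_geometric_abs) simp
      ultimately have "(of_int (abs_sum ps) + (of_int (abs_sum ?l) + of_int f) * (\<Sum>k. (b\<^sup>2) ^ k)) / precision \<le> 1"
        by simp
      moreover have "1 * ((1 / precision) * a) + 1 * ((1 / precision) * x) * y = (a + x * y) / precision" for a x y :: real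
        by (simp add: add_divide_distrib)
      ultimately show ?thesis
        by (simp only:)
    qed
    ultimately have dom: "dominated V c (\<lambda>u v. G u v * ((1 / precision) * peval ps ((G u v)\<^sup>2)) + R u v * (\<Sum>k. (- ((Q u v)\<^sup>2)) ^ k)) 1"
      by (rule dominated_mono)
    show ?thesis
    proof (rule dominated_cong[OF dom])
      fix u v assume uv: "u \<in> V" "v \<in> V" "c u \<noteq> c v"
      have "\<bar>Q u v\<bar> < 1"
        using dominated_abs_le[OF fin Q uv] b by simp
      then have "\<bar>- ((Q u v)\<^sup>2)\<bar> < 1"
        by (simp add: abs_square_less_1)
      then have s: "(\<Sum>k. (- ((Q u v)\<^sup>2)) ^ k) = 1 / (1 - - ((Q u v)\<^sup>2))"
        by (rule suminf_geometric_abs)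
      have "0 < 1 + (Q u v)\<^sup>2"
        using zero_le_power2[of "Q u v"] by linarith
      then show "G u v * ((1 / precision) * peval ps ((G u v)\<^sup>2)) + R u v * (\<Sum>k. (- ((Q u v)\<^sup>2)) ^ k) = K u v"
        unfolding s R_eq W K_def by (simp add: p_def field_simps)
    qed
  qed
  ultimately show "\<exists>K. dominated V c K 1 \<and>
    dominated V c (\<lambda>u v. (2 * kernel_scale r * (of_int z / precision)) * G u v - rounding_kernel r (K u v))
      (2 * kernel_scale r * ((of_int e + of_int (abs_sum zs)) / precision + tail_bound m n))"
    unfolding b_def by blast
qed

end

theorem SDP_inf_le_SDP_certified:
  assumes sg: "simple_graph V E" and "0 < r" and col: "proper_colouring V E 2 c"
    and cert: "certifies r M n qs ps m low" and ks: "0 < kernel_scale r"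
  shows "certified_ratio r low m n * SDP_inf V E A \<le> SDP r V E A"
proof -
  let ?t = "tail_bound m n"
  obtain z zs e where zs: "composed_taylor r M n qs = (z # zs, e)" and low: "0 < low" "low \<le> z - abs_sum zs - e"
    using cert by (auto simp: certifies_def split: prod.splits list.splits)
  have m: "0 \<le> m" "m < 100" using cert by (simp_all add: certifies_def)
  have fin: "finite V" using sg by (simp add: simple_graph_def)
  have col': "c v < 2" if "v \<in> V" for v
    using col that by (simp add: proper_colouring_def)
  have edge: "c u \<noteq> c v" if "u \<in> V" "v \<in> V" "{u, v} \<in> E" for u v
    using col that by (auto simp: proper_colouring_def)
  have bg: "bipartite_gram V c G" if "psd_on V G" "\<And>v. v \<in> V \<Longrightarrow> G v v = 1" for G
    by (rule bipartite_gram.intro) (use fin col' that in auto)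
  \<comment> \<open>The number \<open>e\<close> does not depend on the Gram matrix, so the all-ones
    kernel can serve as an instance.\<close>
  have e: "0 \<le> e"
    by (rule bipartite_gram.certified_kernel(1)[OF bg[OF psd_on_one] cert zs]) simp
  have t: "0 \<le> ?t"
    using m by (intro divide_nonneg_nonneg) (auto simp: power_le_one)
  let ?\<beta> = "2 * kernel_scale r * (of_int z / precision)"
  let ?\<epsilon> = "2 * kernel_scale r * ((of_int e + of_int (abs_sum zs)) / precision + ?t)"
  have "(?\<beta> - ?\<epsilon>) * SDP_inf V E A \<le> SDP r V E A"
  proof (rule SDP_inf_le_SDP_of_kernel[OF sg \<open>0 < r\<close> col])
    show "0 \<le> ?\<epsilon>"
      using ks e t abs_sum_nonneg[of zs] by simp
    show "0 < ?\<beta>"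
      using ks e low abs_sum_nonneg[of zs] by simp
    show "\<exists>K. dominated V c K 1 \<and> dominated V c (\<lambda>u v. ?\<beta> * G u v - rounding_kernel r (K u v)) ?\<epsilon>"
      if "psd_on V G" "\<And>v. v \<in> V \<Longrightarrow> G v v = 1" for G
      by (rule bipartite_gram.certified_kernel(2)[OF bg[OF that] cert zs])
  qed
  \<comment> \<open>The zero kernel is dominated at cost 1 and has edge sum 0. Nonnegativity is what
    allows the factor to be lowered to the certified ratio.\<close>
  moreover have "0 \<le> SDP_inf V E A"
    using edge_form_dominated_le[OF fin dominated_mono[OF dominated_zero, of 1 V c] _ edge, where A = A]
    by (simp add: edge_form_def)
  moreover have "2 * kernel_scale r * (of_int low / precision - ?t) \<le> ?\<beta> - ?\<epsilon>"
  proof -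
    have "real_of_int low / precision \<le> (of_int z - of_int (abs_sum zs) - of_int e) / precision"
      using low(2) by (intro divide_right_mono) linarith+
    then have "real_of_int low / precision - ?t \<le> of_int z / precision - ((of_int e + of_int (abs_sum zs)) / precision + ?t)"
      by (simp add: add_divide_distrib diff_divide_distrib)
    from mult_left_mono[OF this, of "2 * kernel_scale r"] ks show ?thesis
      by (simp add: right_diff_distrib)
  qed
  ultimately show ?thesis
    by (meson mult_right_mono order_trans)
qed

section \<open>The table\<close>

text \<open>\<open>LEAST\<close> yields a colouring only if one exists; since there are no loops, an
  injective numbering of the finite vertex set is proper.\<close>

lemma chromatic_number_colouring:
  assumes "simple_graph V E"
  shows "\<exists>c. proper_colouring V E (chromatic_number V E) c"
proof -
  have "finite V" using assms by (simp add: simple_graph_def)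
  then obtain n and f :: "'a \<Rightarrow> nat" where f: "f ` V = {i. i < n}" "inj_on f V"
    using finite_imp_inj_to_nat_seg[of V] by auto
  have "proper_colouring V E n f"
    unfolding proper_colouring_def
  proof (intro conjI ballI impI)
    fix v assume "v \<in> V"
    then show "f v < n" using f(1) by blast
  next
    fix u v assume uv: "u \<in> V" "v \<in> V" "{u, v} \<in> E"
    then have "u \<noteq> v" using simple_graph_no_loop[OF assms, of u] by auto
    then show "f u \<noteq> f v" using f(2) uv by (auto dest: inj_onD)
  qed
  then have "\<exists>k c. proper_colouring V E k c" by (intro exI)
  then show ?thesis
    unfolding chromatic_number_def by (rule LeastI_ex[of "\<lambda>k. \<exists>c. proper_colouring V E k c"])
qed

lemma chromatic_number_gt_1_imp_edge:
  assumes "1 < chromatic_number V E" shows "E \<noteq> {}"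
proof
  assume "E = {}"
  then have "proper_colouring V E 1 (\<lambda>_. 0)"
    by (simp add: proper_colouring_def)
  then have "\<exists>c. proper_colouring V E 1 c"
    by (rule exI[where x = "\<lambda>_. 0"])
  then have "chromatic_number V E \<le> 1"
    unfolding chromatic_number_def by (rule Least_le[of "\<lambda>k. \<exists>c. proper_colouring V E k c"])
  then show False using assms by simp
qed

lemma exists_decimal_bound:
  fixes K L a :: real
  assumes "K \<le> 1 / L" "0 < L" "1 < L * (a + 1 / 1000000)"
  shows "\<exists>\<alpha>. a \<le> \<alpha> \<and> \<alpha> < a + 10 powr (-6) \<and> K \<le> \<alpha>"
proof -
  have "(10 :: real) powr (-6) = 1 / 1000000"
    by (simp add: powr_minus inverse_eq_divide)
  moreover have "1 / L < a + 1 / 1000000"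
    using assms by (simp add: pos_divide_less_eq mult.commute)
  ultimately show ?thesis
    \<comment> \<open>The maximum is taken because \<open>1 / L\<close> may lie below
      \<open>a\<close>, whereas the witness must lie in the interval starting at
      \<open>a\<close>.\<close>
    using assms(1) by (intro exI[of _ "max a (1 / L)"]) auto
qed

section \<open>Wallis integrals and numerical values\<close>

lemma cos_moment_0_values:
  "cos_moment 1 0 = 2" "cos_moment 2 0 = pi / 2" "cos_moment 3 0 = 4 / 3" "cos_moment 4 0 = 3 * pi / 8"
  "cos_moment 5 0 = 16 / 15" "cos_moment 6 0 = 5 * pi / 16" "cos_moment 7 0 = 32 / 35"
  "cos_moment 8 0 = 35 * pi / 128" "cos_moment 9 0 = 256 / 315" "cos_moment 10 0 = 63 * pi / 256"
proof -
  show 1: "cos_moment 1 0 = 2" by (rule cos_moment_1_0)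
  show 2: "cos_moment 2 0 = pi / 2"
    using cos_moment_add_2[of 0] cos_moment_0_0 by (simp add: numeral_2_eq_2)
  show 3: "cos_moment 3 0 = 4 / 3"
    using cos_moment_add_2[of 1] 1 by (simp add: numeral_3_eq_3)
  show 4: "cos_moment 4 0 = 3 * pi / 8"
    using cos_moment_add_2[of 2] 2 by simp
  show 5: "cos_moment 5 0 = 16 / 15"
    using cos_moment_add_2[of 3] 3 by simp
  show 6: "cos_moment 6 0 = 5 * pi / 16"
    using cos_moment_add_2[of 4] 4 by simp
  show 7: "cos_moment 7 0 = 32 / 35"
    using cos_moment_add_2[of 5] 5 by simp
  show 8: "cos_moment 8 0 = 35 * pi / 128"
    using cos_moment_add_2[of 6] 6 by simp
  show 9: "cos_moment 9 0 = 256 / 315"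
    using cos_moment_add_2[of 7] 7 by simp
  show 10: "cos_moment 10 0 = 63 * pi / 256"
    using cos_moment_add_2[of 8] 8 by simp
qed

text \<open>The Wallis integrals contain pi exactly for even r, so the scale is a rational multiple
  of pi for even r and of 1 / pi for odd r. The shape "rational times pi or 1 / pi" is the one that
  \<open>scaled_bound\<close> matches.\<close>

lemma kernel_scale_values:
  "kernel_scale 1 = 2 * (1 / pi)" "kernel_scale 2 = 1 / 4 * pi"
  "kernel_scale 3 = 8 / 3 * (1 / pi)" "kernel_scale 4 = 9 / 32 * pi"
  "kernel_scale 5 = 128 / 45 * (1 / pi)" "kernel_scale 6 = 75 / 256 * pi"
  "kernel_scale 7 = 512 / 175 * (1 / pi)" "kernel_scale 8 = 1225 / 4096 * pi"
  "kernel_scale 9 = 32768 / 11025 * (1 / pi)" "kernel_scale 10 = 19845 / 65536 * pi"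
  unfolding kernel_scale_def cos_moment_0_values by (simp_all add: power2_eq_square)

lemma inverse_pi_ge: "10000000000000 / 31415926535899 \<le> 1 / pi"
  using pi_approx(2) by (simp add: field_simps)

lemma cos_moment_pos: "0 < cos_moment r 0"
proof (induction r rule: induct_nat_012)
  case 0
  then show ?case by (simp add: cos_moment_0_0)
next
  case 1
  then show ?case using cos_moment_1_0 by simp
next
  case (ge2 r)
  then show ?case using cos_moment_add_2[of r] by simp
qed

lemma kernel_scale_pos: "0 < r \<Longrightarrow> 0 < kernel_scale r"
  using cos_moment_pos[of r] by (simp add: kernel_scale_def)

lemma bipartite_table_bound:
  assumes sg: "simple_graph V E" and "0 < r" and cert: "certifies r M n qs ps m low"
    and chrom: "chromatic_number V E = 2"
    and a: "1 < certified_ratio r low m n * (a + 1 / 1000000)"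
    and "0 \<le> a"
  shows "\<exists>\<alpha>. a \<le> \<alpha> \<and> \<alpha> < a + 10 powr (-6) \<and> groth_K r V E \<le> \<alpha>"
proof -
  let ?L = "certified_ratio r low m n"
  have L: "0 < ?L"
    by (rule zero_less_mult_pos2[of _ "a + 1 / 1000000"]) (use a \<open>0 \<le> a\<close> in linarith)+
  obtain c where c: "proper_colouring V E 2 c"
    using chromatic_number_colouring[OF sg] chrom by auto
  have "finite V" using sg by (simp add: simple_graph_def)
  then have "groth_K r V E \<le> 1 / ?L"
    using chrom
    by (intro groth_K_le \<open>0 < r\<close> sg L SDP_inf_le_SDP_certified[OF sg \<open>0 < r\<close> c cert kernel_scale_pos[OF \<open>0 < r\<close>]]
        chromatic_number_gt_1_imp_edge[of V]) simp_all
  then show ?thesis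
    using L a by (rule exists_decimal_bound)
qed

lemma tripartite_table_bound:
  assumes sg: "simple_graph V E" and "0 < r" and chrom: "chromatic_number V E = 3"
    and a: "1 < 111 / 220 * kernel_scale r * (a + 1 / 1000000)"
  shows "\<exists>\<alpha>. a \<le> \<alpha> \<and> \<alpha> < a + 10 powr (-6) \<and> groth_K r V E \<le> \<alpha>"
proof -
  let ?L = "3/4 * kernel_scale r - 27/110 * kernel_scale r"
  have ks: "0 < kernel_scale r" using kernel_scale_pos[OF \<open>0 < r\<close>] .
  have fin: "finite V" using sg by (simp add: simple_graph_def)
  obtain c where c: "proper_colouring V E 3 c"
    using chromatic_number_colouring[OF sg] chrom by auto
  then have col: "c v < 3" if "v \<in> V" for v
    using that by (simp add: proper_colouring_def)
  have "groth_K r V E \<le> 1 / ?L"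
  proof (rule groth_K_le[OF fin \<open>0 < r\<close> _ sg])
    show "E \<noteq> {}" using chrom by (intro chromatic_number_gt_1_imp_edge[of V]) simp
    show "0 < ?L" using ks by simp
    show "?L * SDP_inf V E A \<le> SDP r V E A" for A
    proof (rule SDP_inf_le_SDP_of_kernel[OF sg \<open>0 < r\<close> c])
      show "\<exists>K. dominated V c K 1 \<and>
          dominated V c (\<lambda>u v. 3/4 * kernel_scale r * G u v - rounding_kernel r (K u v)) (27/110 * kernel_scale r)"
        if "psd_on V G" "\<And>v. v \<in> V \<Longrightarrow> G v v = 1" for G
        by (rule tripartite_kernel[OF fin col that])
    qed (use ks in simp_all)
  qed
  then show ?thesis
    by (rule exists_decimal_bound) (use ks a in simp_all)
qed

lemma table_bounds:
  assumes "simple_graph V E" "0 < r" "certifies r M n qs ps m low"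
    and "1 < certified_ratio r low m n * (a + 1 / 1000000)"
    and "1 < 111 / 220 * kernel_scale r * (c + 1 / 1000000)"
    and "a_tab ! (r - 1) = a" "c_tab ! (r - 1) = c" "0 \<le> a"
  shows "(chromatic_number V E = 2 \<longrightarrow>
            (\<exists>\<alpha>::real. a_tab ! (r - 1) \<le> \<alpha> \<and> \<alpha> < a_tab ! (r - 1) + 10 powr (-6)
                       \<and> groth_K r V E \<le> \<alpha>))
       \<and> (chromatic_number V E = 3 \<longrightarrow>
            (\<exists>\<gamma>::real. c_tab ! (r - 1) \<le> \<gamma> \<and> \<gamma> < c_tab ! (r - 1) + 10 powr (-6)
                       \<and> groth_K r V E \<le> \<gamma>))"
  unfolding assms(6,7)
  by (intro conjI impI bipartite_table_bound[OF assms(1-3) _ assms(4,8)]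
      tripartite_table_bound[OF assms(1,2) _ assms(5)])

text \<open>Here \<open>q\<close> is pi or 1 / pi and \<open>p\<close> a rational lower bound for
  it, so that a comparison of rationals remains for the simplifier.\<close>

lemma scaled_bound:
  fixes p q s x y :: real
  assumes "p \<le> q" "0 \<le> s" "0 \<le> x" "0 \<le> y" "1 < 2 * (s * p) * x * y"
  shows "1 < 2 * (s * q) * x * y"
proof -
  have "2 * (s * p) * x * y \<le> 2 * (s * q) * x * y"
    using assms(1-4) by (intro mult_right_mono mult_left_mono) auto
  then show ?thesis using assms(5) by linarith
qed

lemma scaled_bound':
  fixes p q s y :: real
  assumes "p \<le> q" "0 \<le> s" "0 \<le> y" "1 < 111 / 220 * (s * p) * y"
  shows "1 < 111 / 220 * (s * q) * y"
proof -
  have "111 / 220 * (s * p) * y \<le> 111 / 220 * (s * q) * y"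
    using assms(1-3) by (intro mult_right_mono mult_left_mono) auto
  then show ?thesis using assms(4) by linarith
qed

text \<open>The coefficient lists come from inverting the power series of the rounding kernel numerically.\<close>

lemma certificate_1:
  "certifies 1 14 4
  [30283765781, 1960418053, 152289076, 11970945, 942082, 74148, 5836, 459, 36, 2, 0, 0, 0, 0]
  [60567531563, -7841672215, 304578153, -5633386, 60779, -429, 2]
     48 30283765709"
  by code_simp

lemma certificate_2:
  "certifies 2 18 3
  [31139505595, 3197020752, 656461398, 185342761, 61410840, 22289183, 8579140, 3440597, 1422388,
  601950, 259516, 113586, 50341, 22547, 10190, 4641, 2128, 981]
  [62279011190, -6394041505, 0, -33698683, -8649414, -2664045, -893470, -318716, -119031, -46057,
  -18329, -7463, -3096, -1305, -558, -241, -105, -46]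
     52 31139502004"
  by code_simp

lemma certificate_3:
  "certifies 3 22 4
  [31604251285, 4010772986, 1082617156, 389501624, 160941848, 72075165, 34026425, 16674257, 8401209,
  4324876, 2264886, 1202787, 646214, 350611, 191832, 105723, 58638, 32705, 18332, 10321, 5834, 3310]
  [63208502571, -5347697315, -96950790, -44657688, -13529952, -4812455, -1881402, -786294, -345259,
  -157475, -74022, -35656, -17527, -8764, -4446, -2284, -1186, -622, -329, -175, -94, -50]
     55 31604235402"
  by code_simp

lemma certificate_4:
  "certifies 4 30 4
  [31958992327, 4608167806, 1432724231, 583825869, 270973868, 135755094, 71526922, 39058674,
  21906372, 12543702, 7302468, 4309110, 2571555, 1549313, 941077, 575678, 354339, 219294, 136377,
  85179, 53410, 33608, 21216, 13432, 8527, 5426, 3461, 2212, 1417, 909]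
  [63917984654, -4608167806, -124584715, -44909682, -14300124, -5362976, -2226646, -993177, -467170,
  -228932, -115895, -60245, -32012, -17329, -9530, -5313, -2998, -1709, -984, -571, -334, -196,
  -116, -69, -41, -25, -15, -9, -5, -3]
     57 31958985882"
  by code_simp

lemma certificate_5:
  "certifies 5 36 4
  [32237369037, 5067468398, 1720585499, 757812183, 378433072, 203526776, 114966379, 67250015,
  40380573, 24744534, 15411507, 9727169, 6207856, 3999184, 2597138, 1698431, 1117513, 739262,
  491390, 328033, 219830, 147834, 99734, 67480, 45778, 31132, 21220, 14494, 9919, 6801, 4670, 3212,
  2213, 1526, 1054, 729]
  [64474738075, -4053974719, -127450777, -41039938, -13173942, -5012063, -2124347, -971766, -470474,
  -237994, -124677, -67207, -37099, -20895, -11973, -6964, -4104, -2446, -1473, -895, -549, -339,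
  -210, -131, -83, -52, -33, -21, -13, -8, -5, -3, -2, -1, -1]
     60 32237361949"
  by code_simp

lemma certificate_6:
  "certifies 6 42 5
  [32460706225, 5432196461, 1959531245, 910517020, 478300176, 270208706, 160200468, 98306515,
  61903517, 39771833, 25967123, 17178902, 11490572, 7757691, 5279513, 3617981, 2494456, 1729079,
  1204276, 842351, 591469, 416758, 294587, 208834, 148437, 105766, 75532, 54054, 38758, 27841,
  20033, 14437, 10420, 7531, 5450, 3949, 2865, 2081, 1513, 1101, 802, 584]
  [64921412451, -3621464307, -121208118, -36060080, -11440482, -4329779, -1835809, -843657, -411744,
  -210560, -111778, -61185, -34359, -19718, -11529, -6851, -4129, -2521, -1556, -970, -610, -387,
  -247, -159, -103, -67, -44, -29, -19, -12, -8, -5, -3, -2, -1, -1]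
     62 32460698907"
  by code_simp

lemma certificate_7:
  "certifies 7 50 5
  [32643249608, 5728962776, 2160122642, 1043864490, 569131507, 333388207, 204844333, 130230946,
  84943774, 56522092, 38216701, 26180843, 18132963, 12676051, 8932212, 6337779, 4524248, 3246987,
  2341443, 1695664, 1232724, 899299, 658140, 483047, 355479, 262242, 193896, 143663, 106652, 79319,
  59091, 44091, 32948, 24655, 18474, 13859, 10410, 7827, 5892, 4439, 3348, 2527, 1909, 1443, 1092,
  827, 627, 475, 360, 274]
  [65286499217, -3273693015, -111923452, -31169477, -9671329, -3601550, -1510154, -689032, -334948,
  -171072, -90912, -49917, -28168, -16270, -9588, -5750, -3502, -2162, -1351, -854, -545, -351,
  -227, -149, -98, -65, -43, -29, -19, -13, -9, -6, -4, -2, -2, -1]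
     63 32643245060"
  by code_simp

lemma certificate_8:
  "certifies 8 58 6
  [32794862367, 5975135206, 2330398835, 1160434395, 651000194, 392119045, 247648554, 161800958,
  108442479, 74140071, 51503022, 36248766, 25792808, 18523685, 13409466, 9774523, 7168180, 5285009,
  3915170, 2912785, 2175383, 1630329, 1225718, 924195, 698700, 529517, 402208, 306147, 233483,
  178389, 136526, 104653, 80340, 61761, 47542, 36641, 28273, 21840, 16889, 13073, 10129, 7855, 6097,
  4736, 3682, 2864, 2230, 1737, 1354, 1056, 824, 644, 503, 393, 307, 240, 188, 147]
  [65589724735, -2987567603, -102061262, -26786066, -8080872, -2942229, -1211726, -545002, -261953,
  -132626, -70023, -38272, -21536, -12423, -7322, -4397, -2685, -1663, -1044, -663, -426, -276,
  -180, -119, -79, -53, -35, -24, -16, -11, -7, -5, -3, -2, -1, -1]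
     65 32794859173"
  by code_simp

lemma certificate_9:
  "certifies 9 60 6
  [32922555756, 6182594482, 2476448853, 1262722706, 724575581, 446194730, 288030841, 192319021,
  131717880, 92020023, 65318154, 46974139, 34152626, 25061673, 18537443, 13806666, 10345626,
  7793782, 5899403, 4484573, 3422190, 2620593, 2013130, 1550965, 1198082, 927756, 720051, 560018,
  436401, 340689, 266419, 208670, 163683, 128573, 101128, 79640, 62791, 49562, 39161, 30974, 24521,
  19431, 15410, 12231, 9716, 7724, 6144, 4891, 3896, 3105, 2477, 1976, 1578, 1261, 1008, 806, 645,
  516, 413, 331]
  [65845111512, -2747819770, -92618746, -23006699, -6726170, -2385366, -960846, -424111, -200616,
  -100204, -52304, -28316, -15809, -9061, -5314, -3179, -1936, -1197, -751, -477, -307, -199, -130,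
  -86, -57, -38, -26, -17, -12, -8, -5, -4, -2, -2, -1, -1]
     66 32922548044"
  by code_simp

lemma certificate_10:
  "certifies 10 62 6
  [33031431712, 6359767815, 2602915167, 1352922056, 790715241, 495766086, 325785579, 221419748,
  154354335, 109755090, 79293568, 58039159, 42947990, 32076319, 24147929, 18305208, 13960433,
  10704025, 8246397, 6380213, 4955376, 3862168, 3019693, 2367844, 1861650, 1467257, 1159035, 917481,
  727685, 578199, 460201, 366865, 292894, 234165, 187459, 150255, 120576, 96867, 77901, 62712,
  50532, 40754, 32897, 26576, 21487, 17385, 14076, 11405, 9247, 7502, 6090, 4946, 4020, 3268, 2659,
  2164, 1762, 1436, 1170, 954, 778, 635]
  [66062863424, -2543907126, -83965005, -19803788, -5600862, -1930368, -758547, -327646, -152068,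
  -74697, -38422, -20534, -11335, -6434, -3741, -2222, -1344, -827, -517, -327, -210, -136, -89,
  -59, -39, -26, -18, -12, -8, -5, -4, -2, -2, -1, -1]
     67 33031415173"
  by code_simp

lemma certified_bounds_1:
  "1 < certified_ratio 1 30283765709 48 4 * (1.782213 + 1 / 1000000)"
  "1 < 111 / 220 * kernel_scale 1 * (3.264251 + 1 / 1000000)"
  unfolding kernel_scale_values
  by (rule scaled_bound[OF inverse_pi_ge] scaled_bound'[OF inverse_pi_ge]; simp add: power_divide)+

lemma certified_bounds_2:
  "1 < certified_ratio 2 31139502004 52 3 * (1.404909 + 1 / 1000000)"
  "1 < 111 / 220 * kernel_scale 2 * (2.621596 + 1 / 1000000)"
  unfolding kernel_scale_values
  by (rule scaled_bound[OF pi_approx(1)] scaled_bound'[OF pi_approx(1)]; simp add: power_divide)+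

lemma certified_bounds_3:
  "1 < certified_ratio 3 31604235402 55 4 * (1.280812 + 1 / 1000000)"
  "1 < 111 / 220 * kernel_scale 3 * (2.412700 + 1 / 1000000)"
  unfolding kernel_scale_values
  by (rule scaled_bound[OF inverse_pi_ge] scaled_bound'[OF inverse_pi_ge]; simp add: power_divide)+

lemma certified_bounds_4:
  "1 < certified_ratio 4 31958985882 57 4 * (1.216786 + 1 / 1000000)"
  "1 < 111 / 220 * kernel_scale 4 * (2.309224 + 1 / 1000000)"
  unfolding kernel_scale_values
  by (rule scaled_bound[OF pi_approx(1)] scaled_bound'[OF pi_approx(1)]; simp add: power_divide)+

lemma certified_bounds_5:
  "1 < certified_ratio 5 32237361949 60 4 * (1.177179 + 1 / 1000000)"
  "1 < 111 / 220 * kernel_scale 5 * (2.247399 + 1 / 1000000)"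
  unfolding kernel_scale_values
  by (rule scaled_bound[OF inverse_pi_ge] scaled_bound'[OF inverse_pi_ge]; simp add: power_divide)+

lemma certified_bounds_6:
  "1 < certified_ratio 6 32460698907 62 5 * (1.150060 + 1 / 1000000)"
  "1 < 111 / 220 * kernel_scale 6 * (2.206258 + 1 / 1000000)"
  unfolding kernel_scale_values
  by (rule scaled_bound[OF pi_approx(1)] scaled_bound'[OF pi_approx(1)]; simp add: power_divide)+

lemma certified_bounds_7:
  "1 < certified_ratio 7 32643245060 63 5 * (1.130249 + 1 / 1000000)"
  "1 < 111 / 220 * kernel_scale 7 * (2.176891 + 1 / 1000000)"
  unfolding kernel_scale_values
  by (rule scaled_bound[OF inverse_pi_ge] scaled_bound'[OF inverse_pi_ge]; simp add: power_divide)+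

lemma certified_bounds_8:
  "1 < certified_ratio 8 32794859173 65 6 * (1.115110 + 1 / 1000000)"
  "1 < 111 / 220 * kernel_scale 8 * (2.154868 + 1 / 1000000)"
  unfolding kernel_scale_values
  by (rule scaled_bound[OF pi_approx(1)] scaled_bound'[OF pi_approx(1)]; simp add: power_divide)+

lemma certified_bounds_9:
  "1 < certified_ratio 9 32922548044 66 6 * (1.103150 + 1 / 1000000)"
  "1 < 111 / 220 * kernel_scale 9 * (2.137736 + 1 / 1000000)"
  unfolding kernel_scale_values
  by (rule scaled_bound[OF inverse_pi_ge] scaled_bound'[OF inverse_pi_ge]; simp add: power_divide)+

lemma certified_bounds_10:
  "1 < certified_ratio 10 33031415173 67 6 * (1.093456 + 1 / 1000000)"
  "1 < 111 / 220 * kernel_scale 10 * (2.124024 + 1 / 1000000)"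
  unfolding kernel_scale_values
  by (rule scaled_bound[OF pi_approx(1)] scaled_bound'[OF pi_approx(1)]; simp add: power_divide)+

theorem theorem1p1:
  fixes r :: nat and V :: "'v set" and E :: "'v set set"
  assumes "r \<in> {1..10}" and "simple_graph V E"
  shows "(chromatic_number V E = 2 \<longrightarrow>
            (\<exists>\<alpha>::real. a_tab ! (r - 1) \<le> \<alpha> \<and> \<alpha> < a_tab ! (r - 1) + 10 powr (-6)
                       \<and> groth_K r V E \<le> \<alpha>))
       \<and> (chromatic_number V E = 3 \<longrightarrow>
            (\<exists>\<gamma>::real. c_tab ! (r - 1) \<le> \<gamma> \<and> \<gamma> < c_tab ! (r - 1) + 10 powr (-6)
                       \<and> groth_K r V E \<le> \<gamma>))"
proof -
  have "r = 1 \<or> r = 2 \<or> r = 3 \<or> r = 4 \<or> r = 5 \<or> r = 6 \<or> r = 7 \<or> r = 8 \<or> r = 9 \<or> r = 10"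
    using assms(1) by (simp, presburger)
  then consider
    "r = 1"
    | "r = 2"
    | "r = 3"
    | "r = 4"
    | "r = 5"
    | "r = 6"
    | "r = 7"
    | "r = 8"
    | "r = 9"
    | "r = 10"
    by blast
  then show ?thesis
  proof cases
  case 1
  show ?thesis
    unfolding 1 by (rule table_bounds[OF assms(2) _ certificate_1 certified_bounds_1])
      (simp_all add: a_tab_def c_tab_def)
next
  case 2
  show ?thesis
    unfolding 2 by (rule table_bounds[OF assms(2) _ certificate_2 certified_bounds_2])
      (simp_all add: a_tab_def c_tab_def)
next
  case 3
  show ?thesis
    unfolding 3 by (rule table_bounds[OF assms(2) _ certificate_3 certified_bounds_3])
      (simp_all add: a_tab_def c_tab_def)
next
  case 4
  show ?thesis
    unfolding 4 by (rule table_bounds[OF assms(2) _ certificate_4 certified_bounds_4])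
      (simp_all add: a_tab_def c_tab_def)
next
  case 5
  show ?thesis
    unfolding 5 by (rule table_bounds[OF assms(2) _ certificate_5 certified_bounds_5])
      (simp_all add: a_tab_def c_tab_def)
next
  case 6
  show ?thesis
    unfolding 6 by (rule table_bounds[OF assms(2) _ certificate_6 certified_bounds_6])
      (simp_all add: a_tab_def c_tab_def)
next
  case 7
  show ?thesis
    unfolding 7 by (rule table_bounds[OF assms(2) _ certificate_7 certified_bounds_7])
      (simp_all add: a_tab_def c_tab_def)
next
  case 8
  show ?thesis
    unfolding 8 by (rule table_bounds[OF assms(2) _ certificate_8 certified_bounds_8])
      (simp_all add: a_tab_def c_tab_def)
next
  case 9
  show ?thesis
    unfolding 9 by (rule table_bounds[OF assms(2) _ certificate_9 certified_bounds_9])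
      (simp_all add: a_tab_def c_tab_def)
next
  case 10
  show ?thesis
    unfolding 10 by (rule table_bounds[OF assms(2) _ certificate_10 certified_bounds_10])
      (simp_all add: a_tab_def c_tab_def)
  qed
qed

end
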